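(* Let $\mathcal H$ be a complex separable Hilbert space. Suppose $M:\mathbb C_+\to\mathcal B(\mathcal H)$ is a Herglotz operator and $M(z_0)^{-1}\in\mathcal B(\mathcal H)$ for some (and hence for all) $z_0\in\mathbb C_+$. Then there exist an operator $C=C^*\in\mathcal B(\mathcal H)$ and a family of bounded self-adjoint weakly (Lebesgue) measurable operators $\{\Xi(\lambda)\}_{\lambda\in\mathbb R}\subset\mathcal B(\mathcal H)$ with $$0\le\Xi(\lambda)\le I_{\mathcal H}\quad\text{for a.e. }\lambda\in\mathbb R,$$ such that $$\log(M(z))=C+\int_{\mathbb R}d\lambda\,\Xi(\lambda)\big((\lambda-z)^{-1}-\lambda(1+\lambda^2)^{-1}\big),\quad z\in\mathbb C_+,$$ the integral being taken in the weak sense. Moreover, if $\operatorname{Im}(\log(M(z_0)))\in\mathcal B_1(\mathcal H)$ for some (and hence for all) $z_0\in\mathbb C_+$, then $$0\le\Xi(\lambda)\in\mathcal B_1(\mathcal H)\quad\text{for a.e. }\lambda\in\mathbb R,$$ $$0\le\operatorname{tr}_{\mathcal H}(\Xi(\cdot))\in L^1_{\rm loc}(\mathbb R;d\lambda),\qquad \int_{\mathbb R}d\lambda\,(1+\lambda^2)^{-1}\operatorname{tr}_{\mathcal H}(\Xi(\lambda))<\infty,$$ and $$\operatorname{tr}_{\mathcal H}(\operatorname{Im}(\log(M(z))))=\operatorname{Im}(z)\int_{\mathbb R}d\lambda\,\operatorname{tr}_{\mathcal H}(\Xi(\lambda))\,|\lambda-z|^{-2},\quad z\in\mathbb C_+.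$$
   Context: $\mathcal B(\mathcal H)$ is the space of bounded linear operators on $\mathcal H$, $\mathcal B_1(\mathcal H)$ the trace class, $\operatorname{tr}_{\mathcal H}$ the trace, $\mathbb C_+$ the open upper half-plane. For $T\in\mathcal B(\mathcal H)$: $\operatorname{Re}(T)=(T+T^* )/2$, $\operatorname{Im}(T)=(T-T^* )/(2i)$. A Herglotz operator is an analytic map $M:\mathbb C_+\to\mathcal B(\mathcal H)$ with $\operatorname{Im}(M(z))\ge0$ for all $z\in\mathbb C_+$. If $T\in\mathcal B(\mathcal H)$ is dissipative (i.e. $\operatorname{Im}(T)\ge0$) and $T^{-1}\in\mathcal B(\mathcal H)$, its logarithm is defined by the $\mathcal B(\mathcal H)$-norm convergent Riemann integral $$\log(T)=-i\int_0^\infty d\lambda\,\big((T+i\lambda)^{-1}-(1+i\lambda)^{-1}I_{\mathcal H}\big).$$ If $M$ is a Herglotz operator with $M(z_0)^{-1}\in\mathcal B(\mathcal H)$ for some $z_0\in\mathbb C_+$, then $M(z)^{-1}\in\mathcal B(\mathcal H)$ for all $z\in\mathbb C_+$, so $\log(M(z))$ is defined for all $z\in\mathbb C_+$. An operator integral is taken in the weak sense if it is understood through its matrix elements $(f,\cdot\,g)_{\mathcal H}$, $f,g\in\mathcal H$. *)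

theory Defs
  imports "HOL-Analysis.Analysis"
begin

section \<open>Complex Hilbert spaces\<close>

class complex_vector = real_vector +
  fixes scaleC :: "complex \<Rightarrow> 'a \<Rightarrow> 'a" (infixr "*\<^sub>C" 75)
  assumes scaleC_add_right: "c *\<^sub>C (x + y) = c *\<^sub>C x + c *\<^sub>C y"
    and scaleC_add_left: "(c + d) *\<^sub>C x = c *\<^sub>C x + d *\<^sub>C x"
    and scaleC_scaleC: "c *\<^sub>C d *\<^sub>C x = (c * d) *\<^sub>C x"
    and scaleC_one: "1 *\<^sub>C x = x"
    and scaleR_scaleC: "r *\<^sub>R x = complex_of_real r *\<^sub>C x"

class complex_normed_vector = complex_vector + real_normed_vector +
  assumes norm_scaleC: "norm (c *\<^sub>C x) = cmod c * norm x"

text \<open>The inner product is antilinear in the first and linear in the second argument.\<close>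

class complex_inner = complex_normed_vector +
  fixes cinner :: "'a \<Rightarrow> 'a \<Rightarrow> complex"
  assumes cinner_commute: "cinner x y = cnj (cinner y x)"
    and cinner_add_right: "cinner x (y + z) = cinner x y + cinner x z"
    and cinner_scaleC_right: "cinner x (c *\<^sub>C y) = c * cinner x y"
    and cinner_self: "cinner x x = complex_of_real ((norm x)\<^sup>2)"

class complex_hilbert_space = complex_inner + complete_space

interpretation cvs: vector_space "scaleC :: complex \<Rightarrow> 'a \<Rightarrow> 'a::complex_vector"
  by unfold_locales (simp_all add: scaleC_add_right scaleC_add_left scaleC_scaleC scaleC_one)

instantiation complex :: complex_hilbert_space
begin

definition scaleC_complex :: "complex \<Rightarrow> complex \<Rightarrow> complex" where
  "scaleC_complex c x = c * x"

definition cinner_complex :: "complex \<Rightarrow> complex \<Rightarrow> complex" where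
  "cinner_complex x y = cnj x * y"

instance
  by standard
    (simp_all add: scaleC_complex_def cinner_complex_def algebra_simps scaleR_conv_of_real
      norm_mult complex_norm_square[symmetric] flip: of_real_power)

end

definition is_onb :: "'a::complex_inner set \<Rightarrow> bool" where
  "is_onb E \<longleftrightarrow>
     (\<forall>e\<in>E. \<forall>f\<in>E. cinner e f = (if e = f then 1 else 0)) \<and>
     closure (module.span scaleC E) = UNIV"


section \<open>Bounded operators\<close>

text \<open>The library type of bounded operators contains all bounded real-linear maps; it carries the
  operator norm and, for complex codomains, the pointwise complex scalar multiplication.
  The space $\mathcal B(\mathcal H)$ is its closed complex subspace \<open>cbounded_ops\<close>.\<close>

instantiation blinfun :: (real_normed_vector, complex_normed_vector) complex_normed_vector
begin

lift_definition scaleC_blinfun :: "complex \<Rightarrow> ('a \<Rightarrow>\<^sub>L 'b) \<Rightarrow> 'a \<Rightarrow>\<^sub>L 'b"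
  is "\<lambda>c f x. c *\<^sub>C f x"
proof -
  fix c :: complex and f :: "'a \<Rightarrow> 'b"
  assume f: "bounded_linear f"
  have "bounded_linear (\<lambda>y::'b. c *\<^sub>C y)"
    by (rule bounded_linear_intro[where K = "cmod c"])
      (simp_all add: scaleC_add_right scaleR_scaleC scaleC_scaleC norm_scaleC mult.commute)
  then show "bounded_linear (\<lambda>x. c *\<^sub>C f x)"
    using f by (rule bounded_linear_compose)
qed

instance
proof
  fix c d :: complex and r :: real and x y :: "'a \<Rightarrow>\<^sub>L 'b"
  show "c *\<^sub>C (x + y) = c *\<^sub>C x + c *\<^sub>C y"
    by transfer (simp add: scaleC_add_right)
  show "(c + d) *\<^sub>C x = c *\<^sub>C x + d *\<^sub>C x"
    by transfer (simp add: scaleC_add_left)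
  show "c *\<^sub>C d *\<^sub>C x = (c * d) *\<^sub>C x"
    by transfer (simp add: scaleC_scaleC)
  show "1 *\<^sub>C x = x"
    by transfer (simp add: scaleC_one)
  show "r *\<^sub>R x = complex_of_real r *\<^sub>C x"
    by transfer (simp add: scaleR_scaleC)
  have le: "norm (e *\<^sub>C z) \<le> cmod e * norm z" for e and z :: "'a \<Rightarrow>\<^sub>L 'b"
  proof (rule norm_blinfun_bound)
    show "norm (blinfun_apply (e *\<^sub>C z) v) \<le> cmod e * norm z * norm v" for v
      using norm_blinfun[of z v]
      by (simp add: scaleC_blinfun.rep_eq norm_scaleC mult.assoc mult_left_mono)
  qed simp
  show "norm (c *\<^sub>C x) = cmod c * norm x"
  proof (cases "c = 0")
    case True
    then show ?thesis using le[of c x] by simp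
  next
    case False
    have "inverse c *\<^sub>C c *\<^sub>C x = x"
      using False by transfer (simp add: scaleC_scaleC scaleC_one)
    then have "norm x \<le> cmod (inverse c) * norm (c *\<^sub>C x)"
      using le[of "inverse c" "c *\<^sub>C x"] by simp
    then have "cmod c * norm x \<le> norm (c *\<^sub>C x)"
      using False by (simp add: norm_divide field_simps)
    then show ?thesis using le[of c x] by simp
  qed
qed

end

definition cbounded_ops :: "('a::complex_inner \<Rightarrow>\<^sub>L 'a) set" where
  "cbounded_ops = {T. \<forall>c x. blinfun_apply T (c *\<^sub>C x) = c *\<^sub>C blinfun_apply T x}"

text \<open>\<open>op_adj\<close>, \<open>op_inv\<close> and \<open>op_abs\<close> are characterised by their defining
  properties; the first is meaningful for elements of \<open>cbounded_ops\<close> on a Hilbert space, the second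
  for elements satisfying \<open>boundedly_invertible\<close>, and the third is the positive square root
  $(T^* T)^{1/2}$.\<close>

definition op_adj :: "('a::complex_inner \<Rightarrow>\<^sub>L 'a) \<Rightarrow> ('a \<Rightarrow>\<^sub>L 'a)" where
  "op_adj T = (THE S. \<forall>x y. cinner (blinfun_apply S x) y = cinner x (blinfun_apply T y))"

definition op_Im :: "('a::complex_inner \<Rightarrow>\<^sub>L 'a) \<Rightarrow> ('a \<Rightarrow>\<^sub>L 'a)" where
  "op_Im T = (1 / (2 * \<i>)) *\<^sub>C (T - op_adj T)"

definition op_nonneg :: "('a::complex_inner \<Rightarrow>\<^sub>L 'a) \<Rightarrow> bool" where
  "op_nonneg T \<longleftrightarrow> (\<forall>f. cinner f (blinfun_apply T f) \<in> \<real>\<^sub>\<ge>\<^sub>0)"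

definition boundedly_invertible :: "('a::complex_inner \<Rightarrow>\<^sub>L 'a) \<Rightarrow> bool" where
  "boundedly_invertible T \<longleftrightarrow>
     (\<exists>S\<in>cbounded_ops. S o\<^sub>L T = id_blinfun \<and> T o\<^sub>L S = id_blinfun)"

definition op_inv :: "('a::complex_inner \<Rightarrow>\<^sub>L 'a) \<Rightarrow> ('a \<Rightarrow>\<^sub>L 'a)" where
  "op_inv T = (THE S. S o\<^sub>L T = id_blinfun \<and> T o\<^sub>L S = id_blinfun)"

definition op_abs :: "('a::complex_inner \<Rightarrow>\<^sub>L 'a) \<Rightarrow> ('a \<Rightarrow>\<^sub>L 'a)" where
  "op_abs T = (THE P. P \<in> cbounded_ops \<and> op_nonneg P \<and> P o\<^sub>L P = op_adj T o\<^sub>L T)"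

definition trace_class :: "('a::complex_inner \<Rightarrow>\<^sub>L 'a) \<Rightarrow> bool" where
  "trace_class T \<longleftrightarrow> T \<in> cbounded_ops \<and>
     (\<exists>E. is_onb E \<and> (\<lambda>e. cinner e (blinfun_apply (op_abs T) e)) summable_on E)"

text \<open>For trace class operators the sum does not depend on the orthonormal basis.\<close>

definition op_trace :: "('a::complex_inner \<Rightarrow>\<^sub>L 'a) \<Rightarrow> complex" where
  "op_trace T =
     (if trace_class T then \<Sum>\<^sub>\<infinity>e\<in>(SOME E. is_onb E). cinner e (blinfun_apply T e) else 0)"


section \<open>Herglotz operators, logarithms and weak integrals\<close>

definition complex_differentiable_on ::
    "(complex \<Rightarrow> 'b::complex_normed_vector) \<Rightarrow> complex set \<Rightarrow> bool" where
  "complex_differentiable_on F S \<longleftrightarrow>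
     (\<forall>z\<in>S. \<exists>D. (F has_derivative (\<lambda>h. h *\<^sub>C D)) (at z within S))"

definition herglotz_op :: "(complex \<Rightarrow> 'a::complex_inner \<Rightarrow>\<^sub>L 'a) \<Rightarrow> bool" where
  "herglotz_op M \<longleftrightarrow>
     complex_differentiable_on M {z. Im z > 0} \<and>
     (\<forall>z. Im z > 0 \<longrightarrow> M z \<in> cbounded_ops \<and> op_nonneg (op_Im (M z)))"

text \<open>The gauge integral of a norm-continuous integrand over $[0,\infty)$ is the norm limit of the
  Riemann integrals over $[0,R]$ as $R\to\infty$.\<close>

definition op_log :: "('a::complex_inner \<Rightarrow>\<^sub>L 'a) \<Rightarrow> ('a \<Rightarrow>\<^sub>L 'a)" where
  "op_log T = (- \<i>) *\<^sub>C integral {0..} (\<lambda>t::real.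
     op_inv (T + (\<i> * complex_of_real t) *\<^sub>C id_blinfun)
       - inverse (1 + \<i> * complex_of_real t) *\<^sub>C id_blinfun)"

definition has_weak_integral ::
    "'s measure \<Rightarrow> ('s \<Rightarrow> 'a::complex_inner \<Rightarrow>\<^sub>L 'a) \<Rightarrow> ('a \<Rightarrow>\<^sub>L 'a) \<Rightarrow> bool" where
  "has_weak_integral \<mu> F J \<longleftrightarrow>
     (\<forall>f g. has_bochner_integral \<mu> (\<lambda>t. cinner f (blinfun_apply (F t) g))
              (cinner f (blinfun_apply J g)))"

definition weakly_measurable ::
    "'s measure \<Rightarrow> ('s \<Rightarrow> 'a::complex_inner \<Rightarrow>\<^sub>L 'a) \<Rightarrow> bool" where
  "weakly_measurable \<mu> F \<longleftrightarrow>
     (\<forall>f g. (\<lambda>t. cinner f (blinfun_apply (F t) g)) \<in> borel_measurable \<mu>)"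

end

theory Submission
  imports Defs "HOL-Complex_Analysis.Complex_Analysis" "HOL-Probability.Sinc_Integral"
begin

text \<open>Invertibility propagates from one point to the whole half-plane because the scalar Herglotz functions
  \<open>z \<mapsto> - \<langle>f, (M(z) + i t)\<^sup>-\<^sup>1 f\<rangle>\<close>, \<open>t > 0\<close>, are controlled everywhere by their values at that point
  (Schwarz--Pick), uniformly as \<open>t \<rightarrow> 0\<close>.

  Rotating the ray of integration in the definition of the logarithm onto the two real half-lines gives
  \<open>0 \<le> Im log M(z) \<le> \<pi>\<close>. Hence each \<open>h(z) = \<langle>f, log M(z) f\<rangle>\<close> is a scalar analytic function with
  bounded imaginary part. Transported to the unit disc by the Cayley transform, its power series lies in the
  Hardy space \<open>H\<^sup>2\<close>, so the imaginary parts converge in mean square as the radius tends to \<open>1\<close>, and almost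
  everywhere along a suitable sequence of radii. By separability one sequence works for all \<open>f\<close>; the weak
  limit, divided by \<open>\<pi>\<close>, is \<open>\<Xi>\<close>. Schwarz's formula on circles, dominated convergence and polarization give
  the representation with \<open>C = Re log M(i)\<close>.

  For the trace, sum the Poisson representation of \<open>Im log M(z)\<close> over an orthonormal basis by monotone
  convergence; Poisson kernels at different points are comparable. Independence of the basis follows from
  \<open>T = S\<^sup>2\<close> and Parseval, and \<open>|T| = T\<close> for \<open>T \<ge> 0\<close> from uniqueness of the positive square root.\<close>

text \<open>The bound by pi is what makes the representing density exist pointwise: it excludes
  singular parts, so \<open>\<Xi>\<close> arises as a limit of functions and no operator-valued
  measure has to be differentiated. The number pi is the opening of the half-plane, the range of the
  argument of a dissipative operator. The obstacle is that an almost everywhere limit comes for one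
  vector at a time, with a null set depending on the vector; hence only the countably many vectors
  occurring in the polarization of a dense sequence are treated, and a uniform norm bound carries
  convergence to all pairs. Off the common good set \<open>\<Xi>\<close> is put to zero, so its
  bounds hold everywhere. The circle never appears as a measure space: normalized arc length is
  carried to the line, where it is the Cauchy distribution, whose density combines with the Schwarz
  kernel into the regularized Cauchy kernel of the theorem. The constant is a real part at i because
  i corresponds to the centre of the disc. Traces stay in the extended nonnegative reals until
  finiteness is known, so that sums and integrals may be exchanged.\<close>

instance complex_hilbert_space \<subseteq> banach ..

section \<open>Elementary rules for the inner product\<close>

lemma cinner_add_left: "cinner (x + y) z = cinner x z + cinner (y::'a::complex_inner) z"
  by (metis cinner_commute cinner_add_right complex_cnj_add)

lemma cinner_scaleC_left: "cinner (c *\<^sub>C x) (y::'a::complex_inner) = cnj c * cinner x y"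
  by (metis cinner_commute cinner_scaleC_right complex_cnj_mult)

lemma cinner_scaleR_right [simp]: "cinner x (r *\<^sub>R y) = of_real r * cinner x (y::'a::complex_inner)"
  by (simp add: scaleR_scaleC cinner_scaleC_right)

lemma cinner_scaleR_left [simp]: "cinner (r *\<^sub>R x) y = of_real r * cinner x (y::'a::complex_inner)"
  by (simp add: scaleR_scaleC cinner_scaleC_left)

lemma cinner_zero_right [simp]: "cinner x (0::'a::complex_inner) = 0"
  using cinner_add_right[of x 0 0] by simp

lemma cinner_zero_left [simp]: "cinner (0::'a::complex_inner) x = 0"
  using cinner_add_left[of 0 0 x] by simp

lemma cinner_minus_right [simp]: "cinner x (- y) = - cinner x (y::'a::complex_inner)"
  using cinner_add_right[of x y "-y"] by (simp add: eq_neg_iff_add_eq_0 add.commute)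

lemma cinner_minus_left [simp]: "cinner (- x) y = - cinner x (y::'a::complex_inner)"
  using cinner_add_left[of x "-x" y] by (simp add: eq_neg_iff_add_eq_0 add.commute)

lemma cinner_diff_right: "cinner x (y - z) = cinner x y - cinner x (z::'a::complex_inner)"
  using cinner_add_right[of x y "-z"] by simp

lemma cinner_diff_left: "cinner (x - y) z = cinner x z - cinner y (z::'a::complex_inner)"
  using cinner_add_left[of x "-y" z] by simp

lemma cinner_ext:
  fixes x y :: "'a::complex_inner"
  assumes "\<And>f. cinner f x = cinner f y"
  shows "x = y"
proof -
  have "cinner (x - y) (x - y) = 0"
    using assms by (simp add: cinner_diff_right)
  then show ?thesis by (simp add: cinner_self)
qed

lemma norm_sq_cinner: "(norm (x::'a::complex_inner))\<^sup>2 = Re (cinner x x)"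
  by (simp add: cinner_self)

section \<open>Quadratic forms\<close>

lemma blinfun_apply_scaleC [simp]: "blinfun_apply (c *\<^sub>C T) x = c *\<^sub>C blinfun_apply T x"
  by (simp add: scaleC_blinfun.rep_eq)

lemma cbounded_opsD: "T \<in> cbounded_ops \<Longrightarrow> blinfun_apply T (c *\<^sub>C x) = c *\<^sub>C blinfun_apply T x"
  by (simp add: cbounded_ops_def)

lemma polarization:
  fixes B :: "'a::complex_vector \<Rightarrow> 'a \<Rightarrow> complex"
  assumes "\<And>x y z. B (x + y) z = B x z + B y z" "\<And>x y z. B x (y + z) = B x y + B x z"
    and "\<And>c x y. B (c *\<^sub>C x) y = cnj c * B x y" "\<And>c x y. B x (c *\<^sub>C y) = c * B x y"
  shows "B x y = (\<Sum>m<4. (-\<i>) ^ m * B (x + \<i> ^ m *\<^sub>C y) (x + \<i> ^ m *\<^sub>C y)) / 4"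
  by (simp add: assms eval_nat_numeral algebra_simps)

text \<open>Transfers convergence, measurability and integrals from diagonal matrix elements to all
  of them. It rests on complex linearity, which membership in \<open>cbounded_ops\<close> supplies
  because the operator type itself is only real-linear.\<close>

lemma polarization_op:
  fixes T :: "'a::complex_inner \<Rightarrow>\<^sub>L 'a"
  assumes "T \<in> cbounded_ops"
  shows "cinner x (T y) =
    (\<Sum>m<4. (-\<i>) ^ m * cinner (x + \<i> ^ m *\<^sub>C y) (T (x + \<i> ^ m *\<^sub>C y))) / 4"
  by (rule polarization[of "\<lambda>x y. cinner x (T y)"])
    (simp_all add: assms cinner_add_left cinner_add_right blinfun.add_right
      cinner_scaleC_left cinner_scaleC_right cbounded_opsD)

text \<open>Exchanging x and y in the polarization formula replaces each of its four vectors by a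
  unimodular multiple, which leaves the quadratic form unchanged; since its values are real,
  conjugation restores the original sum.\<close>

lemma hermitian_form:
  fixes T :: "'a::complex_inner \<Rightarrow>\<^sub>L 'a"
  assumes T: "T \<in> cbounded_ops" and re: "\<And>x. cinner x (T x) \<in> \<real>"
  shows "cinner (T x) y = cinner x (T y)"
proof -
  let ?q = "\<lambda>x. cinner x (T x)"
  have q: "cnj (?q x) = ?q x" for x using re by (simp add: Reals_cnj_iff)
  have sw: "?q (x + \<i> *\<^sub>C y) = ?q (y - \<i> *\<^sub>C x)" "?q (x - \<i> *\<^sub>C y) = ?q (y + \<i> *\<^sub>C x)"
           "?q (x - y) = ?q (y - x)"
    by (simp_all add: cinner_add_left cinner_add_right blinfun.add_right blinfun.diff_right
      cinner_diff_left cinner_diff_right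
      cinner_scaleC_left cinner_scaleC_right cbounded_opsD[OF T] algebra_simps)
  have a: "cinner x (T y) = (?q (x+y) - \<i> * ?q (x + \<i> *\<^sub>C y) - ?q (x - y) + \<i> * ?q (x - \<i> *\<^sub>C y))/4" for x y
    by (subst polarization_op[OF T]) (simp add: eval_nat_numeral algebra_simps)
  have "cinner (T x) y = cnj (cinner y (T x))" by (rule cinner_commute)
  also have "\<dots> = (?q (x+y) - \<i> * ?q (x + \<i> *\<^sub>C y) - ?q (x - y) + \<i> * ?q (x - \<i> *\<^sub>C y))/4"
    unfolding a[of y x] sw by (simp add: q algebra_simps)
  finally show ?thesis by (simp only: a[of x y])
qed

lemma op_nonnegD:
  assumes "op_nonneg T"
  shows "cinner x (T x) = of_real (Re (cinner x (T x)))" "0 \<le> Re (cinner x (T x))" "cinner x (T x) \<in> \<real>"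
  using assms by (auto simp: op_nonneg_def complex_nonneg_Reals_iff complex_eq_iff complex_is_Real_iff)

text \<open>The discriminant argument for the semidefinite form of \<open>T\<close>. Besides the
  ordinary Cauchy-Schwarz inequality it yields sharp norm bounds for nonnegative operators from
  bounds on their quadratic forms.\<close>

lemma cauchy_schwarz_nonneg:
  fixes T :: "'a::complex_inner \<Rightarrow>\<^sub>L 'a"
  assumes T: "T \<in> cbounded_ops" and nn: "op_nonneg T"
  shows "(cmod (cinner x (T y)))\<^sup>2 \<le> Re (cinner x (T x)) * Re (cinner y (T y))"
proof -
  note ge = op_nonnegD(2)[OF nn] and re = op_nonnegD(3)[OF nn]
  define p where "p = cinner x (T y)"
  define a b where "a = Re (cinner x (T x))" and "b = Re (cinner y (T y))"
  have xx: "cinner x (T x) = of_real a" and yy: "cinner y (T y) = of_real b"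
    unfolding a_def b_def by (rule op_nonnegD(1)[OF nn])+
  have yx: "cinner y (T x) = cnj p"
    unfolding p_def using hermitian_form[OF T re] by (metis cinner_commute)
  have main: "0 \<le> a - 2 * s * (cmod p)\<^sup>2 + s\<^sup>2 * (cmod p)\<^sup>2 * b" for s :: real
  proof -
    \<comment> \<open>This phase turns both cross terms into \<open>- s * (cmod p)\<^sup>2\<close>,
      so the form becomes a real quadratic polynomial in \<open>s\<close>.\<close>
    define c where "c = - of_real s * cnj p"
    have "cinner (x + c *\<^sub>C y) (T (x + c *\<^sub>C y)) =
        of_real a + c * p + cnj c * cnj p + cnj c * c * of_real b"
      by (simp add: cinner_add_left cinner_add_right blinfun.add_right xx yy yx
      cinner_scaleC_left cinner_scaleC_right cbounded_opsD[OF T] algebra_simps flip: p_def)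
    also have "\<dots> = of_real (a - 2 * s * (cmod p)\<^sup>2 + s\<^sup>2 * (cmod p)\<^sup>2 * b)"
      using complex_norm_square[of p]
      by (simp add: c_def algebra_simps power2_eq_square)
    finally show ?thesis using ge[of "x + c *\<^sub>C y"] by simp
  qed
  have "a \<ge> 0" "b \<ge> 0" using ge a_def b_def by auto
  have "(cmod p)\<^sup>2 \<le> a * b"
  proof (cases "b = 0")
    case True
    show ?thesis
    proof (cases "p = 0")
      case False
      then have "(cmod p)\<^sup>2 > 0" by simp
      \<comment> \<open>For \<open>b = 0\<close> the polynomial is affine; this value of
        \<open>s\<close> makes it \<open>- a - 2\<close>, a contradiction.\<close>
      with main[of "(a + 1) / (cmod p)\<^sup>2"] \<open>a \<ge> 0\<close> True have "0 \<le> a - 2 * (a + 1)" by simp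
      with \<open>a \<ge> 0\<close> show ?thesis by simp
    qed (use \<open>a \<ge> 0\<close> \<open>b \<ge> 0\<close> in auto)
  next
    case False
    then have "b > 0" using \<open>b \<ge> 0\<close> by simp
    with main[of "1 / b"] show ?thesis by (simp add: field_simps power2_eq_square)
  qed
  then show ?thesis by (simp add: p_def a_def b_def)
qed

lemma id_cbounded [simp]: "id_blinfun \<in> cbounded_ops"
  by (simp add: cbounded_ops_def)

lemma cauchy_schwarz: "cmod (cinner x y) \<le> norm x * norm (y::'a::complex_inner)"
proof -
  have "op_nonneg (id_blinfun :: 'a \<Rightarrow>\<^sub>L 'a)"
    by (simp add: op_nonneg_def cinner_self complex_nonneg_Reals_iff)
  from cauchy_schwarz_nonneg[OF id_cbounded this, of x y]
  have "(cmod (cinner x y))\<^sup>2 \<le> (norm x * norm y)\<^sup>2"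
    by (simp add: cinner_self power_mult_distrib)
  then show ?thesis by (rule power2_le_imp_le) simp
qed

lemma bounded_bilinear_cinner: "bounded_bilinear (cinner :: 'a::complex_inner \<Rightarrow> 'a \<Rightarrow> complex)"
  by standard
    (auto simp: cinner_add_left cinner_add_right scaleR_conv_of_real intro!: exI[of _ 1] order_trans[OF cauchy_schwarz])

interpretation cinner: bounded_bilinear "cinner :: 'a::complex_inner \<Rightarrow> 'a \<Rightarrow> complex"
  by (rule bounded_bilinear_cinner)

lemma tendsto_cinner [tendsto_intros]:
  "(f \<longlongrightarrow> a) F \<Longrightarrow> (g \<longlongrightarrow> b) F \<Longrightarrow> ((\<lambda>x. cinner (f x) (g x)) \<longlongrightarrow> cinner a (b::'a::complex_inner)) F"
  by (rule cinner.tendsto)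

lemma bounded_linear_scaleC_right: "bounded_linear (\<lambda>x::'a::complex_normed_vector. c *\<^sub>C x)"
  by (rule bounded_linear_intro[where K = "cmod c"])
      (simp_all add: scaleC_add_right scaleR_scaleC scaleC_scaleC norm_scaleC mult.commute)

lemma tendsto_scaleC_const [tendsto_intros]:
  "(f \<longlongrightarrow> (a::'a::complex_normed_vector)) F \<Longrightarrow> ((\<lambda>x. c *\<^sub>C f x) \<longlongrightarrow> c *\<^sub>C a) F"
  using bounded_linear.tendsto[OF bounded_linear_scaleC_right] .

lemma norm_le_cinner:
  fixes x :: "'a::complex_inner"
  assumes "\<And>f. cmod (cinner f x) \<le> K * norm f" "0 \<le> K"
  shows "norm x \<le> K"
proof (cases "x = 0")
  case False
  have "norm x * norm x \<le> K * norm x"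
    using assms(1)[of x] by (simp add: cinner_self norm_mult power2_eq_square)
  then show ?thesis using False by simp
qed (use assms in simp)

lemma cbounded_norm_le:
  fixes T :: "'a::complex_inner \<Rightarrow>\<^sub>L 'a"
  assumes "\<And>f g. cmod (cinner f (T g)) \<le> K * norm f * norm g" "0 \<le> K"
  shows "norm T \<le> K"
proof (rule norm_blinfun_bound)
  show "norm (T g) \<le> K * norm g" for g
    by (rule norm_le_cinner) (use assms in \<open>auto simp: mult_ac\<close>)
qed (rule assms)

lemma cinner_op_bound:
  fixes T :: "'a::complex_inner \<Rightarrow>\<^sub>L 'a"
  shows "cmod (cinner f (T g)) \<le> norm T * norm f * norm g"
proof -
  have "cmod (cinner f (T g)) \<le> norm f * norm (T g)" by (rule cauchy_schwarz)
  also have "\<dots> \<le> norm f * (norm T * norm g)"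
    by (intro mult_left_mono norm_blinfun) auto
  finally show ?thesis by (simp add: mult_ac)
qed

lemma norm_add_sq:
  fixes x y :: "'a::complex_inner"
  shows "(norm (x + y))\<^sup>2 = (norm x)\<^sup>2 + 2 * Re (cinner x y) + (norm y)\<^sup>2"
  using cinner_commute[of y x] by (simp add: norm_sq_cinner cinner_add_left cinner_add_right)

lemma parallelogram:
  fixes x y :: "'a::complex_inner"
  shows "(norm (x + y))\<^sup>2 + (norm (x - y))\<^sup>2 = 2 * (norm x)\<^sup>2 + 2 * (norm y)\<^sup>2"
  by (simp add: norm_sq_cinner cinner_add_left cinner_add_right cinner_diff_left cinner_diff_right)

text \<open>The bound follows from polarization and the parallelogram law.\<close>

lemma form_bound_quadratic:
  fixes T :: "'a::complex_inner \<Rightarrow>\<^sub>L 'a"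
  assumes T: "T \<in> cbounded_ops" and K: "0 \<le> K" and q: "\<And>x. cmod (cinner x (T x)) \<le> K * (norm x)\<^sup>2"
  shows "norm T \<le> 2 * K"
proof (rule cbounded_norm_le)
  have *: "cmod (cinner f (T g)) \<le> K * ((norm f)\<^sup>2 + (norm g)\<^sup>2)" for f g
  proof -
    have "cmod (\<Sum>m<4. (-\<i>) ^ m * cinner (f + \<i> ^ m *\<^sub>C g) (T (f + \<i> ^ m *\<^sub>C g)))
       \<le> (\<Sum>m<4. K * (norm (f + \<i> ^ m *\<^sub>C g))\<^sup>2)"
      by (rule sum_norm_le) (simp add: norm_mult norm_power q)
    also have "\<dots> = K * (((norm (f + g))\<^sup>2 + (norm (f - g))\<^sup>2) + ((norm (f + \<i> *\<^sub>C g))\<^sup>2 + (norm (f - \<i> *\<^sub>C g))\<^sup>2))"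
      by (simp add: eval_nat_numeral algebra_simps)
    also have "\<dots> = 4 * (K * ((norm f)\<^sup>2 + (norm g)\<^sup>2))"
      unfolding parallelogram by (simp add: norm_scaleC algebra_simps)
    finally show ?thesis
      unfolding polarization_op[OF T, of f g] by (simp add: norm_divide)
  qed
  show "cmod (cinner f (T g)) \<le> 2 * K * norm f * norm g" for f g
  proof (cases "f = 0 \<or> g = 0")
    case False
    define a b where "a = norm f" "b = norm g"
    have ab: "a > 0" "b > 0" using False by (auto simp: a_b_def)
    \<comment> \<open>Replacing \<open>f\<close>, \<open>g\<close> by \<open>s f\<close>,
      \<open>g / s\<close> does not change the matrix element, and this \<open>s\<close> makes both
      squared norms equal to \<open>a * b\<close>, so the sum of squares becomes twice the
      product.\<close>
    define s where "s = sqrt (b / a)"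
    have s: "s > 0" "s\<^sup>2 = b / a" using ab by (auto simp: s_def)
    have "cinner f (T g) = cinner (s *\<^sub>R f) (T ((1/s) *\<^sub>R g))"
      using s by (simp add: blinfun.scaleR_right flip: of_real_mult)
    also have "cmod \<dots> \<le> K * ((norm (s *\<^sub>R f))\<^sup>2 + (norm ((1/s) *\<^sub>R g))\<^sup>2)" by (rule *)
    also have "(norm (s *\<^sub>R f))\<^sup>2 = a * b"
      using s ab by (simp add: power_mult_distrib a_b_def(1)[symmetric]) (simp add: power2_eq_square)
    also have "(norm ((1/s) *\<^sub>R g))\<^sup>2 = a * b"
      using s ab by (simp add: power_mult_distrib power_divide a_b_def(2)[symmetric]) (simp add: power2_eq_square)
    finally show ?thesis by (simp add: a_b_def)
  qed auto
qed (use K in simp)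

section \<open>The Riesz representation theorem and adjoints\<close>

text \<open>The representing vector is the minimizer of the quadratic functional \<open>J\<close>:
  completeness makes a minimizing sequence converge, and at the minimum the first variation vanishes
  in every direction.\<close>

lemma riesz_representation:
  fixes \<phi> :: "'a::complex_hilbert_space \<Rightarrow> complex"
  assumes add: "\<And>x y. \<phi> (x + y) = \<phi> x + \<phi> y" and sc: "\<And>c x. \<phi> (c *\<^sub>C x) = c * \<phi> x"
    and bd: "\<And>x. cmod (\<phi> x) \<le> K * norm x"
  shows "\<exists>v. \<forall>x. \<phi> x = cinner v x"
proof -
  define J where "J = (\<lambda>x. (norm x)\<^sup>2 - 2 * Re (\<phi> x))"
  have low: "J x \<ge> - K\<^sup>2" for x
  proof -
    have "Re (\<phi> x) \<le> K * norm x" using bd[of x] complex_Re_le_cmod[of "\<phi> x"] by linarith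
    moreover have "0 \<le> (norm x - K)\<^sup>2" by simp
    ultimately show ?thesis unfolding J_def by (simp add: power2_eq_square algebra_simps)
  qed
  define m where "m = (INF x. J x)"
  have bb: "bdd_below (range J)" using low by (intro bdd_belowI2)
  have mJ: "m \<le> J x" for x unfolding m_def by (rule cINF_lower[OF bb]) simp
  have "\<exists>x. J x < m + 1 / Suc n" for n
  proof -
    have "(INF x. J x) < m + 1 / Suc n" unfolding m_def by simp
    then show ?thesis using cINF_less_iff[OF _ bb] by auto
  qed
  then obtain X where X: "\<And>n. J (X n) < m + 1 / Suc n" by metis
  have half: "\<phi> ((1/2) *\<^sub>R x) = \<phi> x / 2" for x
    by (simp add: scaleR_scaleC sc)
  \<comment> \<open>The midpoint competes for the minimum; the parallelogram law turns this into
    closeness of almost minimizers.\<close>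
  have par: "(norm (x - y))\<^sup>2 \<le> 2 * (J x - m) + 2 * (J y - m)" for x y
  proof -
    have "J ((1/2) *\<^sub>R (x + y)) = (norm (x + y))\<^sup>2 / 4 - Re (\<phi> x) - Re (\<phi> y)"
      by (simp only: J_def half norm_scaleR) (simp add: add power_mult_distrib power_divide add_divide_distrib)
    with mJ[of "(1/2) *\<^sub>R (x + y)"] parallelogram[of x y] show ?thesis
      by (simp add: J_def)
  qed
  have "Cauchy X"
  proof (rule metric_CauchyI)
    fix e :: real assume e: "e > 0"
    then obtain N where N: "inverse (of_nat (Suc N)) < e\<^sup>2 / 4"
      using reals_Archimedean[of "e\<^sup>2 / 4"] by auto
    have J': "J (X n) - m < e\<^sup>2 / 4" if "n \<ge> N" for n
    proof -
      have "1 / real (Suc n) \<le> inverse (of_nat (Suc N))" using that by (simp add: field_simps)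
      with X[of n] N show ?thesis by linarith
    qed
    show "\<exists>N. \<forall>i\<ge>N. \<forall>j\<ge>N. dist (X i) (X j) < e"
    proof (intro exI[of _ N] allI impI)
      fix i j assume "i \<ge> N" "j \<ge> N"
      with par[of "X i" "X j"] J'[OF \<open>i \<ge> N\<close>] J'[OF \<open>j \<ge> N\<close>] have "(norm (X i - X j))\<^sup>2 < 2 * (e\<^sup>2 / 4) + 2 * (e\<^sup>2 / 4)"
        by (intro order.strict_trans1[OF par] add_strict_mono mult_strict_left_mono) auto
      then have "(norm (X i - X j))\<^sup>2 < e\<^sup>2" by simp
      then show "dist (X i) (X j) < e" using e by (simp add: dist_norm power2_less_imp_less)
    qed
  qed
  then obtain v where v: "X \<longlonglongrightarrow> v" using Cauchy_convergent_iff convergent_def by metis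
  have "bounded_linear \<phi>"
    by (rule bounded_linear_intro[where K = K]) (use bd in \<open>auto simp: add scaleR_scaleC sc mult.commute scaleC_complex_def\<close>)
  then have "(\<lambda>n. \<phi> (X n)) \<longlonglongrightarrow> \<phi> v" using v by (rule bounded_linear.tendsto)
  then have "(\<lambda>n. J (X n)) \<longlonglongrightarrow> J v" unfolding J_def by (intro tendsto_intros v)
  moreover have "(\<lambda>n. m + 1 / Suc n) \<longlonglongrightarrow> m + 0"
    by (intro tendsto_intros LIMSEQ_Suc[OF lim_1_over_n])
  ultimately have Jv: "J v \<le> m"
    using X by (intro LIMSEQ_le[of "\<lambda>n. J (X n)"]) (auto intro: less_imp_le)
  have Jv': "J v \<le> J x" for x using Jv mJ[of x] by linarith
  have re: "Re (\<phi> x) = Re (cinner v x)" for x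
  proof -
    have h: "0 \<le> 2 * s * (Re (cinner v x) - Re (\<phi> x)) + s\<^sup>2 * (norm x)\<^sup>2" for s :: real
    proof -
      have "J (v + s *\<^sub>R x) = J v + 2 * s * (Re (cinner v x) - Re (\<phi> x)) + s\<^sup>2 * (norm x)\<^sup>2"
        by (simp add: J_def norm_add_sq add scaleR_scaleC sc norm_scaleC power_mult_distrib
          cinner_scaleC_right algebra_simps)
      with Jv'[of "v + s *\<^sub>R x"] show ?thesis by simp
    qed
    define d where "d = Re (cinner v x) - Re (\<phi> x)"
    have "d = 0"
    proof (cases "x = 0")
      case True then show ?thesis using sc[of 0 0] by (simp add: d_def)
    next
      case False
      then obtain N where N: "(norm x)\<^sup>2 = N" "N > 0" by simp
      \<comment> \<open>The value \<open>- d / N\<close> minimizes the quadratic polynomial in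
        \<open>s\<close>, and the minimum is negative unless \<open>d = 0\<close>.\<close>
      have "2 * (- d / N) * d + (- d / N)\<^sup>2 * N = - (d\<^sup>2 / N)"
        using N by (simp add: field_simps power2_eq_square)
      with h[of "- d / N"] have "d\<^sup>2 / N \<le> 0"
        unfolding d_def[symmetric] N by linarith
      with N have "d\<^sup>2 \<le> 0" by (simp add: divide_le_0_iff)
      then show ?thesis by simp
    qed
    then show ?thesis by (simp add: d_def)
  qed
  have "\<phi> x = cinner v x" for x
    using re[of x] re[of "\<i> *\<^sub>C x"] by (simp add: sc cinner_scaleC_right complex_eq_iff)
  then show ?thesis by blast
qed

text \<open>The form is antilinear in its first argument, so its conjugate is fed to the Riesz
  theorem; the representing vectors depend linearly on the second argument. Both adjoints and weak
  limits of operators are obtained this way.\<close>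

lemma form_representation:
  fixes B :: "'a::complex_hilbert_space \<Rightarrow> 'a \<Rightarrow> complex"
  assumes "\<And>x y z. B (x + y) z = B x z + B y z" "\<And>x y z. B x (y + z) = B x y + B x z"
    and "\<And>c x y. B (c *\<^sub>C x) y = cnj c * B x y" "\<And>c x y. B x (c *\<^sub>C y) = c * B x y"
    and bd: "\<And>x y. cmod (B x y) \<le> K * norm x * norm y"
  obtains T where "T \<in> cbounded_ops" "\<And>x y. B x y = cinner x (blinfun_apply T y)"
proof -
  have "\<exists>v. \<forall>x. cnj (B x y) = cinner v x" for y
    by (rule riesz_representation[where K = "K * norm y"]) (use assms in \<open>auto simp: mult_ac\<close>)
  then obtain t where "\<And>x y. cnj (B x y) = cinner (t y) x" by metis
  then have t: "B x y = cinner x (t y)" for x y by (metis cinner_commute complex_cnj_cnj)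
  have ta: "t (x + y) = t x + t y" and ts: "t (c *\<^sub>C x) = c *\<^sub>C t x" for x y c
    by (rule cinner_ext; simp add: t[symmetric] assms cinner_add_right cinner_scaleC_right)+
  have tb: "norm (t y) \<le> \<bar>K\<bar> * norm y" for y
  proof (rule norm_le_cinner)
    fix f
    have "cmod (cinner f (t y)) \<le> K * norm f * norm y" using bd t by metis
    also have "\<dots> \<le> \<bar>K\<bar> * norm f * norm y" by (intro mult_right_mono) auto
    finally show "cmod (cinner f (t y)) \<le> \<bar>K\<bar> * norm y * norm f" by (simp add: mult_ac)
  qed simp
  have "bounded_linear t"
    by (rule bounded_linear_intro[where K = "\<bar>K\<bar>"])
       (use tb in \<open>auto simp: ta scaleR_scaleC ts mult.commute\<close>)
  then have "blinfun_apply (Blinfun t) = t" by (rule bounded_linear_Blinfun_apply)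
  then show ?thesis by (intro that[of "Blinfun t"]) (auto simp: cbounded_ops_def ts t)
qed

lemma op_adj_eqI:
  fixes S T :: "'a::complex_inner \<Rightarrow>\<^sub>L 'a"
  assumes "\<And>x y. cinner (S x) y = cinner x (T y)"
  shows "op_adj T = S"
  unfolding op_adj_def
proof (rule the_equality)
  fix S' :: "'a \<Rightarrow>\<^sub>L 'a" assume "\<forall>x y. cinner (S' x) y = cinner x (T y)"
  then have "cinner y (S' x) = cinner y (S x)" for x y
    using assms by (simp add: cinner_commute[of y])
  then show "S' = S" by (metis blinfun_eqI cinner_ext)
qed (use assms in simp)

lemma op_adj:
  fixes T :: "'a::complex_hilbert_space \<Rightarrow>\<^sub>L 'a"
  assumes T: "T \<in> cbounded_ops"
  shows "op_adj T \<in> cbounded_ops" "cinner (op_adj T x) y = cinner x (T y)"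
    "cinner x (op_adj T y) = cinner (T x) y"
proof -
  obtain S where S: "S \<in> cbounded_ops" "\<And>x y. cinner (T x) y = cinner x (blinfun_apply S y)"
    by (rule form_representation[of "\<lambda>x y. cinner (T x) y" "norm T"])
       (auto simp: cinner_add_left cinner_add_right blinfun.add_right
      cinner_scaleC_left cinner_scaleC_right cbounded_opsD[OF T] intro!: order_trans[OF cauchy_schwarz] mult_right_mono norm_blinfun)
  have S': "cinner (blinfun_apply S x) y = cinner x (T y)" for x y
    using S(2)[of y x] cinner_commute[of "blinfun_apply S x" y] cinner_commute[of x "T y"] by simp
  have "op_adj T = S" by (rule op_adj_eqI) (rule S')
  with S show "op_adj T \<in> cbounded_ops" "cinner x (op_adj T y) = cinner (T x) y"
     "cinner (op_adj T x) y = cinner x (T y)"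
    using S' by simp_all
qed

lemma op_adj_self:
  fixes T :: "'a::complex_inner \<Rightarrow>\<^sub>L 'a"
  assumes T: "T \<in> cbounded_ops" "\<And>x. cinner x (T x) \<in> \<real>"
  shows "op_adj T = T"
  by (rule op_adj_eqI) (rule hermitian_form[OF assms])

lemma cbounded_closed_simps [simp]:
  "0 \<in> cbounded_ops"
  "S \<in> cbounded_ops \<Longrightarrow> T \<in> cbounded_ops \<Longrightarrow> S + T \<in> cbounded_ops"
  "S \<in> cbounded_ops \<Longrightarrow> T \<in> cbounded_ops \<Longrightarrow> S - T \<in> cbounded_ops"
  "S \<in> cbounded_ops \<Longrightarrow> c *\<^sub>C S \<in> cbounded_ops"
  "S \<in> cbounded_ops \<Longrightarrow> r *\<^sub>R S \<in> cbounded_ops"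
  "S \<in> cbounded_ops \<Longrightarrow> T \<in> cbounded_ops \<Longrightarrow> S o\<^sub>L T \<in> cbounded_ops"
  by (auto simp: cbounded_ops_def blinfun.add_left blinfun.diff_left blinfun.scaleR_left
      scaleC_add_right cvs.scale_right_diff_distrib scaleC_scaleC scaleR_scaleC mult.commute)

lemma cinner_op_Im:
  fixes T :: "'a::complex_hilbert_space \<Rightarrow>\<^sub>L 'a"
  assumes T: "T \<in> cbounded_ops"
  shows "op_Im T \<in> cbounded_ops" "cinner f (op_Im T f) = of_real (Im (cinner f (T f)))"
proof -
  show "op_Im T \<in> cbounded_ops" unfolding op_Im_def by (intro cbounded_closed_simps op_adj T)
  have "cinner f (op_adj T f) = cnj (cinner f (T f))"
    using op_adj(3)[OF T, of f f] cinner_commute[of "T f" f] by simp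
  then have "cinner f (op_Im T f) = (cinner f (T f) - cnj (cinner f (T f))) / (2 * \<i>)"
    unfolding op_Im_def blinfun_apply_scaleC blinfun.diff_left cinner_scaleC_right cinner_diff_right
    by simp
  then show "cinner f (op_Im T f) = of_real (Im (cinner f (T f)))"
    by (auto simp: complex_eq_iff)
qed

lemma op_nonneg_Im_iff:
  fixes T :: "'a::complex_hilbert_space \<Rightarrow>\<^sub>L 'a"
  assumes T: "T \<in> cbounded_ops"
  shows "op_nonneg (op_Im T) \<longleftrightarrow> (\<forall>f. Im (cinner f (T f)) \<ge> 0)"
  by (simp add: op_nonneg_def cinner_op_Im[OF T] complex_nonneg_Reals_iff)

lemma closed_cbounded_ops: "closed (cbounded_ops :: ('a::complex_inner \<Rightarrow>\<^sub>L 'a) set)"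
unfolding closed_sequential_limits
proof (intro allI impI, elim conjE)
  fix X :: "nat \<Rightarrow> 'a \<Rightarrow>\<^sub>L 'a" and T assume X': "\<forall>n. X n \<in> cbounded_ops" and X2: "X \<longlonglongrightarrow> T"
  then have X: "\<And>n. X n \<in> cbounded_ops" by blast
  have l: "(\<lambda>n. X n x) \<longlonglongrightarrow> T x" for x by (intro tendsto_intros X2)
  have "T (c *\<^sub>C x) = c *\<^sub>C T x" for c x
  proof (rule LIMSEQ_unique[OF l])
    show "(\<lambda>n. X n (c *\<^sub>C x)) \<longlonglongrightarrow> c *\<^sub>C T x"
      unfolding cbounded_opsD[OF X] by (intro tendsto_intros l)
  qed
  then show "T \<in> cbounded_ops" by (simp add: cbounded_ops_def)
qed

lemma bounded_linear_scaleC_left: "bounded_linear (\<lambda>c. c *\<^sub>C (x::'a::complex_normed_vector))"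
  by (rule bounded_linear_intro[where K = "norm x"])
    (auto simp: scaleC_add_left scaleR_scaleC scaleC_scaleC norm_scaleC scaleC_complex_def scaleR_conv_of_real)

section \<open>Inverses of dissipative operators\<close>

abbreviation shift_op :: "('a::complex_inner \<Rightarrow>\<^sub>L 'a) \<Rightarrow> complex \<Rightarrow> ('a \<Rightarrow>\<^sub>L 'a)" where
  "shift_op T c \<equiv> T + c *\<^sub>C id_blinfun"

lemma op_inv_eqI:
  assumes "S o\<^sub>L T = id_blinfun" "T o\<^sub>L S = id_blinfun"
  shows "op_inv T = S"
  unfolding op_inv_def
proof (rule the_equality)
  fix S' assume S': "S' o\<^sub>L T = id_blinfun \<and> T o\<^sub>L S' = id_blinfun"
  have "S' x = S x" for x
  proof -
    have "T (S x) = x" using assms(2) by (metis blinfun_apply_blinfun_compose blinfun_apply_id_blinfun)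
    then have "S' x = S' (T (S x))" by simp
    also have "\<dots> = S x" using S' by (metis blinfun_apply_blinfun_compose blinfun_apply_id_blinfun)
    finally show ?thesis .
  qed
  then show "S' = S" by (rule blinfun_eqI)
qed (use assms in simp)

lemma op_inv:
  assumes "boundedly_invertible T"
  shows "op_inv T \<in> cbounded_ops" "op_inv T (T x) = x" "T (op_inv T x) = x"
proof -
  obtain S where S: "S \<in> cbounded_ops" "S o\<^sub>L T = id_blinfun" "T o\<^sub>L S = id_blinfun"
    using assms unfolding boundedly_invertible_def by blast
  then have *: "op_inv T = S" by (intro op_inv_eqI)
  show "op_inv T \<in> cbounded_ops" using S * by simp
  show "op_inv T (T x) = x" "T (op_inv T x) = x"
    using S(2,3) unfolding * by (metis blinfun_apply_blinfun_compose blinfun_apply_id_blinfun)+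
qed

lemma norm_op_inv_le:
  assumes "boundedly_invertible T" "\<And>x. norm x \<le> k * norm (T x)" "0 \<le> k"
  shows "norm (op_inv T) \<le> k"
proof (rule norm_blinfun_bound)
  show "norm (op_inv T x) \<le> k * norm x" for x
    using assms(2)[of "op_inv T x"] by (simp add: op_inv[OF assms(1)])
qed fact

lemma boundedly_invertible_lower:
  assumes "boundedly_invertible T" "norm (op_inv T) \<le> k"
  shows "norm x \<le> k * norm (T x)"
proof -
  have "norm x = norm (op_inv T (T x))" by (simp add: op_inv[OF assms(1)])
  also have "\<dots> \<le> norm (op_inv T) * norm (T x)" by (rule norm_blinfun)
  also have "\<dots> \<le> k * norm (T x)" by (intro mult_right_mono assms) simp
  finally show ?thesis .
qed

lemma boundedly_invertibleI:
  fixes T :: "'a::complex_inner \<Rightarrow>\<^sub>L 'a"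
  assumes T: "T \<in> cbounded_ops" and low: "\<And>x. norm x \<le> k * norm (T x)"
    and surj: "\<And>y. \<exists>x. T x = y"
  shows "boundedly_invertible T"
proof -
  obtain s where s: "\<And>y. T (s y) = y" using surj by metis
  have inj: "x = y" if "T x = T y" for x y
    using low[of "x - y"] that by (simp add: blinfun.diff_right)
  have sT: "s (T x) = x" for x by (rule inj) (simp add: s)
  have sa: "s (x + y) = s x + s y" for x y by (rule inj) (simp add: s blinfun.add_right)
  have sc: "s (c *\<^sub>C x) = c *\<^sub>C s x" for c x by (rule inj) (simp add: s cbounded_opsD[OF T])
  have "bounded_linear s"
    by (rule bounded_linear_intro[where K = k])
      (use low[of "s _"] in \<open>auto simp: sa scaleR_scaleC sc s mult.commute\<close>)
  then have "blinfun_apply (Blinfun s) = s" by (rule bounded_linear_Blinfun_apply)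
  then show ?thesis
    unfolding boundedly_invertible_def
    by (intro bexI[of _ "Blinfun s"]) (auto intro!: blinfun_eqI simp: sT s cbounded_ops_def sc)
qed

text \<open>The solution of \<open>T x = y\<close> is the fixed point of \<open>x \<mapsto> x + i \<rho> (T x - y)\<close> for small
  \<open>\<rho> > 0\<close> (Lax--Milgram).\<close>

lemma coercive_invertible:
  fixes T :: "'a::complex_hilbert_space \<Rightarrow>\<^sub>L 'a"
  assumes T: "T \<in> cbounded_ops" and a: "\<alpha> > 0"
    and co: "\<And>x. \<alpha> * (norm x)\<^sup>2 \<le> Im (cinner x (T x))"
  shows "boundedly_invertible T" "norm (op_inv T) \<le> 1 / \<alpha>"
proof -
  have low: "norm x \<le> 1 / \<alpha> * norm (T x)" for x
  proof (cases "x = 0")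
    case False
    have "\<alpha> * (norm x)\<^sup>2 \<le> cmod (cinner x (T x))" using co[of x] abs_Im_le_cmod[of "cinner x (T x)"] by linarith
    also have "\<dots> \<le> norm x * norm (T x)" by (rule cauchy_schwarz)
    finally have "norm x * (\<alpha> * norm x) \<le> norm x * norm (T x)" by (simp add: power2_eq_square mult_ac)
    then have "\<alpha> * norm x \<le> norm (T x)" using False by simp
    then show ?thesis using a by (simp add: field_simps)
  qed simp
  have "\<exists>x. T x = y" for y
  proof -
    \<comment> \<open>\<open>K\<close> exceeds both \<open>norm T\<close> and
      \<open>\<alpha>\<close>. The squared Lipschitz constant of the map is at most
      \<open>1 - 2 * \<rho> * \<alpha> + \<rho>\<^sup>2 * K\<^sup>2\<close>, which is minimal at
      \<open>\<rho> = \<alpha> / K\<^sup>2\<close> with value \<open>q\<close>;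
      \<open>\<alpha> < K\<close> keeps \<open>q\<close> positive.\<close>
    define K where "K = norm T + \<alpha> + 1"
    define \<rho> where "\<rho> = \<alpha> / K\<^sup>2"
    define q where "q = 1 - \<alpha>\<^sup>2 / K\<^sup>2"
    have K: "K > 0" "\<alpha> < K" using a by (auto simp: K_def add_pos_nonneg add_nonneg_pos)
    have \<rho>: "\<rho> > 0" using a K by (simp add: \<rho>_def)
    have "\<alpha>\<^sup>2 < K\<^sup>2" using a K by (intro power_strict_mono) auto
    then have q: "0 < q" "q < 1" using a K by (auto simp: q_def field_simps)
    define F where "F = (\<lambda>x. x + (\<i> * of_real \<rho>) *\<^sub>C (T x - y))"
    have contr: "dist (F u) (F v) \<le> sqrt q * dist u v" for u v
    proof -
      define d where "d = u - v"
      have "F u - F v = d + (\<i> * of_real \<rho>) *\<^sub>C T d"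
        by (simp add: F_def d_def cvs.scale_right_diff_distrib blinfun.diff_right algebra_simps)
      then have "(norm (F u - F v))\<^sup>2 = (norm d)\<^sup>2 - 2 * \<rho> * Im (cinner d (T d)) + \<rho>\<^sup>2 * (norm (T d))\<^sup>2"
        by (simp add: norm_add_sq cinner_scaleC_right norm_scaleC norm_mult power_mult_distrib)
      also have "\<dots> \<le> (norm d)\<^sup>2 - 2 * \<rho> * (\<alpha> * (norm d)\<^sup>2) + \<rho>\<^sup>2 * (K * norm d)\<^sup>2"
      proof -
        have "norm (T d) \<le> norm T * norm d" by (rule norm_blinfun)
        also have "\<dots> \<le> K * norm d" using a by (intro mult_right_mono) (auto simp: K_def)
        finally have "(norm (T d))\<^sup>2 \<le> (K * norm d)\<^sup>2" by (intro power_mono) auto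
        then show ?thesis using co[of d] \<rho>
          by (intro add_mono diff_mono mult_left_mono) auto
      qed
      also have "\<dots> = q * (norm d)\<^sup>2"
        using K by (simp add: q_def \<rho>_def field_simps power2_eq_square)
      also have "\<dots> = (sqrt q * norm d)\<^sup>2" using q by (simp add: power_mult_distrib)
      finally have "norm (F u - F v) \<le> sqrt q * norm d" by (rule power2_le_imp_le) (use q in simp)
      then show ?thesis by (simp add: dist_norm d_def)
    qed
    have "\<exists>!x. F x = x"
      by (rule banach_fix_type[of "sqrt q"]) (use q contr in auto)
    then obtain x where "F x = x" by blast
    then have "(\<i> * of_real \<rho>) *\<^sub>C (T x - y) = 0" by (simp add: F_def)
    then have "norm ((\<i> * of_real \<rho>) *\<^sub>C (T x - y)) = 0" by simp
    then show ?thesis using \<rho> by (intro exI[of _ x]) (simp add: norm_scaleC norm_mult)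
  qed
  then show inv: "boundedly_invertible T" by (rule boundedly_invertibleI[OF T low])
  show "norm (op_inv T) \<le> 1 / \<alpha>" by (rule norm_op_inv_le[OF inv low]) (use a in simp)
qed

text \<open>\<open>T x = y\<close> is the fixed point equation
  \<open>x = op_inv S (y - (T - S) x)\<close>, whose right side contracts by the factor
  \<open>q\<close>. The same smallness gives a lower bound for \<open>T\<close> with constant
  \<open>k / (1 - q)\<close>.\<close>

lemma perturb_invertible:
  fixes S T :: "'a::complex_hilbert_space \<Rightarrow>\<^sub>L 'a"
  assumes S: "boundedly_invertible S" "norm (op_inv S) \<le> k" and T: "T \<in> cbounded_ops"
    and q: "norm (T - S) * k \<le> q" "q < 1"
  shows "boundedly_invertible T"
proof -
  have k: "0 \<le> k" using S(2) norm_ge_zero[of "op_inv S"] by linarith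
  have q0: "0 \<le> q" using q k by (meson mult_nonneg_nonneg norm_ge_zero order_trans)
  have d: "k * norm ((T - S) x) \<le> q * norm x" for x
  proof -
    have "k * norm ((T - S) x) \<le> k * (norm (T - S) * norm x)"
      by (intro mult_left_mono norm_blinfun k)
    also have "\<dots> = (norm (T - S) * k) * norm x" by simp
    also have "\<dots> \<le> q * norm x" by (intro mult_right_mono q) simp
    finally show ?thesis .
  qed
  have low: "norm x \<le> (k / (1 - q)) * norm (T x)" for x
  proof -
    have "norm x \<le> k * norm (S x)" by (rule boundedly_invertible_lower[OF S])
    also have "\<dots> \<le> k * (norm (T x) + norm ((T - S) x))"
      using norm_triangle_ineq4[of "T x" "(T - S) x"] k by (intro mult_left_mono) (auto simp: blinfun.diff_left)
    also have "\<dots> \<le> k * norm (T x) + q * norm x" using d[of x] by (simp add: algebra_simps)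
    finally show ?thesis using q(2) by (simp add: field_simps)
  qed
  have "\<exists>x. T x = y" for y
  proof -
    define F where "F = (\<lambda>x. op_inv S (y - (T - S) x))"
    have "dist (F u) (F v) \<le> q * dist u v" for u v
    proof -
      have "F u - F v = op_inv S ((T - S) (v - u))"
        by (simp add: F_def blinfun.diff_right algebra_simps)
      then have "norm (F u - F v) \<le> norm (op_inv S) * norm ((T - S) (v - u))"
        by (simp only: norm_blinfun)
      also have "\<dots> \<le> k * norm ((T - S) (v - u))" by (intro mult_right_mono S) simp
      also have "\<dots> \<le> q * norm (v - u)" by (rule d)
      finally show ?thesis by (simp add: dist_norm norm_minus_commute)
    qed
    then have "\<exists>!x. F x = x" by (intro banach_fix_type[of q] q0 q) auto
    then obtain x where "F x = x" by blast
    then have "S x = y - (T - S) x" unfolding F_def by (metis op_inv(3)[OF S(1)])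
    then have "T x = y" by (simp add: blinfun.diff_left)
    then show ?thesis by blast
  qed
  then show ?thesis by (rule boundedly_invertibleI[OF T low])
qed

text \<open>Dissipativity is kept as a condition on the quadratic form, so that estimates avoid the
  adjoint; \<open>op_nonneg_Im_iff\<close> connects it with nonnegativity of
  \<open>op_Im\<close>.\<close>

definition dissipative :: "('a::complex_inner \<Rightarrow>\<^sub>L 'a) \<Rightarrow> bool" where
  "dissipative T \<longleftrightarrow> T \<in> cbounded_ops \<and> (\<forall>x. Im (cinner x (T x)) \<ge> 0)"

lemma dissipative_shift:
  fixes T :: "'a::complex_hilbert_space \<Rightarrow>\<^sub>L 'a"
  assumes T: "dissipative T" and c: "Im c > 0"
  shows "boundedly_invertible (shift_op T c)" "norm (op_inv (shift_op T c)) \<le> 1 / Im c"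
proof -
  have "Im c * (norm x)\<^sup>2 \<le> Im (cinner x (shift_op T c x))" for x
    using T by (simp add: blinfun.add_left cinner_add_right cinner_scaleC_right cinner_self dissipative_def
      flip: of_real_power)
  moreover have "shift_op T c \<in> cbounded_ops" using T by (simp add: dissipative_def)
  ultimately show "boundedly_invertible (shift_op T c)" "norm (op_inv (shift_op T c)) \<le> 1 / Im c"
    using coercive_invertible[OF _ c] by blast+
qed

text \<open>Two estimates are combined. Coercivity bounds the inverse by 1/t. For small t the shift
  is a perturbation of \<open>T\<close>, which gives \<open>2 * k\<close>, and for larger t the
  bound 1/t is already below that. Together they give decay like 1/(1+t) down to t = 0, as both ends
  of the logarithm integral require.\<close>

lemma dissipative_shift_bound:
  fixes T :: "'a::complex_hilbert_space \<Rightarrow>\<^sub>L 'a"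
  assumes T: "dissipative T" "boundedly_invertible T" "norm (op_inv T) \<le> k" and t: "t \<ge> 0"
  shows "boundedly_invertible (shift_op T (\<i> * of_real t))"
    "norm (op_inv (shift_op T (\<i> * of_real t))) \<le> (2 * k + 1) / (1 + t)"
proof -
  let ?S = "shift_op T (\<i> * of_real t)"
  have k: "0 \<le> k" using T(3) norm_ge_zero[of "op_inv T"] by linarith
  show inv: "boundedly_invertible ?S"
    using dissipative_shift[OF T(1), of "\<i> * of_real t"] T t by (cases "t = 0") auto
  let ?N = "norm (op_inv ?S)"
  have a: "t * ?N \<le> 1"
    using dissipative_shift(2)[OF T(1), of "\<i> * of_real t"] t by (cases "t = 0") (auto simp: field_simps)
  have b: "?N \<le> 2 * k"
  proof (cases "t * k \<le> 1/2")
    case True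
    have "norm x \<le> 2 * k * norm (?S x)" for x
    proof -
      have "norm x \<le> k * norm (T x)" by (rule boundedly_invertible_lower[OF T(2,3)])
      also have "\<dots> \<le> k * (norm (?S x) + t * norm x)"
        using norm_triangle_ineq4[of "?S x" "(\<i> * of_real t) *\<^sub>C x"] k t
        by (intro mult_left_mono) (auto simp: blinfun.add_left norm_scaleC norm_mult)
      also have "\<dots> = k * norm (?S x) + t * k * norm x" by (simp add: algebra_simps)
      also have "\<dots> \<le> k * norm (?S x) + 1/2 * norm x" by (intro add_mono mult_right_mono True) auto
      finally show ?thesis by simp
    qed
    then show ?thesis by (intro norm_op_inv_le[OF inv]) (use k in auto)
  next
    case False
    then have "t > 0" using t by (cases "t = 0") auto
    then have "?N \<le> 1 / t" using a by (simp add: field_simps)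
    also have "\<dots> \<le> 2 * k" using False \<open>t > 0\<close> by (simp add: field_simps)
    finally show ?thesis .
  qed
  have "(1 + t) * ?N \<le> 2 * k + 1" using a b by (simp add: algebra_simps)
  then show "?N \<le> (2 * k + 1) / (1 + t)" using t by (simp add: field_simps)
qed

section \<open>Resolvent identity and analyticity of operator inverses\<close>

lemma op_inv_diff:
  assumes "boundedly_invertible S" "boundedly_invertible T"
  shows "op_inv S - op_inv T = op_inv S o\<^sub>L (T - S) o\<^sub>L op_inv T"
  by (rule blinfun_eqI) (simp add: blinfun.diff_left blinfun.diff_right op_inv[OF assms(1)] op_inv[OF assms(2)])

lemma norm_compose3_le:
  "norm (A o\<^sub>L B o\<^sub>L C) \<le> norm A * norm B * norm C"
  by (meson mult_right_mono norm_blinfun_compose norm_ge_zero order_trans)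

lemma norm_id_le: "norm (id_blinfun :: 'a::real_normed_vector \<Rightarrow>\<^sub>L 'a) \<le> 1"
  by (rule norm_blinfun_bound) auto

text \<open>By the resolvent identity the difference quotient is minus the product of
  \<open>op_inv (A w)\<close>, the difference quotient of \<open>A\<close>, and
  \<open>op_inv (A z)\<close>. The uniform bound \<open>K\<close> makes the inverse norm-continuous
  at \<open>z\<close>, so the limit is taken factor by factor. Matrix elements are differentiated
  because scalar function theory is applied to them.\<close>

lemma op_inv_field_derivative:
  fixes A :: "complex \<Rightarrow> 'a::complex_hilbert_space \<Rightarrow>\<^sub>L 'a"
  assumes S: "open S" "z \<in> S" and inv: "\<And>w. w \<in> S \<Longrightarrow> boundedly_invertible (A w)"
    and bd: "\<And>w. w \<in> S \<Longrightarrow> norm (op_inv (A w)) \<le> K"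
    and der: "(A has_derivative (\<lambda>h. h *\<^sub>C D)) (at z)"
  shows "((\<lambda>w. cinner f (op_inv (A w) g)) has_field_derivative
      - cinner f (op_inv (A z) (D (op_inv (A z) g)))) (at z)"
proof -
  have ev: "eventually (\<lambda>w. w \<in> S) (at z)" using S by (rule eventually_at_in_open')
  have cont: "(A \<longlongrightarrow> A z) (at z)" using has_derivative_continuous[OF der] by (simp add: continuous_within)
  have K: "0 \<le> K" using bd[OF S(2)] norm_ge_zero[of "op_inv (A z)"] by linarith
  have invc: "((\<lambda>w. op_inv (A w)) \<longlongrightarrow> op_inv (A z)) (at z)"
  proof (rule LIM_zero_cancel, rule Lim_null_comparison)
    show "eventually (\<lambda>w. norm (op_inv (A w) - op_inv (A z)) \<le> K * norm (A z - A w) * K) (at z)"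
    proof (rule eventually_mono[OF ev])
      fix w assume w: "w \<in> S"
      have "norm (op_inv (A w) - op_inv (A z)) \<le> norm (op_inv (A w)) * norm (A z - A w) * norm (op_inv (A z))"
        unfolding op_inv_diff[OF inv[OF w] inv[OF S(2)]] by (rule norm_compose3_le)
      also have "\<dots> \<le> K * norm (A z - A w) * K"
        by (intro mult_mono bd w S) (use K in auto)
      finally show "norm (op_inv (A w) - op_inv (A z)) \<le> K * norm (A z - A w) * K" .
    qed
    have "((\<lambda>w. K * norm (A z - A w) * K) \<longlongrightarrow> K * norm (A z - A z) * K) (at z)"
      by (intro tendsto_intros cont)
    then show "((\<lambda>w. K * norm (A z - A w) * K) \<longlongrightarrow> 0) (at z)" by simp
  qed
  define Q where "Q = (\<lambda>w. inverse (w - z) *\<^sub>C (A w - A z))"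
  have Q: "(Q \<longlongrightarrow> D) (at z)"
  proof (rule LIM_zero_cancel, rule Lim_null_comparison)
    show "((\<lambda>w. norm ((A w - A z) - (w - z) *\<^sub>C D) / norm (w - z)) \<longlongrightarrow> 0) (at z)"
      using der unfolding has_derivative_iff_norm by simp
    show "eventually (\<lambda>w. norm (Q w - D) \<le> norm ((A w - A z) - (w - z) *\<^sub>C D) / norm (w - z)) (at z)"
    proof (rule eventually_mono[OF eventually_neq_at_within])
      fix w assume "w \<noteq> z"
      then have "Q w - D = inverse (w - z) *\<^sub>C ((A w - A z) - (w - z) *\<^sub>C D)"
        by (simp add: Q_def cvs.scale_right_diff_distrib scaleC_scaleC)
      then show "norm (Q w - D) \<le> norm ((A w - A z) - (w - z) *\<^sub>C D) / norm (w - z)"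
        by (simp add: norm_scaleC norm_inverse divide_inverse)
    qed
  qed
  have "((\<lambda>w. - cinner f (op_inv (A w) (Q w (op_inv (A z) g)))) \<longlongrightarrow>
      - cinner f (op_inv (A z) (D (op_inv (A z) g)))) (at z)"
    by (intro tendsto_intros invc Q)
  moreover have "eventually (\<lambda>w. - cinner f (op_inv (A w) (Q w (op_inv (A z) g))) =
     (cinner f (op_inv (A w) g) - cinner f (op_inv (A z) g)) / (w - z)) (at z)"
  proof (rule eventually_mono[OF eventually_conj[OF ev eventually_neq_at_within]])
    fix w assume w: "w \<in> S \<and> w \<noteq> z"
    have "cinner f (op_inv (A w) g) - cinner f (op_inv (A z) g) = cinner f ((op_inv (A w) - op_inv (A z)) g)"
      by (simp add: cinner_diff_right blinfun.diff_left)
    also have "\<dots> = - cinner f (op_inv (A w) ((A w - A z) (op_inv (A z) g)))"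
      using w by (subst op_inv_diff[OF inv inv]) (auto simp: S blinfun.diff_left blinfun.diff_right cinner_diff_right)
    finally show "- cinner f (op_inv (A w) (Q w (op_inv (A z) g))) =
     (cinner f (op_inv (A w) g) - cinner f (op_inv (A z) g)) / (w - z)"
      using w unfolding Q_def blinfun_apply_scaleC
      by (simp add: cbounded_opsD[OF op_inv(1)[OF inv]] cinner_scaleC_right divide_inverse mult.commute)
  qed
  ultimately show ?thesis
    unfolding has_field_derivative_iff by (rule Lim_transform_eventually)
qed

section \<open>The logarithm\<close>

lemma integrable_on_half_line:
  fixes f :: "real \<Rightarrow> 'b::banach"
  assumes cont: "continuous_on {0..} f" and bd: "\<And>x. x \<ge> 0 \<Longrightarrow> norm (f x) \<le> C / (1 + x)\<^sup>2"
  shows "f integrable_on {0..}"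
proof -
  define G where "G = (\<lambda>r. integral {0..r} f)"
  have C: "C \<ge> 0" using bd[of 0] norm_ge_zero[of "f 0"] by (simp del: norm_ge_zero)
  have int: "f integrable_on {a..b}" if "0 \<le> a" for a b
    by (intro integrable_continuous_interval continuous_on_subset[OF cont]) (use that in auto)
  have est: "norm (G s - G r) \<le> C / (1 + r)" if "0 \<le> r" "r \<le> s" for r s
  proof -
    have hi: "((\<lambda>x. C / (1 + x)\<^sup>2) has_integral (- C / (1 + s) - (- C / (1 + r)))) {r..s}"
    proof (rule fundamental_theorem_of_calculus)
      fix x assume "x \<in> {r..s}"
      then have "((\<lambda>x. - C / (1 + x)) has_real_derivative C / (1 + x)\<^sup>2) (at x within {r..s})"
        using that by (auto intro!: derivative_eq_intros simp: power2_eq_square)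
      then show "((\<lambda>x. - C / (1 + x)) has_vector_derivative C / (1 + x)\<^sup>2) (at x within {r..s})"
        by (simp add: has_real_derivative_iff_has_vector_derivative)
    qed fact
    have "G s - G r = integral {r..s} f"
      unfolding G_def using Henstock_Kurzweil_Integration.integral_combine[OF that int[of 0 s]] by (simp add: algebra_simps)
    also have "norm \<dots> \<le> integral {r..s} (\<lambda>x. C / (1 + x)\<^sup>2)"
      by (rule integral_norm_bound_integral) (use int hi that bd in auto)
    also have "\<dots> = C / (1 + r) - C / (1 + s)" using hi by (simp add: integral_unique)
    also have "\<dots> \<le> C / (1 + r)" using C that by simp
    finally show ?thesis .
  qed
  show ?thesis
  proof (subst integrable_alt, intro conjI allI impI)
    show "(\<lambda>x. if x \<in> {0..} then f x else 0) integrable_on cbox a b" for a b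
    proof -
      have "{0..} \<inter> cbox a b = {max 0 a..b}" by (auto simp: cbox_interval)
      then show ?thesis unfolding integrable_restrict_Int using int[of "max 0 a" b] by simp
    qed
    fix e :: real assume e: "e > 0"
    have "(\<lambda>n. C / (1 + real n)) \<longlonglongrightarrow> 0" by real_asymp
    then obtain N where N: "C / (1 + real N) < e" using e C by (auto dest!: LIMSEQ_D[of _ 0 e])
    \<comment> \<open>A box containing this ball reaches from a nonpositive left end to at least
      \<open>N\<close>; cut off at 0, its integral is \<open>G b\<close>, so the Cauchy criterion
      reduces to a tail estimate.\<close>
    have G: "integral (cbox a b) (\<lambda>x. if x \<in> {0..} then f x else 0) = G b" "real N \<le> b"
      if "ball 0 (real N + 1) \<subseteq> cbox a b" for a b
    proof -
      have "0 \<in> ball 0 (real N + 1)" "real N \<in> ball 0 (real N + 1)" by auto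
      with that have "0 \<in> cbox a b" "real N \<in> cbox a b" by blast+
      then have a: "a \<le> 0" and b: "real N \<le> b" by auto
      show "real N \<le> b" by (rule b)
      have "{0..} \<inter> cbox a b = {0..b}" using a by (auto simp: cbox_interval)
      then show "integral (cbox a b) (\<lambda>x. if x \<in> {0..} then f x else 0) = G b"
        by (simp only: Henstock_Kurzweil_Integration.integral_restrict_Int G_def)
    qed
    have est': "norm (G s - G r) < e" if "real N \<le> r" "r \<le> s" for r s
    proof -
      have "C / (1 + r) \<le> C / (1 + real N)" using that C by (intro divide_left_mono) auto
      then show ?thesis using est[of r s] that N by simp
    qed
    show "\<exists>B>0. \<forall>a b c d. ball 0 B \<subseteq> cbox a b \<and> ball 0 B \<subseteq> cbox c d \<longrightarrow>
      norm (integral (cbox a b) (\<lambda>x. if x \<in> {0..} then f x else 0) -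
        integral (cbox c d) (\<lambda>x. if x \<in> {0..} then f x else 0)) < e"
    proof (intro exI[of _ "real N + 1"] conjI allI impI; (elim conjE)?)
      fix a b c d :: real assume ab: "ball 0 (real N + 1) \<subseteq> cbox a b" and cd: "ball 0 (real N + 1) \<subseteq> cbox c d"
      have "norm (G b - G d) < e"
        using est'[OF G(2)[OF ab], of d] est'[OF G(2)[OF cd], of b] by (cases "b \<le> d") (auto simp: norm_minus_commute)
      then show "norm (integral (cbox a b) (\<lambda>x. if x \<in> {0..} then f x else 0) -
        integral (cbox c d) (\<lambda>x. if x \<in> {0..} then f x else 0)) < e"
        by (simp only: G(1)[OF ab] G(1)[OF cd])
    qed simp
  qed
qed

abbreviation log_integrand :: "('a::complex_inner \<Rightarrow>\<^sub>L 'a) \<Rightarrow> real \<Rightarrow> ('a \<Rightarrow>\<^sub>L 'a)" where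
  "log_integrand T t \<equiv> op_inv (shift_op T (\<i> * complex_of_real t))
       - inverse (1 + \<i> * complex_of_real t) *\<^sub>C id_blinfun"

lemma cmod_one_plus_it: "t \<ge> 0 \<Longrightarrow> (1 + t) / 2 \<le> cmod (1 + \<i> * of_real t)"
  using complex_Re_le_cmod[of "1 + \<i> * of_real t"] abs_Im_le_cmod[of "1 + \<i> * of_real t"] by auto

lemma one_plus_it_nz: "1 + \<i> * complex_of_real t \<noteq> 0"
  by (simp add: complex_eq_iff)

text \<open>The integrand factors into the scalar inverse of 1 + it, the inverse of T + it, and I -
  T. The first two are each O(1/(1+t)), which gives quadratic decay. Continuity comes from a
  Lipschitz bound for the resolvent in t.\<close>

lemma log_integrand:
  fixes T :: "'a::complex_hilbert_space \<Rightarrow>\<^sub>L 'a"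
  assumes T: "dissipative T" "boundedly_invertible T" "norm (op_inv T) \<le> k"
  shows "t \<ge> 0 \<Longrightarrow> norm (log_integrand T t) \<le> 2 * (2 * k + 1) * (norm T + 1) / (1 + t)\<^sup>2"
    and "continuous_on {0..} (log_integrand T)"
proof -
  let ?S = "\<lambda>t. shift_op T (\<i> * complex_of_real t)"
  have k: "0 \<le> k" using T(3) norm_ge_zero[of "op_inv T"] by linarith
  note inv = dissipative_shift_bound(1)[OF T] and bd = dissipative_shift_bound(2)[OF T]
  show "norm (log_integrand T t) \<le> 2 * (2 * k + 1) * (norm T + 1) / (1 + t)\<^sup>2" if t: "t \<ge> 0"
  proof -
    let ?c = "inverse (1 + \<i> * complex_of_real t)"
    have "log_integrand T t = ?c *\<^sub>C (op_inv (?S t) o\<^sub>L (id_blinfun - T))"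
    proof (rule blinfun_eqI)
      fix x
      have "(id_blinfun - T) x = (1 + \<i> * of_real t) *\<^sub>C x - ?S t x"
        by (simp add: blinfun.add_left blinfun.diff_left scaleC_add_left)
      then have "(?c *\<^sub>C (op_inv (?S t) o\<^sub>L (id_blinfun - T))) x =
          ?c *\<^sub>C ((1 + \<i> * of_real t) *\<^sub>C op_inv (?S t) x - x)"
        by (simp only: blinfun_apply_scaleC blinfun_apply_blinfun_compose blinfun.diff_right
            op_inv[OF inv[OF t]] cbounded_opsD[OF op_inv(1)[OF inv[OF t]]])
      also have "\<dots> = log_integrand T t x"
        using one_plus_it_nz[of t] by (simp add: cvs.scale_right_diff_distrib scaleC_scaleC blinfun.diff_left)
      finally show "log_integrand T t x = (?c *\<^sub>C (op_inv (?S t) o\<^sub>L (id_blinfun - T))) x" by simp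
    qed
    then have "norm (log_integrand T t) = cmod ?c * norm (op_inv (?S t) o\<^sub>L (id_blinfun - T))"
      by (simp add: norm_scaleC)
    also have "\<dots> \<le> (2 / (1 + t)) * (((2 * k + 1) / (1 + t)) * (norm T + 1))"
    proof (intro mult_mono)
      show "cmod ?c \<le> 2 / (1 + t)"
        using le_imp_inverse_le[OF cmod_one_plus_it[OF t]] t by (simp add: norm_inverse)
      have "norm (op_inv (?S t) o\<^sub>L (id_blinfun - T)) \<le> norm (op_inv (?S t)) * norm (id_blinfun - T)"
        by (rule norm_blinfun_compose)
      also have "\<dots> \<le> ((2 * k + 1) / (1 + t)) * (norm T + 1)"
        using norm_triangle_ineq4[of id_blinfun T] norm_id_le k t
        by (intro mult_mono bd[OF t]) (auto intro: order_trans)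
      finally show "norm (op_inv (?S t) o\<^sub>L (id_blinfun - T)) \<le> ((2 * k + 1) / (1 + t)) * (norm T + 1)" .
    qed (use t in auto)
    also have "\<dots> = 2 * (2 * k + 1) * (norm T + 1) / (1 + t)\<^sup>2"
      by (simp add: power2_eq_square)
    finally show ?thesis .
  qed
  have "lipschitz_on ((2 * k + 1)\<^sup>2) {0..} (\<lambda>t. op_inv (?S t))"
  proof (rule lipschitz_onI)
    fix s t :: real assume "s \<in> {0..}" "t \<in> {0..}"
    then have s: "0 \<le> s" and t: "0 \<le> t" by auto
    have b1: "norm (op_inv (?S r)) \<le> 2 * k + 1" if "0 \<le> r" for r
    proof -
      have "(2 * k + 1) / (1 + r) \<le> (2 * k + 1) / 1" using k that by (intro divide_left_mono) auto
      then show ?thesis using bd[OF that] by simp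
    qed
    have "?S t - ?S s = (\<i> * of_real (t - s)) *\<^sub>C id_blinfun"
      by (simp add: algebra_simps)
    then have d: "norm (?S t - ?S s) \<le> \<bar>t - s\<bar>"
      using norm_id_le[where 'a = 'a] by (simp add: norm_scaleC norm_mult mult_left_le flip: of_real_diff)
    have "norm (op_inv (?S s) - op_inv (?S t)) \<le> norm (op_inv (?S s)) * norm (?S t - ?S s) * norm (op_inv (?S t))"
      unfolding op_inv_diff[OF inv[OF s] inv[OF t]] by (rule norm_compose3_le)
    also have "\<dots> \<le> (2 * k + 1) * \<bar>t - s\<bar> * (2 * k + 1)"
      using k by (intro mult_mono d b1 s t) auto
    finally show "dist (op_inv (?S s)) (op_inv (?S t)) \<le> (2 * k + 1)\<^sup>2 * dist s t"
      by (simp add: dist_norm power2_eq_square mult_ac abs_minus_commute)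
  qed simp
  then have c1: "continuous_on {0..} (\<lambda>t. op_inv (?S t))" by (rule lipschitz_on_continuous_on)
  have "continuous_on {0..} (\<lambda>t. inverse (1 + \<i> * complex_of_real t))"
    by (intro continuous_intros) (simp add: one_plus_it_nz)
  then have "continuous_on {0..} (\<lambda>t. inverse (1 + \<i> * complex_of_real t) *\<^sub>C (id_blinfun :: 'a \<Rightarrow>\<^sub>L 'a))"
    by (rule bounded_linear.continuous_on[OF bounded_linear_scaleC_left])
  with c1 show "continuous_on {0..} (log_integrand T)" by (intro continuous_intros)
qed

lemma bounded_linear_cinner_apply: "bounded_linear (\<lambda>A. cinner f (blinfun_apply A g))"
  by (rule bounded_linear_compose[OF cinner.bounded_linear_right blinfun.bounded_linear_left])

lemma cinner_log_integrand:
  "cinner f (log_integrand T t g) =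
     cinner f (op_inv (shift_op T (\<i> * of_real t)) g) - inverse (1 + \<i> * of_real t) * cinner f g"
  by (simp add: blinfun.diff_left cinner_diff_right cinner_scaleC_right)

text \<open>Bounded linear maps commute with the integral. Matrix evaluation gives the scalar
  integrals; the defect of complex homogeneity, which vanishes on the integrand, therefore vanishes
  on the integral, and the logarithm is complex linear.\<close>

lemma op_log:
  fixes T :: "'a::complex_hilbert_space \<Rightarrow>\<^sub>L 'a"
  assumes T: "dissipative T" "boundedly_invertible T"
  shows "op_log T \<in> cbounded_ops"
    and "((\<lambda>t. cinner f (log_integrand T t g)) has_integral \<i> * cinner f (op_log T g)) {0..}"
proof -
  have I: "log_integrand T integrable_on {0..}"
    by (rule integrable_on_half_line[OF log_integrand(2)[OF T order_refl] log_integrand(1)[OF T order_refl]])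
  let ?I = "integral {0..} (log_integrand T)"
  have L: "op_log T = (- \<i>) *\<^sub>C ?I" by (simp add: op_log_def)
  have hi: "((h \<circ> log_integrand T) has_integral h ?I) {0..}" if "bounded_linear h" for h :: "_ \<Rightarrow> 'c::real_normed_vector"
    by (rule has_integral_linear[OF integrable_integral[OF I] that])
  have gc: "log_integrand T t \<in> cbounded_ops" if "t \<ge> 0" for t
    using op_inv(1)[OF dissipative_shift_bound(1)[OF T order_refl that]] by simp
  have "?I (c *\<^sub>C x) = c *\<^sub>C ?I x" for c x
  proof -
    let ?h = "\<lambda>A :: 'a \<Rightarrow>\<^sub>L 'a. A (c *\<^sub>C x) - c *\<^sub>C A x"
    have "bounded_linear ?h"
      by (intro bounded_linear_sub bounded_linear_compose[OF bounded_linear_scaleC_right] blinfun.bounded_linear_left)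
    from hi[OF this] have "((?h \<circ> log_integrand T) has_integral ?h ?I) {0..}" .
    moreover have "((?h \<circ> log_integrand T) has_integral 0) {0..}"
      by (rule has_integral_is_0) (use cbounded_opsD[OF gc] in auto)
    ultimately have "?h ?I = 0" by (rule has_integral_unique)
    then show ?thesis by simp
  qed
  then have "?I \<in> cbounded_ops" by (simp add: cbounded_ops_def)
  then show "op_log T \<in> cbounded_ops" unfolding L by (rule cbounded_closed_simps)
  show "((\<lambda>t. cinner f (log_integrand T t g)) has_integral \<i> * cinner f (op_log T g)) {0..}"
    using hi[OF bounded_linear_cinner_apply[of f g]] unfolding o_def L blinfun_apply_scaleC cinner_scaleC_right
    by simp
qed

section \<open>Resolvents of a dissipative operator and the bounds for its logarithm\<close>

lemma resolvent_field_derivative: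
  fixes T :: "'a::complex_hilbert_space \<Rightarrow>\<^sub>L 'a"
  assumes T: "dissipative T" and z: "Im z > 0"
  shows "((\<lambda>w. cinner f (op_inv (shift_op T w) g)) has_field_derivative
      - cinner f (op_inv (shift_op T z) (op_inv (shift_op T z) g))) (at z)"
proof -
  have "((\<lambda>w. cinner f (op_inv (shift_op T w) g)) has_field_derivative
      - cinner f (op_inv (shift_op T z) (id_blinfun (op_inv (shift_op T z) g)))) (at z)"
  proof (rule op_inv_field_derivative[where K = "2 / Im z"])
    \<comment> \<open>Halving the height leaves a neighbourhood of \<open>z\<close> on which the
      inverses have one common bound \<open>2 / Im z\<close>.\<close>
    show "open {w. Im w > Im z / 2}" by (rule open_halfspace_Im_gt)
    show "boundedly_invertible (shift_op T w)" if "w \<in> {w. Im w > Im z / 2}" for w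
      using dissipative_shift(1)[OF T, of w] that z by simp
    show "norm (op_inv (shift_op T w)) \<le> 2 / Im z" if "w \<in> {w. Im w > Im z / 2}" for w
    proof -
      have "1 / Im w \<le> 2 / Im z" using that z by (simp add: field_simps)
      then show ?thesis using dissipative_shift(2)[OF T, of w] that z by simp
    qed
    have "((\<lambda>w. w *\<^sub>C id_blinfun) has_derivative (\<lambda>h. h *\<^sub>C (id_blinfun :: 'a \<Rightarrow>\<^sub>L 'a))) (at z)"
      by (rule bounded_linear_imp_has_derivative[OF bounded_linear_scaleC_left])
    from has_derivative_add[OF has_derivative_const this]
    show "(shift_op T has_derivative (\<lambda>h. h *\<^sub>C id_blinfun)) (at z)" by simp
  qed (use z in auto)
  then show ?thesis by simp
qed

text \<open>With \<open>g\<close> the resolvent applied to \<open>f\<close>, the element (f, g) is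
  the conjugate of (g, (T + z) g), whose imaginary part is nonnegative.\<close>

lemma Im_resolvent_nonpos:
  fixes T :: "'a::complex_hilbert_space \<Rightarrow>\<^sub>L 'a"
  assumes T: "dissipative T" and z: "Im z \<ge> 0" and inv: "boundedly_invertible (shift_op T z)"
  shows "Im (cinner f (op_inv (shift_op T z) f)) \<le> 0"
proof -
  define g where "g = op_inv (shift_op T z) f"
  have f: "f = T g + z *\<^sub>C g"
    using op_inv(3)[OF inv, of f] by (simp add: g_def blinfun.add_left)
  have "cinner f g = cnj (cinner g (T g) + z * cinner g g)"
    unfolding f by (subst cinner_commute) (simp add: cinner_add_right cinner_scaleC_right)
  then have "Im (cinner f g) = - Im (cinner g (T g)) - Im z * (norm g)\<^sup>2"
    by (simp add: cinner_self flip: of_real_power)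
  moreover have "Im (cinner g (T g)) \<ge> 0" using T by (simp add: dissipative_def)
  moreover have "Im z * (norm g)\<^sup>2 \<ge> 0" using z by simp
  ultimately show ?thesis by (simp add: g_def)
qed

text \<open>Substituting \<open>f = T g + z g\<close> once gives the exact remainder - (f, T g) / z,
  and for \<open>z\<close> beyond twice the norm of \<open>T\<close> the norm of \<open>g\<close> is
  at most 2 |f| / |z|.\<close>

lemma resolvent_asymptotics:
  fixes T :: "'a::complex_hilbert_space \<Rightarrow>\<^sub>L 'a"
  assumes T: "dissipative T" and z: "Im z > 0" and big: "2 * norm T \<le> cmod z"
  shows "cmod (cinner f (op_inv (shift_op T z) f) - of_real ((norm f)\<^sup>2) / z) \<le> 2 * norm T * (norm f)\<^sup>2 / (cmod z)\<^sup>2"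
proof -
  note inv = dissipative_shift(1)[OF T z]
  define g where "g = op_inv (shift_op T z) f"
  have z0: "z \<noteq> 0" "cmod z > 0" using z by auto
  have f: "f = T g + z *\<^sub>C g"
    using op_inv(3)[OF inv, of f] by (simp add: g_def blinfun.add_left)
  have "cmod z * norm g = norm (f - T g)" by (subst f) (simp add: norm_scaleC)
  also have "\<dots> \<le> norm f + norm T * norm g"
    using norm_triangle_ineq4[of f "T g"] norm_blinfun[of T g] by linarith
  also have "norm T * norm g \<le> (cmod z / 2) * norm g" using big by (intro mult_right_mono) auto
  finally have ng: "norm g \<le> 2 * norm f / cmod z" using z0 by (simp add: field_simps)
  have "cinner f f = cinner f (T g) + z * cinner f g"
    by (subst (2) f) (simp add: cinner_add_right cinner_scaleC_right)
  then have "cinner f g - of_real ((norm f)\<^sup>2) / z = - cinner f (T g) / z"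
    using z0 by (simp add: cinner_self field_simps)
  then have "cmod (cinner f g - of_real ((norm f)\<^sup>2) / z) = cmod (cinner f (T g)) / cmod z"
    by (simp add: norm_divide)
  also have "\<dots> \<le> (norm T * norm f * (2 * norm f / cmod z)) / cmod z"
    by (intro divide_right_mono order_trans[OF cinner_op_bound] mult_left_mono ng) auto
  also have "\<dots> = 2 * norm T * (norm f)\<^sup>2 / (cmod z)\<^sup>2" by (simp add: power2_eq_square)
  finally show ?thesis by (simp add: g_def)
qed

text \<open>The integral over \<open>[i e, i r]\<close> is compared with the horizontal segments from \<open>i e\<close> to
  \<open>i e \<plusminus> r\<close>, on which the integrand has nonpositive imaginary part; on the segments closing the
  triangles the integrand is \<open>\<parallel>f\<parallel>\<^sup>2 / z\<close> up to an integrable error.\<close>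

lemma resolvent_integral_bound:
  fixes T :: "'a::complex_hilbert_space \<Rightarrow>\<^sub>L 'a" and f :: 'a
  assumes T: "dissipative T" and e: "0 < e" "e \<le> r" and r: "4 * norm T \<le> r"
  defines "R \<equiv> \<lambda>z. cinner f (op_inv (shift_op T z) f)"
  shows "(\<lambda>t. Re (R (\<i> * of_real t))) integrable_on {e..r}"
    "\<bar>integral {e..r} (\<lambda>t. Re (R (\<i> * of_real t)))\<bar> \<le> pi / 2 * (norm f)\<^sup>2 + 16 * norm T * (norm f)\<^sup>2 / r"
proof -
  define U where "U = {z. Im z > 0}"
  have U: "convex U" "open U" by (simp_all add: U_def convex_halfspace_Im_gt open_halfspace_Im_gt)
  have "R holomorphic_on U"
    unfolding R_def holomorphic_on_open[OF U(2)] using resolvent_field_derivative[OF T] by (auto simp: U_def)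
  then obtain P where "\<And>z. z \<in> U \<Longrightarrow> (P has_field_derivative R z) (at z within U)"
    using holomorphic_convex_primitive'[OF U] by blast
  then have P: "(P has_field_derivative R z) (at z)" if "Im z > 0" for z
    using that at_within_open[OF _ U(2)] by (simp add: U_def)
  define \<delta> where "\<delta> = 16 * norm T * (norm f)\<^sup>2 / r"
  have r0: "r > 0" using e by simp
  \<comment> \<open>On the vertical ray the chain rule contributes a factor i, so the real part of
    the resolvent is the derivative of the imaginary part of the primitive.\<close>
  have vert: "((\<lambda>t. Im (P (\<i> * of_real t))) has_vector_derivative Re (R (\<i> * of_real t))) (at t within S)" if "t > 0" for t S
  proof -
    have "((\<lambda>t. \<i> * complex_of_real t) has_vector_derivative \<i>) (at t)"
      by (auto intro!: derivative_eq_intros)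
    from field_vector_diff_chain_at[OF this P] that
    have "((P \<circ> (\<lambda>t. \<i> * complex_of_real t)) has_vector_derivative \<i> * R (\<i> * of_real t)) (at t)" by simp
    from bounded_linear.has_vector_derivative[OF bounded_linear_Im this]
    show ?thesis by (auto simp: o_def intro: has_vector_derivative_at_within)
  qed
  have hi: "((\<lambda>t. Re (R (\<i> * of_real t))) has_integral Im (P (\<i> * of_real r)) - Im (P (\<i> * of_real e))) {e..r}"
    by (rule fundamental_theorem_of_calculus[OF e(2)]) (use e vert in auto)
  then show "(\<lambda>t. Re (R (\<i> * of_real t))) integrable_on {e..r}" by blast
  \<comment> \<open>The sign of the resolvent makes Im P nonincreasing along the horizontal line;
    moving right and moving left from i e yield the two sides of the final estimate.\<close>
  have hor: "Im (P (of_real b + \<i> * of_real e)) \<le> Im (P (of_real a + \<i> * of_real e))" if "a \<le> b" for a b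
  proof (rule DERIV_nonpos_imp_nonincreasing[OF that])
    fix s :: real
    have s: "Im (of_real s + \<i> * of_real e) > 0" using e by simp
    have "((\<lambda>s. complex_of_real s + \<i> * of_real e) has_vector_derivative 1) (at s)"
      by (auto intro!: derivative_eq_intros)
    from field_vector_diff_chain_at[OF this P[OF s]]
    have "((P \<circ> (\<lambda>s. complex_of_real s + \<i> * of_real e)) has_vector_derivative R (of_real s + \<i> * of_real e)) (at s)" by simp
    from bounded_linear.has_vector_derivative[OF bounded_linear_Im this]
    have "((\<lambda>s. Im (P (complex_of_real s + \<i> * of_real e))) has_real_derivative Im (R (of_real s + \<i> * of_real e))) (at s)"
      by (simp add: o_def has_real_derivative_iff_has_vector_derivative)
    moreover have "Im (R (of_real s + \<i> * of_real e)) \<le> 0"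
      unfolding R_def using s by (intro Im_resolvent_nonpos[OF T] dissipative_shift[OF T]) auto
    ultimately show "\<exists>y. DERIV (\<lambda>s. Im (P (complex_of_real s + \<i> * of_real e))) s :> y \<and> y \<le> 0" by blast
  qed
  \<comment> \<open>Subtracting a primitive of the leading term leaves a derivative of order
    |z|^-2.\<close>
  define Q where "Q = (\<lambda>z. P z - of_real ((norm f)\<^sup>2) * Ln z)"
  have far: "\<bar>Im (P (\<i> * of_real r)) - Im (P v) - (norm f)\<^sup>2 * (pi / 2 - Im (Ln v))\<bar> \<le> \<delta>"
    if s: "\<bar>s\<bar> = 1" and v: "v = of_real (s * r) + \<i> * of_real e" for s v
  proof -
    \<comment> \<open>For either sign \<open>s\<close> this convex set contains both i r and
      \<open>v\<close> and keeps |z| at least r/2, so the mean value inequality applies along a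
      segment of length at most 2 r.\<close>
    let ?S = "{z. Im z > 0} \<inter> {z. s * Re z + Im z \<ge> r}"
    have "convex {z. s * Re z + Im z \<ge> r}"
      using convex_halfspace_ge[of r "Complex s 1"] by (simp add: inner_complex_def)
    then have c: "convex ?S" by (intro convex_Int convex_halfspace_Im_gt)
    have ss: "s * s = 1" "s * (s * r) = r" using s by (auto simp: abs_if split: if_splits)
    have "cmod (\<i> * of_real r - v) \<le> \<bar>s * r\<bar> + \<bar>r - e\<bar>" using cmod_le[of "\<i> * of_real r - v"] by (simp add: v)
    then have d: "cmod (\<i> * of_real r - v) \<le> 2 * r" using s e by (simp add: abs_mult)
    have "cmod (Q (\<i> * of_real r) - Q v) \<le> (8 * norm T * (norm f)\<^sup>2 / r\<^sup>2) * cmod (\<i> * of_real r - v)"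
    proof (rule field_differentiable_bound[OF c])
      fix z assume "z \<in> ?S"
      moreover from this have "\<bar>s * Re z\<bar> + \<bar>Im z\<bar> \<ge> r" by auto
      ultimately have z: "Im z > 0" "r \<le> 2 * cmod z"
        using abs_Re_le_cmod[of z] abs_Im_le_cmod[of z] s by (auto simp: abs_mult)
      then have "z \<notin> \<real>\<^sub>\<le>\<^sub>0" "z \<noteq> 0" by (auto simp: complex_nonpos_Reals_iff)
      then show "(Q has_field_derivative R z - of_real ((norm f)\<^sup>2) / z) (at z within ?S)"
        unfolding Q_def
        by (auto intro!: derivative_eq_intros has_field_derivative_at_within[OF P[OF z(1)]] simp: divide_inverse)
      have "cmod (R z - of_real ((norm f)\<^sup>2) / z) \<le> 2 * norm T * (norm f)\<^sup>2 / (cmod z)\<^sup>2"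
        unfolding R_def using r z by (intro resolvent_asymptotics[OF T]) auto
      also have "\<dots> \<le> 2 * norm T * (norm f)\<^sup>2 / (r / 2)\<^sup>2"
        using z r0 by (intro divide_left_mono power_mono mult_pos_pos zero_less_power) auto
      also have "\<dots> = 8 * norm T * (norm f)\<^sup>2 / r\<^sup>2" by (simp add: power_divide)
      finally show "cmod (R z - of_real ((norm f)\<^sup>2) / z) \<le> 8 * norm T * (norm f)\<^sup>2 / r\<^sup>2" .
    qed (use e r0 in \<open>auto simp: v ss\<close>)
    also have "\<dots> \<le> (8 * norm T * (norm f)\<^sup>2 / r\<^sup>2) * (2 * r)" by (intro mult_left_mono d) simp
    also have "\<dots> = \<delta>" using r0 by (simp add: \<delta>_def power2_eq_square)
    finally have "cmod (Q (\<i> * of_real r) - Q v) \<le> \<delta>" .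
    then have "\<bar>Im (Q (\<i> * of_real r) - Q v)\<bar> \<le> \<delta>" using abs_Im_le_cmod order_trans by blast
    moreover have "Im (Ln (\<i> * of_real r)) = pi / 2" using Im_Ln_eq_pi_half[of "\<i> * of_real r"] r0 by simp
    ultimately show ?thesis by (simp add: Q_def algebra_simps flip: of_real_power)
  qed
  let ?v = "\<lambda>s. of_real (s * r) + \<i> * of_real e"
  have Ln: "0 \<le> Im (Ln (?v s))" "Im (Ln (?v s)) \<le> pi" for s
    using Im_Ln_pos_lt_imp[of "?v s"] e by auto
  \<comment> \<open>The arguments of both corner points lie between 0 and pi, so each leading term
    stays within pi/2 in the direction that is used.\<close>
  have "(norm f)\<^sup>2 * (pi / 2 - Im (Ln (?v 1))) \<le> (norm f)\<^sup>2 * (pi / 2)"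
    "(norm f)\<^sup>2 * (- (pi / 2)) \<le> (norm f)\<^sup>2 * (pi / 2 - Im (Ln (?v (- 1))))"
    using Ln[of 1] Ln[of "- 1"] by (intro mult_left_mono; simp)+
  moreover have "Im (P (?v 1)) \<le> Im (P (\<i> * of_real e))" "Im (P (\<i> * of_real e)) \<le> Im (P (?v (- 1)))"
    using hor[of 0 r] hor[of "- r" 0] r0 by simp_all
  ultimately have "\<bar>Im (P (\<i> * of_real r)) - Im (P (\<i> * of_real e))\<bar> \<le> (norm f)\<^sup>2 * (pi / 2) + \<delta>"
    using far[of 1, OF _ refl] far[of "- 1", OF _ refl] by (simp only: abs_le_iff) auto
  then show "\<bar>integral {e..r} (\<lambda>t. Re (R (\<i> * of_real t)))\<bar> \<le> pi / 2 * (norm f)\<^sup>2 + 16 * norm T * (norm f)\<^sup>2 / r"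
    unfolding integral_unique[OF hi] \<delta>_def by (simp add: mult.commute)
qed

text \<open>The scalar term of the integrand has real part \<open>1 / (1 + t\<^sup>2)\<close>, with
  integral pi/2. Hence - Im (f, log T f) + (pi/2) |f|^2 is a limit of resolvent integrals whose
  moduli are asymptotically at most (pi/2) |f|^2, and both inequalities express this one
  estimate.\<close>

lemma op_log_Im_bounds:
  fixes T :: "'a::complex_hilbert_space \<Rightarrow>\<^sub>L 'a"
  assumes T: "dissipative T" "boundedly_invertible T"
  shows "0 \<le> Im (cinner f (op_log T f))" "Im (cinner f (op_log T f)) \<le> pi * (norm f)\<^sup>2"
proof -
  define R where "R = (\<lambda>t::real. Re (cinner f (op_inv (shift_op T (\<i> * of_real t)) f)))"
  define F where "F = (\<lambda>t. Re (cinner f (log_integrand T t f)))"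
  define J where "J = {0::real..}"
  \<comment> \<open>Compact intervals exhausting the open half-line: the resolvent estimate requires
    a positive left end, and its error vanishes as the right end grows.\<close>
  define V where "V = (\<lambda>k::nat. {1 / (1 + real k)..1 + real k})"
  have FR: "F t = R t - (norm f)\<^sup>2 * (1 / (1 + t\<^sup>2))" for t
    by (simp add: F_def R_def cinner_log_integrand cinner_self power2_eq_square flip: of_real_power)
  have hF: "(F has_integral - Im (cinner f (op_log T f))) J"
    using has_integral_Re[OF op_log(2)[OF T, of f f]] by (simp add: F_def J_def)
  define C where "C = 2 * (2 * norm (op_inv T) + 1) * (norm T + 1) * (norm f)\<^sup>2"
  have Fb: "\<bar>F t\<bar> \<le> C / (1 + t)\<^sup>2" if "t \<ge> 0" for t
  proof -
    have "\<bar>F t\<bar> \<le> norm (log_integrand T t) * norm f * norm f"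
      unfolding F_def by (rule order_trans[OF abs_Re_le_cmod cinner_op_bound])
    also have "\<dots> \<le> 2 * (2 * norm (op_inv T) + 1) * (norm T + 1) / (1 + t)\<^sup>2 * norm f * norm f"
      by (intro mult_right_mono log_integrand(1)[OF T order_refl that]) auto
    finally show ?thesis by (simp add: C_def power2_eq_square)
  qed
  have hb: "(\<lambda>t. C / (1 + t)\<^sup>2) integrable_on J"
    unfolding J_def by (rule integrable_on_half_line[where C = C])
      (auto intro!: continuous_intros simp: C_def)
  have VJ: "V k \<subseteq> J" "J \<inter> V k = V k" for k by (auto simp: V_def J_def) 
  have arct: "((\<lambda>t. (norm f)\<^sup>2 * (1 / (1 + t\<^sup>2))) has_integral
      (norm f)\<^sup>2 * (arctan (1 + real k) - arctan (1 / (1 + real k)))) (V k)" for k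
  proof -
    have "((\<lambda>t. 1 / (1 + t\<^sup>2)) has_integral arctan (1 + real k) - arctan (1 / (1 + real k))) {1 / (1 + real k)..1 + real k}"
    proof (rule fundamental_theorem_of_calculus)
      have "(1 + real k) * (1 + real k) \<ge> 1 * 1" by (intro mult_mono) auto
      then show "1 / (1 + real k) \<le> 1 + real k" by (simp add: divide_le_eq)
      fix t :: real and S
      have "(arctan has_real_derivative 1 / (1 + t\<^sup>2)) (at t within S)"
        using DERIV_arctan[of t] by (simp add: divide_inverse has_field_derivative_at_within)
      then show "(arctan has_vector_derivative 1 / (1 + t\<^sup>2)) (at t within S)"
        by (simp only: has_real_derivative_iff_has_vector_derivative)
    qed
    then show ?thesis unfolding V_def by (rule has_integral_mult_right)
  qed
  \<comment> \<open>The point 0 lies in no \<open>V k\<close>, so the pointwise limit there is 0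
    instead of \<open>F 0\<close>; a single point does not affect the integral.\<close>
  have lim: "(\<lambda>k. integral J (\<lambda>t. if t \<in> V k then F t else 0)) \<longlonglongrightarrow> integral J (\<lambda>t. if t = 0 then 0 else F t)"
  proof (rule Equivalence_Lebesgue_Henstock_Integration.dominated_convergence(2)[OF _ hb])
    fix k
    have "F integrable_on V k"
      using integrable_on_subinterval[of F J "1 / (1 + real k)" "1 + real k"] hF VJ(1)[of k]
      unfolding V_def box_real by blast
    then show "(\<lambda>t. if t \<in> V k then F t else 0) integrable_on J"
      using VJ by (simp add: integrable_restrict_Int Int_commute)
  next
    show "norm (if t \<in> V k then F t else 0) \<le> C / (1 + t)\<^sup>2" if "t \<in> J" for k t
      using Fb[of t] that by (auto simp: J_def C_def)
  next
    fix t assume t: "t \<in> J"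
    show "(\<lambda>k. if t \<in> V k then F t else 0) \<longlonglongrightarrow> (if t = 0 then 0 else F t)"
    proof (cases "t = 0")
      case True
      have "0 \<notin> V k" for k by (auto simp: V_def not_le)
      then show ?thesis using True by simp
    next
      case False
      then have "t > 0" using t by (simp add: J_def)
      have "eventually (\<lambda>k. 1 / (1 + real k) < t) sequentially" "eventually (\<lambda>k. t < 1 + real k) sequentially"
        using \<open>t > 0\<close> by real_asymp+
      then have "eventually (\<lambda>k. (if t \<in> V k then F t else 0) = F t) sequentially"
        by eventually_elim (auto simp: V_def)
      then show ?thesis using False by (simp add: tendsto_eventually)
    qed
  qed
  have "integral J (\<lambda>t. if t = 0 then 0 else F t) = integral J F"
    by (rule integral_spike[of "{0}"]) auto
  also have "\<dots> = - Im (cinner f (op_log T f))" using hF by (rule integral_unique)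
  finally have lim1: "(\<lambda>k. integral (V k) F) \<longlonglongrightarrow> - Im (cinner f (op_log T f))"
    using lim VJ by (simp add: Henstock_Kurzweil_Integration.integral_restrict_Int Int_commute)
  define X where "X = (\<lambda>k. integral (V k) F + (norm f)\<^sup>2 * (arctan (1 + real k) - arctan (1 / (1 + real k))))"
  have "(\<lambda>k. arctan (1 + real k) - arctan (1 / (1 + real k))) \<longlonglongrightarrow> pi / 2" by real_asymp
  then have "X \<longlonglongrightarrow> - Im (cinner f (op_log T f)) + (norm f)\<^sup>2 * (pi / 2)"
    unfolding X_def by (intro tendsto_intros lim1)
  then have limX: "(\<lambda>k. \<bar>X k\<bar>) \<longlonglongrightarrow> \<bar>- Im (cinner f (op_log T f)) + (norm f)\<^sup>2 * (pi / 2)\<bar>"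
    by (rule tendsto_rabs)
  have limB: "(\<lambda>k. pi / 2 * (norm f)\<^sup>2 + 16 * norm T * (norm f)\<^sup>2 / (1 + real k)) \<longlonglongrightarrow> pi / 2 * (norm f)\<^sup>2"
    by real_asymp
  have XB: "\<bar>X k\<bar> \<le> pi / 2 * (norm f)\<^sup>2 + 16 * norm T * (norm f)\<^sup>2 / (1 + real k)" if k: "4 * norm T \<le> 1 + real k" for k
  proof -
    have e: "0 < 1 / (1 + real k)" "1 / (1 + real k) \<le> 1 + real k" by (auto simp: field_simps)
    note RB = resolvent_integral_bound[OF T(1) e k, of f, folded R_def, folded V_def]
    have "integral (V k) F = integral (V k) R - (norm f)\<^sup>2 * (arctan (1 + real k) - arctan (1 / (1 + real k)))"
      unfolding FR[abs_def] using RB(1) arct[of k]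
      by (subst Henstock_Kurzweil_Integration.integral_diff) (auto simp: R_def V_def integral_unique[OF arct[unfolded V_def]] dest: has_integral_integrable)
    then have "X k = integral (V k) R" by (simp add: X_def)
    then show ?thesis using RB(2) by (simp add: R_def V_def)
  qed
  have aux: "0 \<le> x \<and> x \<le> pi * c" if "\<bar>- x + c * (pi / 2)\<bar> \<le> pi / 2 * c" for x c :: real
  proof -
    have "\<bar>- x + d\<bar> \<le> d \<Longrightarrow> 0 \<le> x \<and> x \<le> d + d" for d by arith
    from this[of "pi / 2 * c"] that show ?thesis by (simp add: mult.commute)
  qed
  have "\<bar>- Im (cinner f (op_log T f)) + (norm f)\<^sup>2 * (pi / 2)\<bar> \<le> pi / 2 * (norm f)\<^sup>2"
    by (rule LIMSEQ_le[OF limX limB]) (intro exI[of _ "nat \<lceil>4 * norm T\<rceil>"] allI impI XB, linarith)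
  then show "0 \<le> Im (cinner f (op_log T f))" "Im (cinner f (op_log T f)) \<le> pi * (norm f)\<^sup>2"
    using aux[of "Im (cinner f (op_log T f))" "(norm f)\<^sup>2"] by blast+
qed

section \<open>The Cauchy distribution and the Cayley transform\<close>

definition cayley :: "real \<Rightarrow> complex" where
  "cayley t = (of_real t - \<i>) / (of_real t + \<i>)"

text \<open>The pull-back of normalized arc length under \<open>cayley\<close>, equivalently the
  Poisson kernel of the half-plane at i. Circle integrals are taken over the line from the outset,
  so no change of variables is made later.\<close>

definition cauchy_distr :: "real measure" where
  "cauchy_distr = density lborel (\<lambda>t. ennreal (inverse (pi * (1 + t\<^sup>2))))"

lemma of_real_plus_i_nz: "complex_of_real t + \<i> \<noteq> 0" "complex_of_real t - \<i> \<noteq> 0"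
  by (simp_all add: complex_eq_iff)

lemma norm_cayley [simp]: "cmod (cayley t) = 1"
proof -
  have "cmod (of_real t - \<i>) = cmod (of_real t + \<i>)" by (simp add: cmod_def)
  then show ?thesis using of_real_plus_i_nz[of t] by (simp add: cayley_def norm_divide)
qed

lemma cayley_cnj: "cayley t * cnj (cayley t) = 1"
  using complex_norm_square[of "cayley t"] by simp

lemma continuous_cayley: "continuous_on S cayley"
  unfolding cayley_def by (intro continuous_intros) (simp add: of_real_plus_i_nz)

lemma measurable_cayley [measurable]: "cayley \<in> borel_measurable borel"
  by (rule borel_measurable_continuous_onI[OF continuous_cayley])

lemma cauchy_density_pos: "0 < pi * (1 + t\<^sup>2)"
  by (intro mult_pos_pos) (auto intro: add_pos_nonneg)

lemma integrable_inverse_square: "integrable lborel (\<lambda>t::real. inverse (1 + t\<^sup>2))"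
    and integral_inverse_square: "(LINT t|lborel. inverse (1 + t\<^sup>2)) = pi"
  using integrable_inverse_1_plus_square LBINT_inverse_1_plus_square
  by (simp_all add: set_integrable_def interval_lebesgue_integral_def set_lebesgue_integral_def)

lemma sets_cauchy_distr [simp, measurable_cong]: "sets cauchy_distr = sets borel"
  by (simp add: cauchy_distr_def)

lemma space_cauchy_distr [simp]: "space cauchy_distr = UNIV"
  by (simp add: cauchy_distr_def)

lemma integrable_cauchy_distr_iff:
  fixes g :: "real \<Rightarrow> complex"
  assumes [measurable]: "g \<in> borel_measurable borel"
  shows "integrable cauchy_distr g \<longleftrightarrow> integrable lborel (\<lambda>t. inverse (pi * (1 + t\<^sup>2)) *\<^sub>R g t)"
  unfolding cauchy_distr_def using cauchy_density_pos by (intro integrable_density) (auto simp: less_imp_le)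

lemma integral_cauchy_distr:
  fixes g :: "real \<Rightarrow> complex"
  assumes [measurable]: "g \<in> borel_measurable borel"
  shows "integral\<^sup>L cauchy_distr g = (LINT t|lborel. inverse (pi * (1 + t\<^sup>2)) *\<^sub>R g t)"
  unfolding cauchy_distr_def using cauchy_density_pos by (intro integral_density) (auto simp: less_imp_le)

interpretation cauchy_distr: prob_space cauchy_distr
proof
  have "emeasure cauchy_distr (space cauchy_distr) = (\<integral>\<^sup>+t. ennreal (inverse (pi * (1 + t\<^sup>2))) \<partial>lborel)"
    by (simp add: cauchy_distr_def emeasure_density)
  also have "\<dots> = ennreal (LINT t|lborel. inverse (pi * (1 + t\<^sup>2)))"
    using integrable_inverse_square by (intro nn_integral_eq_integral) (auto simp: less_imp_le[OF cauchy_density_pos])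
  also have "(LINT t|lborel. inverse (pi * (1 + t\<^sup>2))) = 1"
    by (simp add: integral_inverse_square)
  finally show "emeasure cauchy_distr (space cauchy_distr) = 1" by simp
qed

lemma prob_cauchy_distr_UNIV [simp]: "measure cauchy_distr UNIV = 1"
  using cauchy_distr.prob_space by simp

lemma measurable_cnj_comp [measurable (raw)]:
  "f \<in> borel_measurable M \<Longrightarrow> (\<lambda>x. cnj (f x)) \<in> borel_measurable M"
  by (rule borel_measurable_continuous_on[of cnj]) (auto intro!: continuous_intros)

lemma integrable_cauchy_distr_bounded:
  fixes g :: "real \<Rightarrow> complex"
  assumes "g \<in> borel_measurable borel" "\<And>t. cmod (g t) \<le> B"
  shows "integrable cauchy_distr g"
  by (rule cauchy_distr.integrable_const_bound[where B = B]) (use assms in auto)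

lemma cayley_limits:
  "(cayley \<longlongrightarrow> 1) at_top" "(cayley \<longlongrightarrow> 1) at_bot"
proof -
  have eq: "cayley t = 1 - 2 * \<i> / (of_real t + \<i>)" for t
    using of_real_plus_i_nz[of t] by (simp add: cayley_def field_simps)
  have "((\<lambda>t. 2 * \<i> / (complex_of_real t + \<i>)) \<longlongrightarrow> 0) at_infinity"
  proof (rule Lim_null_comparison)
    show "eventually (\<lambda>t. cmod (2 * \<i> / (complex_of_real t + \<i>)) \<le> 2 * inverse (norm t)) at_infinity"
      unfolding eventually_at_infinity
    proof (intro exI[of _ 1] allI impI)
      fix t :: real assume "1 \<le> norm t"
      moreover have "\<bar>t\<bar> \<le> cmod (of_real t + \<i>)" using abs_Re_le_cmod[of "of_real t + \<i>"] by simp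
      ultimately have "inverse (cmod (of_real t + \<i>)) \<le> inverse \<bar>t\<bar>" by (intro le_imp_inverse_le) auto
      then show "cmod (2 * \<i> / (complex_of_real t + \<i>)) \<le> 2 * inverse (norm t)"
        by (simp add: norm_divide norm_mult divide_inverse norm_inverse)
    qed
    have "((\<lambda>t::real. 2 * norm (inverse t)) \<longlongrightarrow> 2 * norm (0::real)) at_infinity"
      by (intro tendsto_intros tendsto_inverse_0)
    then show "((\<lambda>t::real. 2 * inverse (norm t)) \<longlongrightarrow> 0) at_infinity" by simp
  qed
  then have "((\<lambda>t. 1 - 2 * \<i> / (complex_of_real t + \<i>)) \<longlongrightarrow> 1 - 0) at_infinity"
    by (intro tendsto_intros)
  then have "(cayley \<longlongrightarrow> 1) at_infinity" by (simp add: eq[abs_def])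
  then show "(cayley \<longlongrightarrow> 1) at_top" "(cayley \<longlongrightarrow> 1) at_bot"
    by (auto intro: tendsto_mono[OF at_top_le_at_infinity] tendsto_mono[OF at_bot_le_at_infinity])
qed

text \<open>The derivative of \<open>cayley\<close> is 2 i \<open>cayley\<close> / (1 + t^2), so a
  multiple of \<open>cayley t ^ n\<close> is a primitive of the weighted power. Both ends of the
  line tend to the same point 1 of the circle, and the boundary terms cancel.\<close>

lemma cayley_moment:
  assumes n: "n > 0"
  shows "(LINT t|cauchy_distr. cayley t ^ n) = 0"
proof -
  let ?f = "\<lambda>t. inverse (pi * (1 + t\<^sup>2)) *\<^sub>R cayley t ^ n"
  let ?F = "\<lambda>t. inverse (2 * \<i> * of_nat n * of_real pi) * cayley t ^ n"
  have "integrable cauchy_distr (\<lambda>t. cayley t ^ n)"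
    by (rule integrable_cauchy_distr_bounded[where B = 1]) (auto simp: norm_power)
  then have int: "integrable lborel ?f" by (simp add: integrable_cauchy_distr_iff)
  have der: "(?F has_vector_derivative ?f t) (at t)" for t
  proof -
    obtain m where m: "n = Suc m" using n gr0_implies_Suc by blast
    let ?g = "\<lambda>z. (z - \<i>) / (z + \<i>)"
    have sq: "complex_of_real (1 + t\<^sup>2) = (of_real t - \<i>) * (of_real t + \<i>)"
      by (simp add: algebra_simps power2_eq_square)
    have "(?g has_field_derivative 2 * \<i> / (of_real t + \<i>)\<^sup>2) (at (of_real t))"
      using of_real_plus_i_nz[of t] by (auto intro!: derivative_eq_intros simp: power2_eq_square)
    from DERIV_cmult[OF DERIV_power[OF this, of n]]
    have "((\<lambda>z. inverse (2 * \<i> * of_nat n * of_real pi) * ?g z ^ n) has_field_derivative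
        inverse (2 * \<i> * of_nat n * of_real pi) * (of_nat n * (2 * \<i> / (of_real t + \<i>)\<^sup>2 * ?g (of_real t) ^ (n - Suc 0)))) (at (of_real t))"
      .
    also have "inverse (2 * \<i> * of_nat n * of_real pi) * (of_nat n * (2 * \<i> / (of_real t + \<i>)\<^sup>2 * ?g (of_real t) ^ (n - Suc 0))) = ?f t"
    proof -
      have "inverse (2 * \<i> * N * p) * (N * (2 * \<i> / b\<^sup>2 * (a / b) ^ m)) = inverse (p * (a * b)) * (a / b) ^ Suc m"
        if "a \<noteq> 0" "b \<noteq> 0" "N \<noteq> 0" "p \<noteq> 0" for a b N p :: complex
        using that by (simp add: field_simps power2_eq_square)
      from this[OF of_real_plus_i_nz(2)[of t] of_real_plus_i_nz(1)[of t], of "of_nat n" "of_real pi"] n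
      have "inverse (2 * \<i> * of_nat n * of_real pi) * (of_nat n * (2 * \<i> / (of_real t + \<i>)\<^sup>2 * ?g (of_real t) ^ m))
        = inverse (of_real pi * ((of_real t - \<i>) * (of_real t + \<i>))) * ?g (of_real t) ^ Suc m" by simp
      moreover have "n - Suc 0 = m" "Suc m = n" using m by auto
      ultimately show ?thesis
        unfolding scaleR_conv_of_real of_real_inverse of_real_mult sq cayley_def by (simp only:)
    qed
    finally show ?thesis
      unfolding cayley_def[abs_def] by (rule has_vector_derivative_real_field)
  qed
  have "(LBINT t=-\<infinity>..\<infinity>. ?f t) = inverse (2 * \<i> * of_nat n * of_real pi) * 1 ^ n - inverse (2 * \<i> * of_nat n * of_real pi) * 1 ^ n"
  proof (rule interval_integral_FTC_integrable[where F = ?F])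
    show "isCont ?f t" for t
      using cauchy_density_pos[of t] continuous_cayley[of UNIV]
      by (intro continuous_intros) (auto simp: continuous_on_eq_continuous_at)
    show "set_integrable lborel (einterval (- \<infinity>) \<infinity>) ?f" using int by (simp add: set_integrable_def)
    show "((?F \<circ> real_of_ereal) \<longlongrightarrow> inverse (2 * \<i> * of_nat n * of_real pi) * 1 ^ n) (at_right (- \<infinity>))"
      unfolding ereal_tendsto_simps by (intro tendsto_intros cayley_limits)
    show "((?F \<circ> real_of_ereal) \<longlongrightarrow> inverse (2 * \<i> * of_nat n * of_real pi) * 1 ^ n) (at_left \<infinity>)"
      unfolding ereal_tendsto_simps by (intro tendsto_intros cayley_limits)
  qed (use der in auto)
  then have "(LINT t|lborel. ?f t) = 0"
    by (simp add: interval_lebesgue_integral_def set_lebesgue_integral_def)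
  then show ?thesis by (simp add: integral_cauchy_distr)
qed

lemma cayley_orthonormal:
  "(LINT t|cauchy_distr. cayley t ^ m * cnj (cayley t ^ n)) = (if m = n then 1 else 0)"
proof -
  have le: "(LINT t|cauchy_distr. cayley t ^ m * cnj (cayley t ^ n)) = (if m = n then 1 else 0)" if "n \<le> m" for m n
  proof -
    have "cayley t ^ m * cnj (cayley t ^ n) = cayley t ^ (m - n)" for t
    proof -
      have "cayley t ^ m = cayley t ^ (m - n) * cayley t ^ n" using that by (simp flip: power_add)
      then have "cayley t ^ m * cnj (cayley t ^ n) = cayley t ^ (m - n) * (cayley t * cnj (cayley t)) ^ n"
        by (simp add: power_mult_distrib)
      then show ?thesis by (simp add: cayley_cnj)
    qed
    then show ?thesis using that cayley_moment[of "m - n"] by auto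
  qed
  show ?thesis
  proof (cases "n \<le> m")
    case False
    have "(LINT t|cauchy_distr. cayley t ^ m * cnj (cayley t ^ n)) = (LINT t|cauchy_distr. cnj (cayley t ^ n * cnj (cayley t ^ m)))"
      by (simp add: mult.commute)
    also have "\<dots> = cnj (if n = m then 1 else 0)" using le[of m n] False by (subst Bochner_Integration.integral_cnj) simp
    finally show ?thesis using False by auto
  qed (rule le)
qed

section \<open>Absolutely convergent Fourier series with nonnegative frequencies\<close>

definition circ_series :: "(nat \<Rightarrow> complex) \<Rightarrow> real \<Rightarrow> complex" where
  "circ_series a t = (\<Sum>n. a n * cayley t ^ n)"

lemma circ_series_sums:
  assumes "summable (\<lambda>n. cmod (a n))"
  shows "(\<lambda>n. a n * cayley t ^ n) sums circ_series a t" "cmod (circ_series a t) \<le> (\<Sum>n. cmod (a n))"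
    "summable (\<lambda>n. cmod (a n * cayley t ^ n))"
proof -
  show s: "summable (\<lambda>n. cmod (a n * cayley t ^ n))" using assms by (simp add: norm_mult norm_power)
  then show "(\<lambda>n. a n * cayley t ^ n) sums circ_series a t"
    unfolding circ_series_def by (rule summable_sums[OF summable_norm_cancel])
  show "cmod (circ_series a t) \<le> (\<Sum>n. cmod (a n))"
    unfolding circ_series_def using summable_norm[OF s] by (simp add: norm_mult norm_power)
qed

lemma measurable_circ_series [measurable]: "circ_series a \<in> borel_measurable borel"
  unfolding circ_series_def[abs_def] by measurable

text \<open>Termwise integration, justified by absolute summability. That condition is met on
  circles of radius r < 1, where Taylor coefficients carry a factor \<open>r ^ n\<close>. The
  coefficient formula, Parseval's identity and the mean of a product all come from it.\<close>

lemma integral_circ_series_mult: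
  assumes a: "summable (\<lambda>n. cmod (a n))" and K: "K \<in> borel_measurable borel" "\<And>t. cmod (K t) \<le> B"
  shows "(\<lambda>n. a n * (LINT t|cauchy_distr. cayley t ^ n * K t)) sums (LINT t|cauchy_distr. circ_series a t * K t)"
proof -
  note [measurable] = K(1)
  have B: "0 \<le> B" using K(2)[of 0] norm_ge_zero order_trans by blast
  have eq: "(\<Sum>n. a n * cayley t ^ n * K t) = circ_series a t * K t" for t
    using sums_unique[OF sums_mult2[OF circ_series_sums(1)[OF a, of t], of "K t"]] by simp
  have nb: "cmod (a n * cayley t ^ n * K t) \<le> cmod (a n) * B" for n t
    using K(2)[of t] by (simp add: norm_mult norm_power mult_left_mono)
  have "(\<lambda>n. LINT t|cauchy_distr. a n * cayley t ^ n * K t) sums (LINT t|cauchy_distr. (\<Sum>n. a n * cayley t ^ n * K t))"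
  proof (rule sums_integral)
    show i: "integrable cauchy_distr (\<lambda>t. a n * cayley t ^ n * K t)" for n
      by (rule integrable_cauchy_distr_bounded[OF _ nb]) measurable
    show "AE t in cauchy_distr. summable (\<lambda>n. norm (a n * cayley t ^ n * K t))"
      using circ_series_sums(3)[OF a] by (intro AE_I2) (simp add: norm_mult summable_mult2)
    have "(LINT t|cauchy_distr. cmod (a n * cayley t ^ n * K t)) \<le> (LINT t|cauchy_distr. cmod (a n) * B)" for n
      by (intro integral_mono integrable_norm i nb) simp
    then show "summable (\<lambda>n. LINT t|cauchy_distr. norm (a n * cayley t ^ n * K t))"
      by (intro summable_comparison_test'[OF summable_mult2[OF a, of B]])
        auto
  qed
  then show ?thesis unfolding eq by (simp add: mult.assoc)
qed

lemma circ_series_coeff: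
  assumes a: "summable (\<lambda>n. cmod (a n))"
  shows "(LINT t|cauchy_distr. circ_series a t * cnj (cayley t ^ m)) = a m"
proof -
  have "(\<lambda>n. a n * (LINT t|cauchy_distr. cayley t ^ n * cnj (cayley t ^ m))) sums (LINT t|cauchy_distr. circ_series a t * cnj (cayley t ^ m))"
    by (rule integral_circ_series_mult[OF a, where B = 1]) (auto simp: norm_power)
  moreover have "(\<lambda>n. a n * (LINT t|cauchy_distr. cayley t ^ n * cnj (cayley t ^ m))) = (\<lambda>n. if n = m then a n else 0)"
    unfolding cayley_orthonormal by auto
  moreover have "(\<lambda>n. if n = m then a n else 0) sums a m" by (rule sums_single)
  ultimately show ?thesis using sums_unique2 by metis
qed

lemma circ_series_parseval:
  assumes a: "summable (\<lambda>n. cmod (a n))" and b: "summable (\<lambda>n. cmod (b n))"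
  shows "(\<lambda>n. a n * cnj (b n)) sums (LINT t|cauchy_distr. circ_series a t * cnj (circ_series b t))"
proof -
  have c: "(LINT t|cauchy_distr. cayley t ^ n * cnj (circ_series a t)) = cnj (a n)" for n
  proof -
    have "(LINT t|cauchy_distr. cayley t ^ n * cnj (circ_series a t)) = (LINT t|cauchy_distr. cnj (circ_series a t * cnj (cayley t ^ n)))"
      by (simp add: mult.commute)
    then show ?thesis by (simp only: Bochner_Integration.integral_cnj circ_series_coeff[OF a])
  qed
  have "(\<lambda>n. b n * (LINT t|cauchy_distr. cayley t ^ n * cnj (circ_series a t))) sums (LINT t|cauchy_distr. circ_series b t * cnj (circ_series a t))"
    by (rule integral_circ_series_mult[OF b, where B = "\<Sum>n. cmod (a n)"]) (auto simp: circ_series_sums(2)[OF a])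
  then have "(\<lambda>n. cnj (b n * cnj (a n))) sums cnj (LINT t|cauchy_distr. circ_series b t * cnj (circ_series a t))"
    unfolding sums_cnj c .
  also have "cnj (LINT t|cauchy_distr. circ_series b t * cnj (circ_series a t)) = (LINT t|cauchy_distr. circ_series a t * cnj (circ_series b t))"
    by (simp add: mult.commute flip: Bochner_Integration.integral_cnj)
  finally show ?thesis by (simp add: mult.commute)
qed

text \<open>Without negative frequencies only the product of the constant terms has nonzero mean.
  Applied to a square, this turns a bound on the imaginary part into a bound on the mean
  square.\<close>

lemma circ_series_mean_mult:
  assumes a: "summable (\<lambda>n. cmod (a n))" and b: "summable (\<lambda>n. cmod (b n))"
  shows "(LINT t|cauchy_distr. circ_series a t * circ_series b t) = a 0 * b 0"
proof -
  have z: "(LINT t|cauchy_distr. cayley t ^ n * circ_series b t) = (if n = 0 then b 0 else 0)" for n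
  proof -
    have 1: "(\<lambda>m. b m * (LINT t|cauchy_distr. cayley t ^ m * cayley t ^ n)) sums (LINT t|cauchy_distr. circ_series b t * cayley t ^ n)"
      by (rule integral_circ_series_mult[OF b, where B = 1]) (auto simp: norm_power)
    have 2: "(\<lambda>m. b m * (LINT t|cauchy_distr. cayley t ^ m * cayley t ^ n)) = (\<lambda>m. if m = 0 then (if n = 0 then b 0 else 0) else 0)"
      using cayley_moment by (auto simp flip: power_add)
    have 3: "(\<lambda>m::nat. if m = 0 then (if n = 0 then b 0 else 0) else 0) sums (if n = 0 then b 0 else 0)" by (rule sums_single)
    have "(LINT t|cauchy_distr. circ_series b t * cayley t ^ n) = (if n = 0 then b 0 else 0)"
      by (rule sums_unique2[OF 1[unfolded 2] 3])
    then show ?thesis by (simp only: mult.commute)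
  qed
  have 1: "(\<lambda>n. a n * (LINT t|cauchy_distr. cayley t ^ n * circ_series b t)) sums (LINT t|cauchy_distr. circ_series a t * circ_series b t)"
    by (rule integral_circ_series_mult[OF a, where B = "\<Sum>n. cmod (b n)"]) (auto simp: circ_series_sums(2)[OF b])
  have 2: "(\<lambda>n. a n * (LINT t|cauchy_distr. cayley t ^ n * circ_series b t)) = (\<lambda>n. if n = 0 then a 0 * b 0 else 0)"
    unfolding z by auto
  have 3: "(\<lambda>n::nat. if n = 0 then a 0 * b 0 else 0) sums (a 0 * b 0)" by (rule sums_single)
  show ?thesis by (rule sums_unique2[OF 1[unfolded 2] 3])
qed

section \<open>Functions on the disc with bounded imaginary part\<close>

definition taylor_coeff :: "(complex \<Rightarrow> complex) \<Rightarrow> nat \<Rightarrow> complex" where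
  "taylor_coeff H n = (deriv ^^ n) H 0 / fact n"

lemma taylor_coeff_sums:
  assumes "H holomorphic_on ball 0 1" "cmod w < 1"
  shows "(\<lambda>n. taylor_coeff H n * w ^ n) sums H w"
  using holomorphic_power_series[OF assms(1), of w] assms(2) by (simp add: taylor_coeff_def)

lemma taylor_coeff_0 [simp]: "taylor_coeff H 0 = H 0"
  by (simp add: taylor_coeff_def)

lemma taylor_coeff_summable:
  assumes H: "H holomorphic_on ball 0 1" and r: "0 \<le> r" "r < 1"
  shows "summable (\<lambda>n. cmod (taylor_coeff H n * of_real r ^ n))"
proof (rule powser_insidea)
  \<comment> \<open>Convergence at a radius strictly between \<open>r\<close> and 1 gives absolute
    convergence at \<open>r\<close>.\<close>
  have "cmod (of_real ((1 + r) / 2)) < 1" using r unfolding norm_of_real by simp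
  then show "summable (\<lambda>n. taylor_coeff H n * of_real ((1 + r) / 2) ^ n)"
    by (rule sums_summable[OF taylor_coeff_sums[OF H]])
  show "cmod (of_real r) < cmod (of_real ((1 + r) / 2))" using r unfolding norm_of_real by simp
qed

lemma disc_circ_series:
  assumes H: "H holomorphic_on ball 0 1" and r: "0 \<le> r" "r < 1"
  shows "H (of_real r * cayley t) = circ_series (\<lambda>n. taylor_coeff H n * of_real r ^ n) t"
proof -
  have "(\<lambda>n. taylor_coeff H n * (of_real r * cayley t) ^ n) sums H (of_real r * cayley t)"
    by (rule taylor_coeff_sums[OF H]) (use r in \<open>simp add: norm_mult\<close>)
  then show ?thesis
    using circ_series_sums(1)[OF taylor_coeff_summable[OF H r], of t]
    by (simp add: power_mult_distrib mult.assoc sums_unique2)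
qed

text \<open>On the circle \<open>cnj (cayley t)\<close> is the inverse of \<open>cayley t\<close>,
  so the kernel is the geometric series 1 + 2 sum (w / cayley t)^n over n > 0. Its coefficients are
  stored conjugated because Parseval's identity conjugates the second series.\<close>

lemma schwarz_kernel:
  assumes w: "cmod w < 1"
  defines "b \<equiv> \<lambda>n. if n = 0 then 1 else 2 * cnj w ^ n"
  shows "summable (\<lambda>n. cmod (b n))" "cnj (circ_series b t) = (cayley t + w) / (cayley t - w)"
proof -
  have "summable (\<lambda>n. 2 * cmod w ^ n)" using w by (intro summable_mult summable_geometric) simp
  then show sb: "summable (\<lambda>n. cmod (b n))"
    by (rule summable_comparison_test'[where N = 0]) (auto simp: b_def norm_mult norm_power)
  let ?q = "cnj w * cayley t"
  have q: "cmod ?q < 1" using w by (simp add: norm_mult)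
  then have q1: "1 - ?q \<noteq> 0" by (metis diff_eq_diff_less_eq eq_iff_diff_eq_0 norm_one order_less_irrefl)
  have "(\<lambda>n. 2 * ?q ^ n - (if n = 0 then 1 else 0)) sums (2 * (1 / (1 - ?q)) - 1)"
    by (intro sums_diff sums_mult geometric_sums q sums_single)
  moreover have "(\<lambda>n. 2 * ?q ^ n - (if n = 0 then 1 else 0)) = (\<lambda>n. b n * cayley t ^ n)"
    by (auto simp: b_def power_mult_distrib)
  ultimately have "circ_series b t = 2 * (1 / (1 - ?q)) - 1"
    using circ_series_sums(1)[OF sb] sums_unique2 by metis
  then have *: "circ_series b t * (1 - ?q) = 1 + ?q" using q1 by (simp add: field_simps)
  have "cnj (circ_series b t) * (1 - w * cnj (cayley t)) = 1 + w * cnj (cayley t)"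
    using arg_cong[OF *, of cnj] by simp
  then have "cnj (circ_series b t) * (cayley t - w * (cayley t * cnj (cayley t))) = cayley t + w * (cayley t * cnj (cayley t))"
    by algebra
  then have "cnj (circ_series b t) * (cayley t - w) = cayley t + w" by (simp add: cayley_cnj)
  moreover have "cayley t - w \<noteq> 0" using w norm_cayley[of t] by auto
  ultimately show "cnj (circ_series b t) = (cayley t + w) / (cayley t - w)" by (simp add: field_simps)
qed

text \<open>Write Im H as (H - cnj H) / (2 i). Paired with the kernel, H gives 2 H(r w) - H(0) by
  Parseval, while cnj H gives only cnj (H 0) by the mean of a product; the combination recovers H up
  to the real part at the centre.\<close>

lemma schwarz_formula:
  assumes H: "H holomorphic_on ball 0 1" and r: "0 \<le> r" "r < 1" and w: "cmod w < 1"
  shows "\<i> * (LINT t|cauchy_distr. of_real (Im (H (of_real r * cayley t))) * ((cayley t + w) / (cayley t - w)))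
    = H (of_real r * w) - of_real (Re (H 0))"
proof -
  define a where "a = (\<lambda>n. taylor_coeff H n * of_real r ^ n)"
  define b where "b = (\<lambda>n. if n = 0 then 1 else 2 * cnj w ^ n)"
  have a: "summable (\<lambda>n. cmod (a n))" using taylor_coeff_summable[OF H r] by (simp add: a_def)
  have b: "summable (\<lambda>n. cmod (b n))" "cnj (circ_series b t) = (cayley t + w) / (cayley t - w)" for t
    using schwarz_kernel[OF w] unfolding b_def by blast+
  have Ha: "H (of_real r * cayley t) = circ_series a t" for t using disc_circ_series[OF H r] by (simp add: a_def)
  have bd: "cmod (circ_series a t) \<le> (\<Sum>n. cmod (a n))" "cmod (circ_series b t) \<le> (\<Sum>n. cmod (b n))" for t
    using circ_series_sums(2)[OF a] circ_series_sums(2)[OF b(1)] by blast+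
  have nn: "0 \<le> (\<Sum>n. cmod (a n))" by (rule suminf_nonneg[OF a]) simp
  have "cmod (of_real r * w) < 1" using r w by (simp add: norm_mult mult_le_less_imp_less[of r 1 "cmod w" 1])
     (meson le_less_trans less_imp_le mult_left_le_one_le norm_ge_zero)
  then have "(\<lambda>n. 2 * (taylor_coeff H n * (of_real r * w) ^ n) - (if n = 0 then H 0 else 0)) sums (2 * H (of_real r * w) - H 0)"
    by (intro sums_diff sums_mult taylor_coeff_sums[OF H] sums_single)
  moreover have "(\<lambda>n. 2 * (taylor_coeff H n * (of_real r * w) ^ n) - (if n = 0 then H 0 else 0)) = (\<lambda>n. a n * cnj (b n))"
    by (auto simp: a_def b_def power_mult_distrib)
  ultimately have I1: "(LINT t|cauchy_distr. circ_series a t * cnj (circ_series b t)) = 2 * H (of_real r * w) - H 0"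
    using circ_series_parseval[OF a b(1)] sums_unique2 by metis
  have "(LINT t|cauchy_distr. cnj (circ_series a t) * cnj (circ_series b t)) = (LINT t|cauchy_distr. cnj (circ_series a t * circ_series b t))"
    by simp
  also have "\<dots> = cnj (H 0)"
    by (subst Bochner_Integration.integral_cnj, subst circ_series_mean_mult[OF a b(1)]) (simp add: a_def b_def)
  finally have I2: "(LINT t|cauchy_distr. cnj (circ_series a t) * cnj (circ_series b t)) = cnj (H 0)" .
  have "(LINT t|cauchy_distr. of_real (Im (H (of_real r * cayley t))) * ((cayley t + w) / (cayley t - w)))
    = (LINT t|cauchy_distr. (circ_series a t * cnj (circ_series b t) - cnj (circ_series a t) * cnj (circ_series b t)) / (2 * \<i>))"
  proof (rule Bochner_Integration.integral_cong[OF refl])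
    fix t
    have "of_real (Im (circ_series a t)) = (circ_series a t - cnj (circ_series a t)) / (2 * \<i>)"
      by (auto simp: complex_eq_iff)
    then show "of_real (Im (H (of_real r * cayley t))) * ((cayley t + w) / (cayley t - w)) =
       (circ_series a t * cnj (circ_series b t) - cnj (circ_series a t) * cnj (circ_series b t)) / (2 * \<i>)"
      unfolding Ha b(2)[symmetric] by (simp only: left_diff_distrib times_divide_eq_left)
  qed
  also have "\<dots> = (2 * H (of_real r * w) - H 0 - cnj (H 0)) / (2 * \<i>)"
  proof -
    have "integrable cauchy_distr (\<lambda>t. circ_series a t * cnj (circ_series b t))"
      "integrable cauchy_distr (\<lambda>t. cnj (circ_series a t) * cnj (circ_series b t))"
      by (rule integrable_cauchy_distr_bounded[where B = "(\<Sum>n. cmod (a n)) * (\<Sum>n. cmod (b n))"];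
        use bd nn in \<open>auto simp: norm_mult intro!: mult_mono\<close>)+
    then show ?thesis by (simp add: I1 I2)
  qed
  finally show ?thesis by (auto simp: complex_eq_iff)
qed

text \<open>Mean squares over the circles of radius \<open>r\<close> increase with \<open>r\<close>, and they are bounded because
  \<open>H\<^sup>2\<close> has constant mean.\<close>

lemma disc_mean_square_Cauchy:
  assumes H: "H holomorphic_on ball 0 1" and B: "\<And>w. cmod w < 1 \<Longrightarrow> \<bar>Im (H w)\<bar> \<le> B" and e: "e > 0"
  obtains R where "0 \<le> R" "R < 1"
    "\<And>r s. R \<le> r \<Longrightarrow> r < 1 \<Longrightarrow> R \<le> s \<Longrightarrow> s < 1 \<Longrightarrow>
      (LINT t|cauchy_distr. (Im (H (of_real r * cayley t)) - Im (H (of_real s * cayley t)))\<^sup>2) \<le> e"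
proof -
  define a where "a = (\<lambda>(r::real) n. taylor_coeff H n * of_real r ^ n)"
  have a: "summable (\<lambda>n. cmod (a r n))" if "0 \<le> r" "r < 1" for r
    using taylor_coeff_summable[OF H that] by (simp add: a_def)
  have Ha: "H (of_real r * cayley t) = circ_series (a r) t" if "0 \<le> r" "r < 1" for r t
    using disc_circ_series[OF H that] by (simp add: a_def)
  have B0: "0 \<le> B" using B[of 0] by simp
  \<comment> \<open>The inner product of the series for radii \<open>r\<close> and \<open>s\<close>
    is \<open>A (r * s)\<close>, a power series with nonnegative coefficients in the product of the
    radii alone; its monotonicity carries the rest of the argument.\<close>
  define A where "A = (\<lambda>x::real. \<Sum>n. (cmod (taylor_coeff H n))\<^sup>2 * x ^ n)"
  have As: "(\<lambda>n. (cmod (taylor_coeff H n))\<^sup>2 * (r * s) ^ n) sums A (r * s)"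
    and Ai: "(LINT t|cauchy_distr. circ_series (a r) t * cnj (circ_series (a s) t)) = of_real (A (r * s))"
    if rs: "0 \<le> r" "r < 1" "0 \<le> s" "s < 1" for r s
  proof -
    have "a r n * cnj (a s n) = of_real ((cmod (taylor_coeff H n))\<^sup>2 * (r * s) ^ n)" for n
      using complex_norm_square[of "taylor_coeff H n"] by (simp add: a_def power_mult_distrib)
    then have p: "(\<lambda>n. complex_of_real ((cmod (taylor_coeff H n))\<^sup>2 * (r * s) ^ n)) sums (LINT t|cauchy_distr. circ_series (a r) t * cnj (circ_series (a s) t))"
      using circ_series_parseval[OF a a, OF rs] by simp
    then have "summable (\<lambda>n. (cmod (taylor_coeff H n))\<^sup>2 * (r * s) ^ n)"
      using sums_summable summable_Re by fastforce
    then show 1: "(\<lambda>n. (cmod (taylor_coeff H n))\<^sup>2 * (r * s) ^ n) sums A (r * s)"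
      unfolding A_def by (rule summable_sums)
    then show "(LINT t|cauchy_distr. circ_series (a r) t * cnj (circ_series (a s) t)) = of_real (A (r * s))"
      using sums_unique2[OF p] by (metis sums_of_real)
  qed
  have Amono: "A (r * s) \<le> A (r' * s')"
    if "0 \<le> r" "r < 1" "0 \<le> s" "s < 1" "0 \<le> r'" "r' < 1" "0 \<le> s'" "s' < 1" "r * s \<le> r' * s'" for r s r' s'
    using that by (intro sums_le[OF _ As As] mult_left_mono power_mono) auto
  have intH: "integrable cauchy_distr (\<lambda>t. circ_series (a r) t * cnj (circ_series (a s) t))"
    "integrable cauchy_distr (\<lambda>t. circ_series (a r) t * circ_series (a s) t)"
    if rs: "0 \<le> r" "r < 1" "0 \<le> s" "s < 1" for r s
    by (rule integrable_cauchy_distr_bounded[where B = "(\<Sum>n. cmod (a r n)) * (\<Sum>n. cmod (a s n))"];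
      use circ_series_sums(2)[OF a] rs suminf_nonneg[OF a] in \<open>auto simp: norm_mult intro!: mult_mono\<close>)+
  \<comment> \<open>The function \<open>Re (?h t * cnj (?h t) - ?h t * ?h t)\<close> is twice the
    square of the imaginary part, and the mean of the square of \<open>?h\<close> is the square of
    \<open>H 0\<close>.\<close>
  have Abound: "A (r * r) \<le> 2 * B\<^sup>2 + Re (H 0 * H 0)" if r: "0 \<le> r" "r < 1" for r
  proof -
    let ?h = "circ_series (a r)"
    have "A (r * r) - Re (H 0 * H 0) = Re (LINT t|cauchy_distr. ?h t * cnj (?h t)) - Re (LINT t|cauchy_distr. ?h t * ?h t)"
      using Ai[OF r r] circ_series_mean_mult[OF a a, OF r r] by (simp add: a_def)
    also have "\<dots> = Re (LINT t|cauchy_distr. ?h t * cnj (?h t) - ?h t * ?h t)"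
      using intH[OF r r] by simp
    also have "\<dots> = (LINT t|cauchy_distr. Re (?h t * cnj (?h t) - ?h t * ?h t))"
      using intH[OF r r] by (intro integral_Re[symmetric]) simp
    also have "\<dots> \<le> (LINT t|cauchy_distr. 2 * B\<^sup>2)"
    proof (rule integral_mono)
      show "integrable cauchy_distr (\<lambda>t. Re (?h t * cnj (?h t) - ?h t * ?h t))"
        using intH[OF r r] by (intro integrable_Re) simp
      show "Re (?h t * cnj (?h t) - ?h t * ?h t) \<le> 2 * B\<^sup>2" for t
      proof -
        have "\<bar>Im (?h t)\<bar> \<le> B" using B[of "of_real r * cayley t"] r Ha[OF r, of t] by (simp add: norm_mult)
        then have "(Im (?h t))\<^sup>2 \<le> B\<^sup>2" by (metis abs_ge_zero power2_abs power_mono)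
        then show ?thesis by (simp add: power2_eq_square)
      qed
    qed simp
    finally show ?thesis by simp
  qed
  define S where "S = (SUP r\<in>{0..<1}. A (r * r))"
  have bdd: "bdd_above ((\<lambda>r. A (r * r)) ` {0..<1})" by (rule bdd_aboveI2) (use Abound in auto)
  have AS: "A (r * r) \<le> S" if "0 \<le> r" "r < 1" for r
    unfolding S_def by (rule cSUP_upper[OF _ bdd]) (use that in auto)
  have "\<exists>R\<in>{0..<1}. S - e < A (R * R)"
    using less_cSUP_iff[of "{0..<1::real}" "\<lambda>r. A (r * r)" "S - e"] bdd e unfolding S_def by auto
  then obtain R where R: "0 \<le> R" "R < 1" "S - e < A (R * R)" by auto
  \<comment> \<open>For s \<le> r the mean square of the full difference is A(r r) - 2 A(r s) + A(s
    s), hence at most A(r r) - A(s s); beyond \<open>R\<close> both values lie within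
    \<open>e\<close> of the supremum \<open>S\<close>.\<close>
  have key: "(LINT t|cauchy_distr. (Im (H (of_real r * cayley t)) - Im (H (of_real s * cayley t)))\<^sup>2) \<le> e"
    if rs: "R \<le> s" "s \<le> r" "r < 1" for r s
  proof -
    have r: "0 \<le> r" "r < 1" and s: "0 \<le> s" "s < 1" using rs R by auto
    let ?h = "circ_series (a r)" and ?k = "circ_series (a s)"
    let ?D = "\<lambda>t. (?h t * cnj (?h t) - ?h t * cnj (?k t)) - (?k t * cnj (?h t) - ?k t * cnj (?k t))"
    have iD: "integrable cauchy_distr ?D"
      by (intro Bochner_Integration.integrable_diff intH r s)
    have "(LINT t|cauchy_distr. (Im (H (of_real r * cayley t)) - Im (H (of_real s * cayley t)))\<^sup>2)
      \<le> (LINT t|cauchy_distr. Re (?D t))"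
    proof (rule integral_mono')
      show "integrable cauchy_distr (\<lambda>t. Re (?D t))" by (intro integrable_Re iD)
      fix t
      have "?D t = (?h t - ?k t) * cnj (?h t - ?k t)" by (simp add: algebra_simps)
      then have D: "Re (?D t) = (cmod (?h t - ?k t))\<^sup>2" using complex_norm_square[of "?h t - ?k t"]
        by (metis Re_complex_of_real)
      then show "0 \<le> Re (?D t)" by simp
      have "\<bar>Im (?h t - ?k t)\<bar> \<le> cmod (?h t - ?k t)" by (rule abs_Im_le_cmod)
      then have "(Im (?h t - ?k t))\<^sup>2 \<le> (cmod (?h t - ?k t))\<^sup>2" by (metis abs_ge_zero power2_abs power_mono)
      then show "(Im (H (of_real r * cayley t)) - Im (H (of_real s * cayley t)))\<^sup>2 \<le> Re (?D t)"
        unfolding D Ha[OF r] Ha[OF s] by simp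
    qed
    also have "\<dots> = Re (LINT t|cauchy_distr. ?D t)" using iD by (rule integral_Re)
    also have "(LINT t|cauchy_distr. ?D t) = of_real (A (r * r)) - of_real (A (r * s)) - (of_real (A (s * r)) - of_real (A (s * s)))"
      using intH r s by (simp add: Ai)
    also have "Re \<dots> = A (r * r) - A (r * s) - (A (s * r) - A (s * s))" by simp
    also have "\<dots> \<le> A (r * r) - A (s * s)"
      using Amono[OF s s r s] Amono[OF s s s r] rs s by (simp add: mult_right_mono mult_left_mono)
    also have "\<dots> \<le> e"
      using AS[OF r] R(3) Amono[OF R(1,2) R(1,2) s s] rs R by (simp add: mult_mono)
    finally show ?thesis .
  qed
  show ?thesis
  proof (rule that[OF R(1,2)])
    fix r s assume "R \<le> r" "r < 1" "R \<le> s" "s < 1"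
    then show "(LINT t|cauchy_distr. (Im (H (of_real r * cayley t)) - Im (H (of_real s * cayley t)))\<^sup>2) \<le> e"
      using key[of s r] key[of r s] by (cases "s \<le> r") (auto simp: power2_commute)
  qed
qed

section \<open>Scalar Herglotz functions\<close>

text \<open>The Schwarz--Pick lemma; the shift by \<open>i d\<close> makes the imaginary part strictly positive.\<close>

lemma herglotz_scalar_bound:
  assumes z0: "Im z0 > 0" and z: "Im z > 0"
  obtains c where "c \<ge> 0"
    "\<And>h. h holomorphic_on {z. Im z > 0} \<Longrightarrow> (\<And>z. Im z > 0 \<Longrightarrow> Im (h z) \<ge> 0) \<Longrightarrow> cmod (h z) \<le> c * cmod (h z0)"
proof -
  define w where "w = (z - z0) / (z - cnj z0)"
  \<comment> \<open>The Cayley transform from the disc to the half-plane adapted to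
    \<open>z0\<close>: it sends 0 to \<open>z0\<close> and \<open>w\<close> to
    \<open>z\<close>.\<close>
  define \<phi> where "\<phi> = (\<lambda>v. (z0 - cnj z0 * v) / (1 - v))"
  have half: "cmod (p - q) < cmod (p - cnj q)" if "Im p > 0" "Im q > 0" for p q
  proof -
    have "(cmod (p - q))\<^sup>2 < (cmod (p - cnj q))\<^sup>2"
      using that by (simp add: cmod_power2) (simp add: power2_eq_square algebra_simps)
    then show ?thesis by (rule power2_less_imp_less) simp
  qed
  have nz: "p - cnj q \<noteq> 0" if "Im p > 0" "Im q > 0" for p q using that by (auto simp: complex_eq_iff)
  have w: "cmod w < 1"
    using half[OF z z0] nz[OF z z0] by (simp add: w_def norm_divide divide_less_eq)
  have v1: "1 - v \<noteq> 0" if "cmod v < 1" for v using that by auto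
  have Im\<phi>: "Im (\<phi> v) > 0" if v: "cmod v < 1" for v
  proof -
    have "\<phi> v = ((z0 - cnj z0 * v) * cnj (1 - v)) / of_real ((cmod (1 - v))\<^sup>2)"
      using v1[OF v] complex_norm_square[of "1 - v"] by (simp add: \<phi>_def)
    moreover have "Im ((z0 - cnj z0 * v) * cnj (1 - v)) = Im z0 * (1 - (cmod v)\<^sup>2)"
      by (simp add: cmod_power2) (simp add: power2_eq_square algebra_simps)
    moreover have "(cmod v)\<^sup>2 < 1" using v by (simp add: power_less_one_iff)
    ultimately show ?thesis using z0 v1[OF v] by (simp add: flip: of_real_power)
  qed
  have \<phi>w: "\<phi> w = z"
  proof -
    have "z0 - cnj z0 \<noteq> 0" using nz[OF z0 z0] .
    then show ?thesis using nz[OF z z0] v1[OF w] by (simp add: \<phi>_def w_def divide_simps) (simp add: algebra_simps)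
  qed
  have \<phi>0: "\<phi> 0 = z0" by (simp add: \<phi>_def)
  \<comment> \<open>Solving |k w| - |k 0| \<le> |w| (|k w| + |k 0|) for |k w| gives this factor; it
    depends on the two points only, not on \<open>h\<close>.\<close>
  define c where "c = (1 + cmod w) / (1 - cmod w)"
  have c: "c \<ge> 0" using w by (simp add: c_def)
  have main: "cmod (h z) \<le> c * cmod (h z0)"
    if h: "h holomorphic_on {z. Im z > 0}" and Imh: "\<And>z. Im z > 0 \<Longrightarrow> Im (h z) \<ge> 0" for h
  proof (rule field_le_epsilon)
    fix e :: real assume e: "e > 0"
    \<comment> \<open>Chosen so that the error \<open>c * d + d\<close> of removing the shift is
      exactly \<open>e\<close>.\<close>
    define d where "d = e / (c + 1)"
    have d: "d > 0" using e c by (simp add: d_def)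
    define k where "k = (\<lambda>v. h (\<phi> v) + \<i> * of_real d)"
    have Imk: "Im (k v) > 0" if "cmod v < 1" for v using Imh[OF Im\<phi>[OF that]] d by (simp add: k_def)
    define G where "G = (\<lambda>v. (k v - k 0) / (k v - cnj (k 0)))"
    have "\<phi> holomorphic_on ball 0 1" unfolding \<phi>_def by (intro holomorphic_intros) (use v1 in auto)
    moreover have "\<phi> ` ball 0 1 \<subseteq> {z. Im z > 0}" using Im\<phi> by auto
    ultimately have "(\<lambda>v. h (\<phi> v)) holomorphic_on ball 0 1"
      using holomorphic_on_compose_gen[OF _ h] by (simp add: o_def)
    then have "k holomorphic_on ball 0 1" unfolding k_def by (intro holomorphic_intros)
    then have "G holomorphic_on ball 0 1" unfolding G_def
      by (intro holomorphic_intros) (use nz[OF Imk Imk] in auto)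
    moreover have "cmod (G v) < 1" if "cmod v < 1" for v
      using half[OF Imk[OF that] Imk[of 0]] nz[OF Imk[OF that] Imk[of 0]] by (simp add: G_def norm_divide divide_less_eq)
    ultimately have "cmod (G w) \<le> cmod w" by (intro Schwarz_Lemma(1)) (auto simp: G_def w)
    then have "cmod (k w - k 0) \<le> cmod w * cmod (k w - cnj (k 0))"
      using nz[OF Imk[OF w] Imk[of 0]] by (simp add: G_def norm_divide divide_le_eq)
    also have "\<dots> \<le> cmod w * (cmod (k w) + cmod (k 0))"
      using norm_triangle_ineq4[of "k w" "cnj (k 0)"] by (intro mult_left_mono) auto
    finally have "cmod (k w) - cmod (k 0) \<le> cmod w * (cmod (k w) + cmod (k 0))"
      using norm_triangle_ineq2[of "k w" "k 0"] by linarith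
    then have "(1 - cmod w) * cmod (k w) \<le> (1 + cmod w) * cmod (k 0)" by (simp add: algebra_simps)
    then have "cmod (k w) \<le> c * cmod (k 0)" using w by (simp add: c_def field_simps)
    moreover have "cmod (h z) \<le> cmod (k w) + d" "cmod (k 0) \<le> cmod (h z0) + d"
      using norm_triangle_ineq4[of "k w" "\<i> * of_real d"] norm_triangle_ineq[of "h z0" "\<i> * of_real d"] d
      by (simp_all add: k_def \<phi>w \<phi>0 norm_mult)
    moreover have "c * cmod (k 0) \<le> c * (cmod (h z0) + d)" using calculation(3) c by (rule mult_left_mono)
    moreover have "c * (cmod (h z0) + d) + d = c * cmod (h z0) + e"
    proof -
      have "d * (c + 1) = e" using c by (simp add: d_def)
      then show ?thesis by (simp add: algebra_simps)
    qed
    ultimately show "cmod (h z) \<le> c * cmod (h z0) + e" by linarith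
  qed
  show ?thesis by (rule that[OF c main])
qed

section \<open>Herglotz operators and their logarithms\<close>

lemma herglotz_dissipative:
  fixes M :: "complex \<Rightarrow> 'h::complex_hilbert_space \<Rightarrow>\<^sub>L 'h"
  assumes "herglotz_op M" "Im z > 0"
  shows "dissipative (M z)"
proof -
  have "M z \<in> cbounded_ops" "op_nonneg (op_Im (M z))" using assms by (auto simp: herglotz_op_def)
  then show ?thesis using op_nonneg_Im_iff[of "M z"] by (simp add: dissipative_def)
qed

lemma herglotz_derivative:
  assumes "herglotz_op M" "Im z > 0"
  obtains D where "(M has_derivative (\<lambda>h. h *\<^sub>C D)) (at z)"
proof -
  have "open {z. Im z > 0}" by (rule open_halfspace_Im_gt)
  then have e: "at z within {z. Im z > 0} = at z" by (rule at_within_open[rotated]) (use assms(2) in simp)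
  have "\<exists>D. (M has_derivative (\<lambda>h. h *\<^sub>C D)) (at z within {z. Im z > 0})"
    using assms unfolding herglotz_op_def complex_differentiable_on_def by blast
  then show ?thesis using that unfolding e by blast
qed

lemma herglotz_invertible:
  fixes M :: "complex \<Rightarrow> 'h::complex_hilbert_space \<Rightarrow>\<^sub>L 'h"
  assumes M: "herglotz_op M" and z0: "Im z0 > 0" "boundedly_invertible (M z0)" and z: "Im z > 0"
  shows "boundedly_invertible (M z)"
proof -
  note diss = herglotz_dissipative[OF M]
  obtain c where c: "c \<ge> 0"
    "\<And>h. h holomorphic_on {z. Im z > 0} \<Longrightarrow> (\<And>z. Im z > 0 \<Longrightarrow> Im (h z) \<ge> 0) \<Longrightarrow> cmod (h z) \<le> c * cmod (h z0)"
    using herglotz_scalar_bound[OF z0(1) z] by blast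
  define k where "k = norm (op_inv (M z0))"
  \<comment> \<open>A bound for the inverse of M(z) + i t that does not involve t: the factor 2
    comes from passing from the quadratic form to the norm, \<open>c\<close> from Schwarz-Pick, and
    \<open>2 * k + 1\<close> bounds the inverse at \<open>z0\<close>. So t can be chosen afterwards,
    small enough that removing the shift is an admissible perturbation.\<close>
  define N where "N = 2 * (c * (2 * k + 1))"
  have N: "0 \<le> N" using c by (simp add: N_def k_def)
  define t where "t = 1 / (2 * (N + 1))"
  have t: "t > 0" using N by (simp add: t_def)
  have It: "Im (\<i> * of_real t) > 0" using t by simp
  let ?A = "\<lambda>w. shift_op (M w) (\<i> * of_real t)"
  have inv: "boundedly_invertible (?A w)" "norm (op_inv (?A w)) \<le> 1 / t" if "Im w > 0" for w
    using dissipative_shift[OF diss[OF that] It] by simp_all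
  have q: "cmod (cinner f (op_inv (?A z) f)) \<le> c * (2 * k + 1) * (norm f)\<^sup>2" for f
  proof -
    define h where "h = (\<lambda>w. - cinner f (op_inv (?A w) f))"
    have "h field_differentiable at w" if w: "Im w > 0" for w
    proof -
      obtain D where "(M has_derivative (\<lambda>h. h *\<^sub>C D)) (at w)" using herglotz_derivative[OF M w] .
      from has_derivative_add[OF this has_derivative_const]
      have D: "(?A has_derivative (\<lambda>h. h *\<^sub>C D)) (at w)" by simp
      have "((\<lambda>w. cinner f (op_inv (?A w) f)) has_field_derivative - cinner f (op_inv (?A w) (D (op_inv (?A w) f)))) (at w)"
        by (rule op_inv_field_derivative[where S = "{w. Im w > 0}" and K = "1 / t"])
          (use D inv w in \<open>auto simp: open_halfspace_Im_gt\<close>)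
      then show ?thesis unfolding h_def by (intro field_differentiable_minus) (auto simp: field_differentiable_def)
    qed
    then have "h holomorphic_on {z. Im z > 0}"
      by (simp add: holomorphic_on_def field_differentiable_at_within)
    moreover have "Im (h w) \<ge> 0" if "Im w > 0" for w
      using Im_resolvent_nonpos[OF diss[OF that] _ inv(1)[OF that]] t by (simp add: h_def)
    ultimately have "cmod (h z) \<le> c * cmod (h z0)" by (rule c(2))
    also have "cmod (h z0) \<le> (2 * k + 1) * norm f * norm f"
    proof -
      have "cmod (h z0) \<le> norm (op_inv (?A z0)) * norm f * norm f"
        unfolding h_def by (simp add: cinner_op_bound)
      also have "norm (op_inv (?A z0)) \<le> (2 * k + 1) / (1 + t)"
        using dissipative_shift_bound(2)[OF diss[OF z0(1)] z0(2), of k t] t by (simp add: k_def)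
      also have "\<dots> \<le> (2 * k + 1) / 1" using t by (intro divide_left_mono) (auto simp: k_def)
      finally show ?thesis by (simp add: mult_right_mono)
    qed
    finally show ?thesis using c(1) by (simp add: h_def power2_eq_square mult_left_mono mult.assoc)
  qed
  have "norm (op_inv (?A z)) \<le> N" unfolding N_def
    by (rule form_bound_quadratic[OF op_inv(1)[OF inv(1)[OF z]] _ q]) (use c in \<open>simp add: k_def\<close>)
  moreover have "norm (M z - ?A z) * N \<le> 1 / 2"
  proof -
    have "norm (M z - ?A z) \<le> t"
      using t norm_id_le[where 'a = 'h] by (simp add: norm_scaleC norm_mult mult_left_le)
    then have "norm (M z - ?A z) * N \<le> t * N" using N by (rule mult_right_mono)
    also have "\<dots> \<le> 1 / 2" using N by (simp add: t_def field_simps)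
    finally show ?thesis .
  qed
  ultimately show ?thesis
    by (intro perturb_invertible[OF inv(1)[OF z], where T = "M z" and q = "1 / 2"]) (use diss[OF z] in \<open>auto simp: dissipative_def\<close>)
qed

text \<open>Differentiation under the integral sign: near \<open>z\<close> the inverses obey one
  common bound, so the resolvent identity dominates the difference quotients of the integrand by a
  multiple of \<open>1 / (1 + t)\<^sup>2\<close>, and dominated convergence applies along
  sequences.\<close>

lemma op_log_field_differentiable:
  fixes M :: "complex \<Rightarrow> 'h::complex_hilbert_space \<Rightarrow>\<^sub>L 'h"
  assumes M: "herglotz_op M" and inv: "\<And>z. Im z > 0 \<Longrightarrow> boundedly_invertible (M z)" and z: "Im z > 0"
  shows "(\<lambda>z. cinner f (op_log (M z) g)) field_differentiable at z"
proof -
  note diss = herglotz_dissipative[OF M]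
  obtain D where D: "(M has_derivative (\<lambda>h. h *\<^sub>C D)) (at z)" using herglotz_derivative[OF M z] .
  define k where "k = norm (op_inv (M z))"
  define C where "C = norm D + 1"
  have k: "k \<ge> 0" by (simp add: k_def)
  have C: "C > 0" by (simp add: C_def add_nonneg_pos)
  have "\<forall>\<^sub>F w in nhds z. norm (M w - M z) \<le> C * cmod (w - z)"
  proof -
    have "\<forall>e>0. \<exists>d>0. \<forall>w. norm (w - z) < d \<longrightarrow> norm (M w - M z - (w - z) *\<^sub>C D) \<le> e * norm (w - z)"
      using D unfolding has_derivative_at_alt by blast
    then obtain d where d: "d > 0" "\<And>w. cmod (w - z) < d \<Longrightarrow> norm (M w - M z - (w - z) *\<^sub>C D) \<le> cmod (w - z)"
      by (metis mult_1 zero_less_one)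
    have "norm (M w - M z) \<le> C * cmod (w - z)" if "cmod (w - z) < d" for w
    proof -
      have "norm (M w - M z) \<le> norm (M w - M z - (w - z) *\<^sub>C D) + norm ((w - z) *\<^sub>C D)"
        using norm_triangle_ineq[of "M w - M z - (w - z) *\<^sub>C D" "(w - z) *\<^sub>C D"] by (simp only: diff_add_cancel)
      also have "\<dots> \<le> cmod (w - z) + cmod (w - z) * norm D"
        using d(2)[OF that] by (simp only: norm_scaleC add_right_mono)
      finally show ?thesis by (simp add: C_def algebra_simps)
    qed
    then show ?thesis using d(1) unfolding eventually_nhds_metric dist_norm by blast
  qed
  moreover have "\<forall>\<^sub>F w in nhds z. C * cmod (w - z) * k < 1 / 2"
  proof -
    have "((\<lambda>w. C * cmod (w - z) * k) \<longlongrightarrow> C * cmod (z - z) * k) (nhds z)" by (intro tendsto_intros filterlim_ident)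
    then show ?thesis by (rule order_tendstoD) simp
  qed
  moreover have "\<forall>\<^sub>F w in nhds z. w \<in> {w. Im w > 0}"
    by (rule eventually_nhds_in_open) (use z in \<open>auto simp: open_halfspace_Im_gt\<close>)
  ultimately have "\<forall>\<^sub>F w in nhds z. norm (M w - M z) \<le> C * cmod (w - z) \<and> C * cmod (w - z) * k < 1 / 2 \<and> Im w > 0"
    by eventually_elim auto
  then obtain S where S: "open S" "z \<in> S"
    "\<And>w. w \<in> S \<Longrightarrow> norm (M w - M z) \<le> C * cmod (w - z)" "\<And>w. w \<in> S \<Longrightarrow> C * cmod (w - z) * k < 1 / 2"
    "\<And>w. w \<in> S \<Longrightarrow> Im w > 0"
    unfolding eventually_nhds by blast
  have low: "norm (op_inv (M w)) \<le> 2 * k" if w: "w \<in> S" for w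
  proof (rule norm_op_inv_le[OF inv[OF S(5)[OF w]]])
    fix x
    have "norm x \<le> k * norm (M z x)" by (rule boundedly_invertible_lower[OF inv[OF z]]) (simp add: k_def)
    also have "\<dots> \<le> k * (norm (M w x) + norm (M w - M z) * norm x)"
      using norm_triangle_ineq4[of "M w x" "(M w - M z) x"] norm_blinfun[of "M w - M z" x] k
      by (intro mult_left_mono) (auto simp: blinfun.diff_left)
    also have "\<dots> = k * norm (M w x) + (norm (M w - M z) * k) * norm x" by (simp add: algebra_simps)
    also have "\<dots> \<le> k * norm (M w x) + 1/2 * norm x"
    proof -
      have "norm (M w - M z) * k \<le> C * cmod (w - z) * k" using S(3)[OF w] k by (rule mult_right_mono)
      then have "norm (M w - M z) * k \<le> 1 / 2" using S(4)[OF w] by linarith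
      then show ?thesis by (intro add_mono mult_right_mono) auto
    qed
    finally show "norm x \<le> 2 * k * norm (M w x)" by simp
  qed (use k in simp)
  let ?A = "\<lambda>w t. shift_op (M w) (\<i> * of_real t)"
  \<comment> \<open>The constant of \<open>dissipative_shift_bound\<close>, with the local bound
    \<open>2 * k\<close> in place of \<open>k\<close>.\<close>
  define K where "K = 2 * (2 * k) + 1"
  have K: "K > 0" using k by (simp add: K_def)
  have Ainv: "boundedly_invertible (?A w t)" and Abd: "norm (op_inv (?A w t)) \<le> K / (1 + t)" if "w \<in> S" "t \<ge> 0" for w t
    using dissipative_shift_bound[OF diss[OF S(5)] inv[OF S(5)] low that(2)] that(1) by (simp_all add: K_def)
  define \<phi> where "\<phi> = (\<lambda>w t. cinner f (log_integrand (M w) t g))"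
  define d where "d = (\<lambda>t. - cinner f (op_inv (?A z t) (D (op_inv (?A z t) g))))"
  have \<phi>I: "(\<phi> w has_integral \<i> * cinner f (op_log (M w) g)) {0..}" if "w \<in> S" for w
    unfolding \<phi>_def by (rule op_log(2)[OF diss inv]) (use S(5)[OF that] in auto)
  have lim: "((\<lambda>w. (\<phi> w t - \<phi> z t) / (w - z)) \<longlongrightarrow> d t) (at z)" if t: "t \<ge> 0" for t
  proof -
    from has_derivative_add[OF D has_derivative_const]
    have D': "((\<lambda>w. ?A w t) has_derivative (\<lambda>h. h *\<^sub>C D)) (at z)" by simp
    have Kb: "K / (1 + t) \<le> K" using K t by (simp add: divide_le_eq)
    have "((\<lambda>w. cinner f (op_inv (?A w t) g)) has_field_derivative d t) (at z)"
      unfolding d_def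
      by (rule op_inv_field_derivative[OF S(1,2) Ainv[OF _ t] order_trans[OF Abd[OF _ t] Kb] D'])
    then show ?thesis unfolding has_field_derivative_iff \<phi>_def cinner_log_integrand by simp
  qed
  have bound: "cmod ((\<phi> w t - \<phi> z t) / (w - z)) \<le> K\<^sup>2 * C * norm f * norm g / (1 + t)\<^sup>2"
    if w: "w \<in> S" "w \<noteq> z" and t: "t \<ge> 0" for w t
  proof -
    have "\<phi> w t - \<phi> z t = cinner f ((op_inv (?A w t) o\<^sub>L (?A z t - ?A w t) o\<^sub>L op_inv (?A z t)) g)"
      unfolding \<phi>_def cinner_log_integrand
      by (subst op_inv_diff[symmetric]) (use Ainv w S(2) t in \<open>auto simp: blinfun.diff_left cinner_diff_right\<close>)
    also have "cmod \<dots> \<le> norm (op_inv (?A w t) o\<^sub>L (?A z t - ?A w t) o\<^sub>L op_inv (?A z t)) * norm f * norm g"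
      by (rule cinner_op_bound)
    also have "\<dots> \<le> (norm (op_inv (?A w t)) * norm (?A z t - ?A w t) * norm (op_inv (?A z t))) * norm f * norm g"
      by (intro mult_right_mono norm_compose3_le) auto
    also have "\<dots> \<le> ((K / (1 + t)) * (C * cmod (w - z)) * (K / (1 + t))) * norm f * norm g"
      using S(3)[OF w(1)] Abd w S(2) t K C
      by (intro mult_right_mono mult_mono) (auto simp: norm_minus_commute)
    also have "\<dots> = K\<^sup>2 * C * norm f * norm g / (1 + t)\<^sup>2 * cmod (w - z)"
      by (simp add: power2_eq_square)
    finally show ?thesis using w by (simp add: norm_divide divide_le_eq)
  qed
  have "((\<lambda>w. (cinner f (op_log (M w) g) - cinner f (op_log (M z) g)) / (w - z)) \<longlongrightarrow> - \<i> * integral {0..} d) (at z)"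
    unfolding tendsto_at_iff_sequentially
  proof (intro allI impI)
    fix X :: "nat \<Rightarrow> complex" assume X: "\<forall>i. X i \<in> UNIV - {z}" "X \<longlonglongrightarrow> z"
    have evS: "eventually (\<lambda>n. X n \<in> S) sequentially" by (rule topological_tendstoD[OF X(2) S(1,2)])
    then obtain N where N: "\<And>n. n \<ge> N \<Longrightarrow> X n \<in> S" unfolding eventually_sequentially by blast
    \<comment> \<open>Dominated convergence is applied with a bound valid at every index, so the
      initial terms outside \<open>S\<close> are dropped.\<close>
    define Y where "Y = (\<lambda>n. X (n + N))"
    have Y: "\<And>n. Y n \<in> S" "\<And>n. Y n \<noteq> z" "Y \<longlonglongrightarrow> z"
      using N X LIMSEQ_ignore_initial_segment[OF X(2), of N] by (auto simp: Y_def)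
    have q: "((\<lambda>t. (\<phi> (Y n) t - \<phi> z t) / (Y n - z)) has_integral
       \<i> * ((cinner f (op_log (M (Y n)) g) - cinner f (op_log (M z) g)) / (Y n - z))) {0..}" for n
      using has_integral_divide[OF has_integral_diff[OF \<phi>I[OF Y(1)[of n]] \<phi>I[OF S(2)]], of "Y n - z"]
      by (simp add: right_diff_distrib)
    have "(\<lambda>n. integral {0..} (\<lambda>t. (\<phi> (Y n) t - \<phi> z t) / (Y n - z))) \<longlonglongrightarrow> integral {0..} d"
    proof (rule Equivalence_Lebesgue_Henstock_Integration.dominated_convergence(2))
      show "(\<lambda>t. (\<phi> (Y n) t - \<phi> z t) / (Y n - z)) integrable_on {0..}" for n using q by blast
      show "(\<lambda>t. K\<^sup>2 * C * norm f * norm g / (1 + t)\<^sup>2) integrable_on {0..}"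
        by (rule integrable_on_half_line[where C = "K\<^sup>2 * C * norm f * norm g"]) (use C in \<open>auto intro!: continuous_intros\<close>)
      show "norm ((\<phi> (Y n) t - \<phi> z t) / (Y n - z)) \<le> K\<^sup>2 * C * norm f * norm g / (1 + t)\<^sup>2" if "t \<in> {0..}" for n t
        using bound[OF Y(1,2)] that by simp
      show "(\<lambda>n. (\<phi> (Y n) t - \<phi> z t) / (Y n - z)) \<longlonglongrightarrow> d t" if "t \<in> {0..}" for t
        using lim[of t] that Y unfolding tendsto_at_iff_sequentially by (auto simp: o_def)
    qed
    then have "(\<lambda>n. - \<i> * integral {0..} (\<lambda>t. (\<phi> (Y n) t - \<phi> z t) / (Y n - z))) \<longlonglongrightarrow> - \<i> * integral {0..} d"
      by (intro tendsto_intros)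
    then have "(\<lambda>n. (cinner f (op_log (M (Y n)) g) - cinner f (op_log (M z) g)) / (Y n - z)) \<longlonglongrightarrow> - \<i> * integral {0..} d"
      unfolding integral_unique[OF q] by simp
    then show "((\<lambda>w. (cinner f (op_log (M w) g) - cinner f (op_log (M z) g)) / (w - z)) \<circ> X) \<longlonglongrightarrow> - \<i> * integral {0..} d"
      unfolding o_def Y_def by (rule LIMSEQ_offset)
  qed
  then show ?thesis unfolding field_differentiable_def has_field_derivative_iff by blast
qed

section \<open>Convergence almost everywhere\<close>

text \<open>Increments that are summable in mean have an almost everywhere finite sum, and
  telescoping gives convergence. The bound starts at \<open>N\<close> because a diagonal choice of
  radii controls the i-th function only from the i-th step on.\<close>

lemma AE_convergent_fast:
  fixes u :: "nat \<Rightarrow> 'a \<Rightarrow> real"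
  assumes int: "\<And>k. integrable M (\<lambda>x. \<bar>u (Suc k) x - u k x\<bar>)"
    and bd: "\<And>k. k \<ge> N \<Longrightarrow> (LINT x|M. \<bar>u (Suc k) x - u k x\<bar>) \<le> (1 / 2) ^ k"
  shows "AE x in M. convergent (\<lambda>k. u k x)"
proof -
  let ?d = "\<lambda>k x. \<bar>u (Suc (k + N)) x - u (k + N) x\<bar>"
  have [measurable]: "(\<lambda>x. ?d k x) \<in> borel_measurable M" for k
    using borel_measurable_integrable[OF int[of "k + N"]] .
  have "(\<integral>\<^sup>+x. (\<Sum>k. ennreal (?d k x)) \<partial>M) = (\<Sum>k. \<integral>\<^sup>+x. ennreal (?d k x) \<partial>M)"
    by (rule nn_integral_suminf) measurable
  also have "\<dots> \<le> (\<Sum>k. ennreal ((1 / 2) ^ k))"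
  proof (intro suminf_le summableI)
    fix k
    have "(\<integral>\<^sup>+x. ennreal (?d k x) \<partial>M) = ennreal (LINT x|M. ?d k x)"
      by (rule nn_integral_eq_integral[OF int]) simp
    also have "\<dots> \<le> ennreal ((1 / 2) ^ (k + N))" by (intro ennreal_leI bd) simp
    also have "\<dots> \<le> ennreal ((1 / 2) ^ k)" by (intro ennreal_leI power_decreasing) auto
    finally show "(\<integral>\<^sup>+x. ennreal (?d k x) \<partial>M) \<le> ennreal ((1 / 2) ^ k)" .
  qed
  also have "\<dots> = ennreal (\<Sum>k. (1 / 2) ^ k)"
    by (rule suminf_ennreal2) (auto intro!: summable_geometric)
  also have "\<dots> < \<infinity>" by simp
  finally have "(\<integral>\<^sup>+x. (\<Sum>k. ennreal (?d k x)) \<partial>M) \<noteq> \<infinity>" by simp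
  then have "AE x in M. (\<Sum>k. ennreal (?d k x)) \<noteq> \<infinity>"
    by (intro nn_integral_noteq_infinite) measurable
  then show ?thesis
  proof (eventually_elim)
    fix x assume "(\<Sum>k. ennreal (?d k x)) \<noteq> \<infinity>"
    then have "summable (\<lambda>k. ?d k x)" by (intro summable_suminf_not_top) auto
    then have "summable (\<lambda>k. u (Suc (k + N)) x - u (k + N) x)" by (rule summable_rabs_cancel)
    then have "(\<lambda>n. \<Sum>k<n. u (Suc (k + N)) x - u (k + N) x) \<longlonglongrightarrow> (\<Sum>k. u (Suc (k + N)) x - u (k + N) x)"
      by (rule summable_LIMSEQ)
    moreover have "(\<Sum>k<n. u (Suc (k + N)) x - u (k + N) x) = u (n + N) x - u N x" for n
      by (induction n) auto
    ultimately have "(\<lambda>n. u (n + N) x - u N x) \<longlonglongrightarrow> (\<Sum>k. u (Suc (k + N)) x - u (k + N) x)" by simp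
    from tendsto_add[OF this tendsto_const[of "u N x"]]
    have "convergent (\<lambda>n. u (n + N) x)" by (auto simp: convergent_def)
    then show "convergent (\<lambda>k. u k x)" using convergent_ignore_initial_segment[of "\<lambda>k. u k x" N] by simp
  qed
qed

text \<open>A three-epsilon argument for a sequence with a common Lipschitz constant. It is applied
  to sesquilinear forms in one argument and then in the other.\<close>

lemma convergent_on_dense:
  fixes a :: "nat \<Rightarrow> 'h::real_normed_vector \<Rightarrow> complex"
  assumes lip: "\<And>k x y. cmod (a k x - a k y) \<le> C * norm (x - y)"
    and dense: "closure D = UNIV" and conv: "\<And>x. x \<in> D \<Longrightarrow> convergent (\<lambda>k. a k x)"
  shows "convergent (\<lambda>k. a k x)"
  unfolding Cauchy_convergent_iff[symmetric]
proof (rule metric_CauchyI)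
  fix e :: real assume e: "e > 0"
  define r where "r = e / (4 * (\<bar>C\<bar> + 1))"
  have r: "r > 0" using e by (simp add: r_def)
  have "x \<in> closure D" using dense by simp
  then obtain y where y: "y \<in> D" "dist y x < r" using r unfolding closure_approachable by blast
  have near: "cmod (a k x - a k y) < e / 4" for k
  proof -
    have "cmod (a k x - a k y) \<le> C * norm (x - y)" by (rule lip)
    also have "\<dots> \<le> (\<bar>C\<bar> + 1) * norm (x - y)" by (intro mult_right_mono) auto
    also have "\<dots> < (\<bar>C\<bar> + 1) * r"
      using y(2) by (intro mult_strict_left_mono) (auto simp: dist_norm norm_minus_commute)
    also have "\<dots> = e / 4"
    proof -
      have "b * (e / (4 * b)) = e / 4" if "b \<noteq> 0" for b using that by simp
      from this[of "\<bar>C\<bar> + 1"] show ?thesis unfolding r_def by simp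
    qed
    finally show ?thesis .
  qed
  have "Cauchy (\<lambda>k. a k y)" using conv[OF y(1)] by (simp add: Cauchy_convergent_iff)
  then obtain N where N: "\<And>m n. m \<ge> N \<Longrightarrow> n \<ge> N \<Longrightarrow> dist (a m y) (a n y) < e / 4"
    using e unfolding Cauchy_def by (metis zero_less_divide_iff zero_less_numeral)
  show "\<exists>N. \<forall>m\<ge>N. \<forall>n\<ge>N. dist (a m x) (a n x) < e"
  proof (intro exI[of _ N] allI impI)
    fix m n assume "m \<ge> N" "n \<ge> N"
    have "dist (a m x) (a n x) \<le> cmod (a m x - a m y) + dist (a m y) (a n y) + cmod (a n x - a n y)"
      using dist_triangle[of "a m x" "a n x" "a m y"] dist_triangle[of "a m y" "a n x" "a n y"]
      by (simp add: dist_norm norm_minus_commute)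
    then show "dist (a m x) (a n x) < e" using near[of m] near[of n] N[OF \<open>m \<ge> N\<close> \<open>n \<ge> N\<close>] e by linarith
  qed
qed

section \<open>Boundary values\<close>

text \<open>The inverse of the map sending z to (z - i) / (z + i), whose restriction to the line is
  \<open>cayley\<close>; the centre of the disc goes to i, where the constant term is read
  off.\<close>

definition to_half_plane :: "complex \<Rightarrow> complex" where
  "to_half_plane w = \<i> * (1 + w) / (1 - w)"

lemma Im_to_half_plane:
  assumes w: "cmod w < 1"
  shows "Im (to_half_plane w) > 0"
proof -
  have nz: "1 - w \<noteq> 0" using w by auto
  then have "to_half_plane w = (\<i> * (1 + w) * cnj (1 - w)) / of_real ((cmod (1 - w))\<^sup>2)"
    using complex_norm_square[of "1 - w"] by (simp add: to_half_plane_def)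
  moreover have "Im (\<i> * (1 + w) * cnj (1 - w)) = 1 - (cmod w)\<^sup>2"
    by (simp add: cmod_power2) (simp add: power2_eq_square algebra_simps)
  moreover have "(cmod w)\<^sup>2 < 1" using w by (simp add: power_less_one_iff)
  ultimately show ?thesis using nz by (simp flip: of_real_power)
qed

lemma to_half_plane_0 [simp]: "to_half_plane 0 = \<i>"
  by (simp add: to_half_plane_def)

lemma to_half_plane_surj:
  assumes z: "Im z > 0"
  shows "cmod ((z - \<i>) / (z + \<i>)) < 1" "to_half_plane ((z - \<i>) / (z + \<i>)) = z"
proof -
  have nz: "z + \<i> \<noteq> 0" using z by (auto simp: complex_eq_iff)
  have "(cmod (z - \<i>))\<^sup>2 < (cmod (z + \<i>))\<^sup>2"
    using z by (simp add: cmod_power2) (simp add: power2_eq_square algebra_simps)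
  then have "cmod (z - \<i>) < cmod (z + \<i>)" by (rule power2_less_imp_less) simp
  then show "cmod ((z - \<i>) / (z + \<i>)) < 1" using nz by (simp add: norm_divide divide_less_eq)
  have "1 + (z - \<i>) / (z + \<i>) = 2 * z / (z + \<i>)" "1 - (z - \<i>) / (z + \<i>) = 2 * \<i> / (z + \<i>)"
    using nz by (simp_all add: field_simps)
  then show "to_half_plane ((z - \<i>) / (z + \<i>)) = z" unfolding to_half_plane_def using nz by simp
qed

lemma holomorphic_compose_to_half_plane:
  assumes "\<And>z. Im z > 0 \<Longrightarrow> h field_differentiable at z"
  shows "(\<lambda>w. h (to_half_plane w)) holomorphic_on ball 0 1"
proof -
  have h: "h holomorphic_on {z. Im z > 0}"
    using assms by (simp add: holomorphic_on_def field_differentiable_at_within)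
  have "to_half_plane holomorphic_on ball 0 1" unfolding to_half_plane_def[abs_def]
    by (intro holomorphic_intros) auto
  moreover have "to_half_plane ` ball 0 1 \<subseteq> {z. Im z > 0}" using Im_to_half_plane by auto
  ultimately show ?thesis using holomorphic_on_compose_gen[OF _ h] by (simp add: o_def)
qed

text \<open>In half-plane coordinates the Schwarz kernel is (1 + t z) / (t - z). Division by 1 +
  t^2, which stems from the Cauchy density, splits it by partial fractions into the Cauchy kernel
  minus the regularizing term t / (1 + t^2).\<close>

lemma kernel_transform:
  assumes z: "Im z > 0"
  defines "w \<equiv> (z - \<i>) / (z + \<i>)"
  shows "\<i> * ((cayley t + w) / (cayley t - w)) / of_real (1 + t\<^sup>2) =
    inverse (of_real t - z) - of_real (t * inverse (1 + t\<^sup>2))"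
proof -
  define \<tau> where "\<tau> = complex_of_real t"
  have nz: "z + \<i> \<noteq> 0" "\<tau> + \<i> \<noteq> 0" "\<tau> - z \<noteq> 0" using z by (auto simp: complex_eq_iff \<tau>_def)
  have sq: "complex_of_real (1 + t\<^sup>2) = 1 + \<tau> * \<tau>" by (simp add: \<tau>_def power2_eq_square)
  have "1 + t\<^sup>2 \<noteq> 0" using zero_le_power2[of t] by linarith
  then have nz2: "1 + \<tau> * \<tau> \<noteq> 0" unfolding sq[symmetric] by (simp only: of_real_eq_0_iff not_False_eq_True)
  have 1: "cayley t + w = 2 * (1 + \<tau> * z) / ((\<tau> + \<i>) * (z + \<i>))"
    using nz by (simp add: cayley_def w_def \<tau>_def[symmetric] add_frac_eq) (simp add: algebra_simps)
  have 2: "cayley t - w = 2 * \<i> * (\<tau> - z) / ((\<tau> + \<i>) * (z + \<i>))"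
    using nz by (simp add: cayley_def w_def \<tau>_def[symmetric] diff_frac_eq) (simp add: algebra_simps)
  have "\<i> * ((2 * a / p) / (2 * \<i> * b / p)) = a / b" if "p \<noteq> 0" "b \<noteq> 0" for a b p :: complex
    using that by (simp add: divide_simps)
  note 3 = this
  have "\<i> * ((cayley t + w) / (cayley t - w)) = (1 + \<tau> * z) / (\<tau> - z)"
    unfolding 1 2 by (rule 3) (use nz in auto)
  then have "\<i> * ((cayley t + w) / (cayley t - w)) / of_real (1 + t\<^sup>2) = (1 + \<tau> * z) / (\<tau> - z) / (1 + \<tau> * \<tau>)"
    by (simp only: sq)
  also have "\<dots> = inverse (\<tau> - z) - \<tau> * inverse (1 + \<tau> * \<tau>)"
    using nz nz2 by (simp add: divide_simps) (simp add: algebra_simps)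
  also have "\<dots> = inverse (of_real t - z) - of_real (t * inverse (1 + t\<^sup>2))"
    unfolding of_real_mult of_real_inverse sq \<tau>_def ..
  finally show ?thesis .
qed

lemma separable_dense_sequence:
  assumes "separable_space (euclidean :: 'h::metric_space topology)"
  obtains d :: "nat \<Rightarrow> 'h::metric_space" where "closure (range d) = UNIV"
proof -
  obtain C :: "'h::metric_space set" where C: "countable C" "euclidean closure_of C = UNIV"
    using assms by (auto simp: separable_space_def)
  then have "closure C = UNIV" by simp
  moreover from this have "C \<noteq> {}" by auto
  ultimately show ?thesis using C(1) range_from_nat_into[of C] that by metis
qed

text \<open>Polarization of pairs from \<open>d\<close> evaluates the quadratic form only at these
  vectors; being countably many, they admit one common null set.\<close>

lemma countable_polarization_vectors:
  fixes d :: "nat \<Rightarrow> 'h::complex_vector"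
  obtains v :: "nat \<Rightarrow> 'h::complex_vector" where "\<And>i j m. d i + \<i> ^ m *\<^sub>C d j \<in> range v"
proof (rule that)
  fix i j m :: nat
  show "d i + \<i> ^ m *\<^sub>C d j \<in> range (\<lambda>n. case prod_decode n of (i, p) \<Rightarrow> case prod_decode p of (j, m) \<Rightarrow> d i + \<i> ^ m *\<^sub>C d j)"
    by (rule range_eqI[of _ _ "prod_encode (i, prod_encode (j, m))"]) simp
qed

text \<open>One sequence of radii serves countably many functions by a diagonal choice: the \<open>k\<close>-th radius
  makes the mean squares of the first \<open>k\<close> functions oscillate by at most \<open>4\<^sup>-\<^sup>k\<close>.\<close>

lemma common_radii:
  fixes H :: "nat \<Rightarrow> complex \<Rightarrow> complex"
  assumes H: "\<And>i. H i holomorphic_on ball 0 1" and B: "\<And>i w. cmod w < 1 \<Longrightarrow> \<bar>Im (H i w)\<bar> \<le> B i"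
  obtains r :: "nat \<Rightarrow> real" where "\<And>k. 0 \<le> r k" "\<And>k. r k < 1" "r \<longlonglongrightarrow> 1"
    "\<And>i. AE t in cauchy_distr. convergent (\<lambda>k. Im (H i (of_real (r k) * cayley t)))"
proof -
  define q where "q = (\<lambda>(i::nat) r s. LINT t|cauchy_distr. (Im (H i (of_real r * cayley t)) - Im (H i (of_real s * cayley t)))\<^sup>2)"
  have "\<exists>R. 0 \<le> R \<and> R < 1 \<and> (\<forall>r s. R \<le> r \<longrightarrow> r < 1 \<longrightarrow> R \<le> s \<longrightarrow> s < 1 \<longrightarrow> q i r s \<le> (1/4) ^ k)" for i k
    by (rule disc_mean_square_Cauchy[OF H[of i] B[where i = i], where e = "(1/4) ^ k"]) (auto simp: q_def)
  then obtain \<rho> where \<rho>: "\<And>i k. 0 \<le> \<rho> i k" "\<And>i k. \<rho> i k < 1"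
    "\<And>i k r s. \<rho> i k \<le> r \<Longrightarrow> r < 1 \<Longrightarrow> \<rho> i k \<le> s \<Longrightarrow> s < 1 \<Longrightarrow> q i r s \<le> (1/4) ^ k"
    by metis
  \<comment> \<open>The second term of the maximum forces the radii to tend to 1.\<close>
  define \<sigma> where "\<sigma> = (\<lambda>(i, j::nat). max (\<rho> i j) (1 - 1 / (real j + 2)))"
  define r where "r = (\<lambda>k. Max (\<sigma> ` ({..k} \<times> {..k})))"
  have \<sigma>1: "\<sigma> p < 1" for p using \<rho>(2) by (cases p) (simp add: \<sigma>_def)
  have r\<sigma>: "\<sigma> (i, j) \<le> r k" if "i \<le> k" "j \<le> k" for i j k
    unfolding r_def by (rule Max_ge) (use that in auto)
  have r1: "r k < 1" for k
    unfolding r_def by (subst Max_less_iff) (use \<sigma>1 in auto)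
  have r\<rho>: "\<rho> i j \<le> r k" if "i \<le> k" "j \<le> k" for i j k
    using r\<sigma>[OF that] by (simp add: \<sigma>_def)
  have r0: "0 \<le> r k" for k using r\<rho>[of 0 k 0] \<rho>(1)[of 0 0] by simp
  have lim: "r \<longlonglongrightarrow> 1"
  proof (rule tendsto_sandwich)
    show "eventually (\<lambda>k. 1 - 1 / (real k + 2) \<le> r k) sequentially"
    proof (intro always_eventually allI)
      show "1 - 1 / (real k + 2) \<le> r k" for k using r\<sigma>[of k k k] by (simp add: \<sigma>_def)
    qed
    show "eventually (\<lambda>k. r k \<le> 1) sequentially" using r1 by (intro always_eventually allI) (simp add: less_imp_le)
    show "(\<lambda>k. 1 - 1 / (real k + 2)) \<longlonglongrightarrow> 1" by real_asymp
  qed simp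
  have conv: "AE t in cauchy_distr. convergent (\<lambda>k. Im (H i (of_real (r k) * cayley t)))" for i
  proof -
    define u where "u = (\<lambda>k t. Im (H i (of_real (r k) * cayley t)))"
    have B0: "0 \<le> B i" using B[of 0 i] by simp
    have um: "u k \<in> borel_measurable borel" for k
    proof (rule borel_measurable_continuous_onI)
      have "continuous_on UNIV (\<lambda>t. H i (of_real (r k) * cayley t))"
        by (rule continuous_on_compose2[OF holomorphic_on_imp_continuous_on[OF H]])
          (use r0 r1 in \<open>auto intro!: continuous_intros continuous_cayley simp: norm_mult\<close>)
      then show "continuous_on UNIV (u k)" unfolding u_def by (intro continuous_intros)
    qed
    note [measurable] = um
    have ub: "\<bar>u k t\<bar> \<le> B i" for k t
      unfolding u_def by (rule B) (use r0[of k] r1[of k] in \<open>simp add: norm_mult\<close>)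
    have db: "\<bar>u (Suc k) t - u k t\<bar> \<le> 2 * B i" for k t using ub[of k t] ub[of "Suc k" t] by linarith
    have i1: "integrable cauchy_distr (\<lambda>t. \<bar>u (Suc k) t - u k t\<bar>)" for k
      by (rule cauchy_distr.integrable_const_bound[where B = "2 * B i"]) (use db in auto)
    have i2: "integrable cauchy_distr (\<lambda>t. (u (Suc k) t - u k t)\<^sup>2)" for k
    proof (rule cauchy_distr.integrable_const_bound[where B = "(2 * B i)\<^sup>2"])
      show "AE t in cauchy_distr. norm ((u (Suc k) t - u k t)\<^sup>2) \<le> (2 * B i)\<^sup>2"
        using power_mono[OF db abs_ge_zero, of k _ 2] by (intro AE_I2) (simp del: power_mult_distrib)
    qed measurable
    have "AE t in cauchy_distr. convergent (\<lambda>k. u k t)"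
    proof (rule AE_convergent_fast[where u = u and N = i, OF i1])
      fix k assume k: "i \<le> k"
      \<comment> \<open>The arithmetic-geometric mean inequality with weight \<open>2 ^ k\<close>
        converts the mean square bound \<open>(1/4) ^ k\<close> into a mean bound
        \<open>(1/2) ^ k\<close>.\<close>
      have am: "\<bar>x\<bar> \<le> (2 ^ k * x\<^sup>2 + (1/2) ^ k) / 2" for x :: real
      proof -
        have "0 \<le> (2 ^ k * \<bar>x\<bar> - 1)\<^sup>2" by simp
        then have "2 ^ k * (2 * \<bar>x\<bar>) \<le> 2 ^ k * (2 ^ k * x\<^sup>2 + (1/2) ^ k)"
          by (simp add: power2_eq_square algebra_simps power_one_over abs_mult_self_eq)
        then have "2 * \<bar>x\<bar> \<le> 2 ^ k * x\<^sup>2 + (1/2) ^ k" by (rule mult_left_le_imp_le) simp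
        then show ?thesis by simp
      qed
      have "(LINT t|cauchy_distr. \<bar>u (Suc k) t - u k t\<bar>) \<le> (LINT t|cauchy_distr. (2 ^ k * (u (Suc k) t - u k t)\<^sup>2 + (1/2) ^ k) / 2)"
        using i1 i2 by (intro integral_mono am) auto
      also have "\<dots> = (2 ^ k * q i (r (Suc k)) (r k) + (1/2) ^ k) / 2"
        using i2 by (simp add: q_def u_def)
      also have "\<dots> \<le> (2 ^ k * (1/4) ^ k + (1/2) ^ k) / 2"
        using \<rho>(3)[of i k "r (Suc k)" "r k"] r\<rho>[of i "Suc k" k] r\<rho>[of i k k] r1 k by simp
      also have "\<dots> = (1/2) ^ k" by (simp flip: power_mult_distrib)
      finally show "(LINT t|cauchy_distr. \<bar>u (Suc k) t - u k t\<bar>) \<le> (1/2) ^ k" .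
    qed
    then show ?thesis by (simp add: u_def)
  qed
  show ?thesis by (rule that[OF r0 r1 lim conv])
qed

text \<open>Polarization gives convergence on pairs from the dense sequence; the uniform bound
  \<open>K\<close> extends it to one argument, then to the other. The limiting form is again bounded
  by \<open>K\<close> and is therefore represented by an operator.\<close>

lemma polarization_convergent:
  fixes B :: "nat \<Rightarrow> 'h::complex_hilbert_space \<Rightarrow>\<^sub>L 'h"
  assumes B: "\<And>k. B k \<in> cbounded_ops" "\<And>k. norm (B k) \<le> K" and dense: "closure (range d) = UNIV"
    and conv: "\<And>i j m. convergent (\<lambda>k. cinner (d i + \<i> ^ m *\<^sub>C d j) (B k (d i + \<i> ^ m *\<^sub>C d j)))"
  obtains T where "T \<in> cbounded_ops" "\<And>f g. (\<lambda>k. cinner f (B k g)) \<longlonglongrightarrow> cinner f (blinfun_apply T g)"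
proof -
  have K: "0 \<le> K" using B(2)[of 0] norm_ge_zero order_trans by blast
  have 1: "convergent (\<lambda>k. cinner (d i) (B k (d j)))" for i j
  proof -
    have "(\<lambda>k. (\<Sum>m<4. (-\<i>) ^ m * cinner (d i + \<i> ^ m *\<^sub>C d j) (B k (d i + \<i> ^ m *\<^sub>C d j))) / 4) \<longlonglongrightarrow>
      (\<Sum>m<4. (-\<i>) ^ m * lim (\<lambda>k. cinner (d i + \<i> ^ m *\<^sub>C d j) (B k (d i + \<i> ^ m *\<^sub>C d j)))) / 4"
      by (intro tendsto_divide tendsto_sum tendsto_mult tendsto_const conv[unfolded convergent_LIMSEQ_iff]) simp
    moreover have "(\<lambda>k. cinner (d i) (B k (d j))) =
      (\<lambda>k. (\<Sum>m<4. (-\<i>) ^ m * cinner (d i + \<i> ^ m *\<^sub>C d j) (B k (d i + \<i> ^ m *\<^sub>C d j))) / 4)"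
      by (intro ext polarization_op B)
    ultimately show ?thesis by (simp only: convergentI)
  qed
  have bd: "cmod (cinner f (B k g)) \<le> K * norm f * norm g" for f g k
    by (rule order_trans[OF cinner_op_bound]) (intro mult_right_mono B(2), auto)
  have 2: "convergent (\<lambda>k. cinner (d i) (B k g))" for i g
  proof (rule convergent_on_dense[where C = "K * norm (d i)", OF _ dense])
    show "cmod (cinner (d i) (B k x) - cinner (d i) (B k y)) \<le> K * norm (d i) * norm (x - y)" for k x y
      using bd[of "d i" k "x - y"] by (simp add: blinfun.diff_right cinner_diff_right)
  qed (use 1 in auto)
  have 3: "convergent (\<lambda>k. cinner f (B k g))" for f g
  proof (rule convergent_on_dense[where C = "K * norm g" and a = "\<lambda>k f. cinner f (B k g)", OF _ dense])
    show "cmod (cinner x (B k g) - cinner y (B k g)) \<le> K * norm g * norm (x - y)" for k x y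
      using bd[of "x - y" k g] by (simp add: cinner_diff_left mult_ac)
  qed (use 2 in auto)
  define b where "b = (\<lambda>f g. lim (\<lambda>k. cinner f (B k g)))"
  have b: "(\<lambda>k. cinner f (B k g)) \<longlonglongrightarrow> b f g" for f g
    using 3 by (simp add: b_def convergent_LIMSEQ_iff)
  have bK: "cmod (b f g) \<le> K * norm f * norm g" for f g
    by (rule LIMSEQ_le_const2[OF tendsto_norm[OF b]]) (use bd in blast)
  obtain T where "T \<in> cbounded_ops" "\<And>f g. b f g = cinner f (blinfun_apply T g)"
  proof (rule form_representation[of b K, OF _ _ _ _ bK])
    show "b (x + y) z = b x z + b y z" for x y z
      using LIMSEQ_unique[OF b[of "x + y" z]] tendsto_add[OF b[of x z] b[of y z]] by (simp add: cinner_add_left)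
    show "b x (y + z) = b x y + b x z" for x y z
      using LIMSEQ_unique[OF b[of x "y + z"]] tendsto_add[OF b[of x y] b[of x z]]
      by (simp add: cinner_add_right blinfun.add_right)
    show "b (c *\<^sub>C x) y = cnj c * b x y" for c x y
      using LIMSEQ_unique[OF b[of "c *\<^sub>C x" y]] tendsto_mult[OF tendsto_const b[of x y], of "cnj c"]
      by (simp add: cinner_scaleC_left)
    show "b x (c *\<^sub>C y) = c * b x y" for c x y
      using LIMSEQ_unique[OF b[of x "c *\<^sub>C y"]] tendsto_mult[OF tendsto_const b[of x y], of c]
      by (simp add: cinner_scaleC_right cbounded_opsD[OF B(1)])
  qed blast
  then show ?thesis using b that by simp
qed

text \<open>Of the logarithm only complex linearity of its values, analyticity of its quadratic
  forms and the bounds 0 and pi enter. The representation is proved on the diagonal, where Schwarz's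
  formula applies; the other matrix elements follow later by polarization.\<close>

lemma bounded_herglotz_representation:
  fixes L :: "complex \<Rightarrow> 'h::complex_hilbert_space \<Rightarrow>\<^sub>L 'h"
  assumes sep: "separable_space (euclidean :: 'h topology)"
    and L: "\<And>z. Im z > 0 \<Longrightarrow> L z \<in> cbounded_ops"
    and diff: "\<And>z f. Im z > 0 \<Longrightarrow> (\<lambda>z. cinner f (L z f)) field_differentiable at z"
    and bd: "\<And>z f. Im z > 0 \<Longrightarrow> 0 \<le> Im (cinner f (L z f))" "\<And>z f. Im z > 0 \<Longrightarrow> Im (cinner f (L z f)) \<le> pi * (norm f)\<^sup>2"
  obtains \<Xi> :: "real \<Rightarrow> 'h \<Rightarrow>\<^sub>L 'h" where "\<And>t. \<Xi> t \<in> cbounded_ops"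
    "\<And>t. op_nonneg (\<Xi> t)" "\<And>t. op_nonneg (id_blinfun - \<Xi> t)"
    "\<And>f g. (\<lambda>t. cinner f (\<Xi> t g)) \<in> borel_measurable borel"
    "\<And>z f. Im z > 0 \<Longrightarrow> has_bochner_integral lborel
      (\<lambda>t. (inverse (of_real t - z) - of_real (t * inverse (1 + t\<^sup>2))) * cinner f (\<Xi> t f))
      (cinner f (L z f) - of_real (Re (cinner f (L \<i> f))))"
proof -
  obtain d :: "nat \<Rightarrow> 'h" where d: "closure (range d) = UNIV" using separable_dense_sequence[OF sep] .
  obtain v :: "nat \<Rightarrow> 'h" where v: "\<And>i j m. d i + \<i> ^ m *\<^sub>C d j \<in> range v" by (rule countable_polarization_vectors[of d]) blast
  define H where "H = (\<lambda>f w. cinner f (L (to_half_plane w) f))"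
  have H: "H f holomorphic_on ball 0 1" for f
    unfolding H_def by (rule holomorphic_compose_to_half_plane[OF diff])
  have Hb: "0 \<le> Im (H f w)" "Im (H f w) \<le> pi * (norm f)\<^sup>2" if "cmod w < 1" for f w
    unfolding H_def by (rule bd[OF Im_to_half_plane[OF that]])+
  have Hb': "\<bar>Im (H f w)\<bar> \<le> pi * (norm f)\<^sup>2" if "cmod w < 1" for f w
    using Hb[OF that] by simp
  obtain r :: "nat \<Rightarrow> real" where r: "\<And>k. 0 \<le> r k" "\<And>k. r k < 1" "r \<longlonglongrightarrow> 1"
    "\<And>i. AE t in cauchy_distr. convergent (\<lambda>k. Im (H (v i) (of_real (r k) * cayley t)))"
    by (rule common_radii[of "\<lambda>i. H (v i)", OF H Hb']) (assumption, rule that)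
  define u where "u = (\<lambda>f k t. Im (H f (of_real (r k) * cayley t)))"
  have n1: "cmod (of_real (r k) * cayley t) < 1" for k t using r(1,2)[of k] by (simp add: norm_mult)
  have ub: "0 \<le> u f k t" "u f k t \<le> pi * (norm f)\<^sup>2" for f k t
    unfolding u_def by (rule Hb[OF n1])+
  have um [measurable]: "u f k \<in> borel_measurable borel" for f k
  proof (rule borel_measurable_continuous_onI)
    have "continuous_on UNIV (\<lambda>t. H f (of_real (r k) * cayley t))"
      by (rule continuous_on_compose2[OF holomorphic_on_imp_continuous_on[OF H]])
        (use n1 in \<open>auto intro!: continuous_intros continuous_cayley\<close>)
    then show "continuous_on UNIV (u f k)" unfolding u_def by (intro continuous_intros)
  qed
  define Bk where "Bk = (\<lambda>t k. op_Im (L (to_half_plane (of_real (r k) * cayley t))))"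
  have Bk: "Bk t k \<in> cbounded_ops" "cinner f (Bk t k f) = of_real (u f k t)" for f t k
    unfolding Bk_def u_def H_def by (rule cinner_op_Im[OF L[OF Im_to_half_plane[OF n1]]])+
  have Bkn: "norm (Bk t k) \<le> 2 * pi" for t k
    by (rule form_bound_quadratic[OF Bk(1)]) (use ub in \<open>auto simp: Bk(2)\<close>)
  \<comment> \<open>The set on which boundary values exist for all polarization vectors; it is Borel
    and has full measure for the Cauchy distribution.\<close>
  define G where "G = {t. \<forall>n. convergent (\<lambda>k. u (v n) k t)}"
  have "{t \<in> space borel. Cauchy (\<lambda>k. u (v n) k t)} \<in> sets borel" for n by (rule sets_Collect_Cauchy[OF um])
  then have "Measurable.pred borel (\<lambda>t. convergent (\<lambda>k. u (v n) k t))" for n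
    by (simp add: pred_def Cauchy_convergent_iff)
  then have "Measurable.pred borel (\<lambda>t. \<forall>n. convergent (\<lambda>k. u (v n) k t))" by measurable
  then have Gm [measurable]: "G \<in> sets borel" by (simp add: G_def pred_def)
  have G_AE: "AE t in cauchy_distr. t \<in> G"
    using r(4) unfolding G_def u_def by (simp add: AE_all_countable)
  have "\<exists>T. T \<in> cbounded_ops \<and> (\<forall>f g. (\<lambda>k. cinner f (Bk t k g)) \<longlonglongrightarrow> cinner f (blinfun_apply T g))" if t: "t \<in> G" for t
  proof -
    have "convergent (\<lambda>k. cinner (d i + \<i> ^ m *\<^sub>C d j) (Bk t k (d i + \<i> ^ m *\<^sub>C d j)))" for i j m
    proof -
      obtain n where "d i + \<i> ^ m *\<^sub>C d j = v n" using v[of i m j] by blast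
      moreover have "convergent (\<lambda>k. u (v n) k t)" using t by (simp add: G_def)
      ultimately show ?thesis unfolding Bk(2) by (simp add: convergent_of_real)
    qed
    note c = this
    obtain T where "T \<in> cbounded_ops" "\<And>f g. (\<lambda>k. cinner f (Bk t k g)) \<longlonglongrightarrow> cinner f (blinfun_apply T g)"
      by (rule polarization_convergent[where B = "Bk t" and K = "2 * pi", OF Bk(1) Bkn d c]) (rule that)
    then show ?thesis by blast
  qed
  then obtain T where T: "\<And>t. t \<in> G \<Longrightarrow> T t \<in> cbounded_ops"
    "\<And>t f g. t \<in> G \<Longrightarrow> (\<lambda>k. cinner f (Bk t k g)) \<longlonglongrightarrow> cinner f (blinfun_apply (T t) g)"
    by metis
  \<comment> \<open>The default 0 on the null set keeps both operator inequalities valid at every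
    point, and makes the matrix elements Borel measurable as everywhere limits.\<close>
  define \<Xi> where "\<Xi> = (\<lambda>t. if t \<in> G then (1 / pi) *\<^sub>R T t else 0)"
  define Q where "Q = (\<lambda>f t. Re (cinner f (\<Xi> t f)))"
  have \<Xi>c: "\<Xi> t \<in> cbounded_ops" for t using T(1) by (simp add: \<Xi>_def)
  have lim: "(\<lambda>k. u f k t) \<longlonglongrightarrow> pi * Q f t" and Qr: "cinner f (\<Xi> t f) = of_real (Q f t)" if t: "t \<in> G" for f t
  proof -
    have 1: "(\<lambda>k. complex_of_real (u f k t)) \<longlonglongrightarrow> cinner f (T t f)" using T(2)[OF t, of f f] by (simp add: Bk(2))
    have 2: "cinner f (\<Xi> t f) = cinner f (T t f) / of_real pi" using t by (simp add: \<Xi>_def blinfun.scaleR_left)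
    then have "Re (cinner f (T t f)) = pi * Q f t" by (simp add: Q_def)
    with tendsto_Re[OF 1] show "(\<lambda>k. u f k t) \<longlonglongrightarrow> pi * Q f t" by simp
    have "(\<lambda>k. 0) \<longlonglongrightarrow> Im (cinner f (T t f))" using tendsto_Im[OF 1] by simp
    then have "Im (cinner f (T t f)) = 0" by (simp add: LIMSEQ_const_iff)
    then show "cinner f (\<Xi> t f) = of_real (Q f t)" unfolding Q_def 2 by (simp add: complex_eq_iff)
  qed
  have Qr: "cinner f (\<Xi> t f) = of_real (Q f t)" for f t
    using Qr by (cases "t \<in> G") (auto simp: Q_def \<Xi>_def)
  have Q0: "0 \<le> Q f t" and Q1: "Q f t \<le> (norm f)\<^sup>2" for f t
  proof -
    have "0 \<le> pi * Q f t" "pi * Q f t \<le> pi * (norm f)\<^sup>2" if "t \<in> G"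
      using LIMSEQ_le_const[OF lim[OF that]] LIMSEQ_le_const2[OF lim[OF that]] ub by blast+
    then have "0 \<le> Q f t" "Q f t \<le> (norm f)\<^sup>2" if "t \<in> G"
      using that pi_gt_zero by (simp_all only: zero_le_mult_iff mult_le_cancel_left_pos) auto
    moreover have "Q f t = 0" if "t \<notin> G" using that by (simp add: Q_def \<Xi>_def)
    ultimately show "0 \<le> Q f t" "Q f t \<le> (norm f)\<^sup>2" by (metis order_refl, metis zero_le_power2)
  qed
  have Qm [measurable]: "Q f \<in> borel_measurable borel" for f
  proof (rule borel_measurable_LIMSEQ_real)
    show "(\<lambda>k. if t \<in> G then u f k t / pi else 0) \<longlonglongrightarrow> Q f t" for t
      using tendsto_divide[OF lim tendsto_const[of pi]] by (auto simp: Q_def \<Xi>_def)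
    show "(\<lambda>t. if t \<in> G then u f k t / pi else 0) \<in> borel_measurable borel" for k by measurable
  qed
  have \<Xi>m: "(\<lambda>t. cinner f (\<Xi> t g)) \<in> borel_measurable borel" for f g
  proof -
    have "(\<lambda>t. cinner f (\<Xi> t g)) = (\<lambda>t. (\<Sum>m<4. (-\<i>) ^ m * of_real (Q (f + \<i> ^ m *\<^sub>C g) t)) / 4)"
    proof
      show "cinner f (\<Xi> t g) = (\<Sum>m<4. (-\<i>) ^ m * of_real (Q (f + \<i> ^ m *\<^sub>C g) t)) / 4" for t
        by (subst polarization_op[OF \<Xi>c]) (simp only: Qr)
    qed
    also have "\<dots> \<in> borel_measurable borel" by measurable
    finally show ?thesis .
  qed
  have rep: "has_bochner_integral lborel
      (\<lambda>t. (inverse (of_real t - z) - of_real (t * inverse (1 + t\<^sup>2))) * cinner f (\<Xi> t f))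
      (cinner f (L z f) - of_real (Re (cinner f (L \<i> f))))" if z: "Im z > 0" for z f
  proof -
    define w where "w = (z - \<i>) / (z + \<i>)"
    have w: "cmod w < 1" "to_half_plane w = z" using to_half_plane_surj[OF z] by (simp_all add: w_def)
    define K where "K = (\<lambda>t. (cayley t + w) / (cayley t - w))"
    have Km [measurable]: "K \<in> borel_measurable borel" unfolding K_def by measurable
    have Kb: "cmod (K t) \<le> 2 / (1 - cmod w)" for t
    proof -
      have "cmod (cayley t + w) \<le> 2" using norm_triangle_ineq[of "cayley t" w] w by simp
      moreover have "1 - cmod w \<le> cmod (cayley t - w)" using norm_triangle_ineq2[of "cayley t" w] by simp
      ultimately show ?thesis unfolding K_def norm_divide using w by (intro frac_le) auto
    qed
    define X where "X = (\<lambda>t. complex_of_real (pi * Q f t) * K t)"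
    have Xm [measurable]: "X \<in> borel_measurable borel" unfolding X_def by measurable
    have Xb: "cmod (complex_of_real (u f k t) * K t) \<le> pi * (norm f)\<^sup>2 * (2 / (1 - cmod w))" for k t
      unfolding norm_mult by (intro mult_mono Kb) (use ub[of f k t] in auto)
    have Xi: "integrable cauchy_distr X"
    proof (rule integrable_cauchy_distr_bounded[OF Xm])
      show "cmod (X t) \<le> pi * (norm f)\<^sup>2 * (2 / (1 - cmod w))" for t
        unfolding X_def norm_mult by (intro mult_mono Kb) (use Q0 Q1 in \<open>auto simp: norm_mult\<close>)
    qed
    have "(\<lambda>k. LINT t|cauchy_distr. complex_of_real (u f k t) * K t) \<longlonglongrightarrow> (LINT t|cauchy_distr. X t)"
    proof (rule integral_dominated_convergence[where w = "\<lambda>_. pi * (norm f)\<^sup>2 * (2 / (1 - cmod w))"])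
      show "AE t in cauchy_distr. (\<lambda>k. complex_of_real (u f k t) * K t) \<longlonglongrightarrow> X t"
        using G_AE
      proof eventually_elim
        case (elim t)
        show ?case unfolding X_def by (intro tendsto_mult tendsto_of_real lim elim tendsto_const)
      qed
      show "AE t in cauchy_distr. norm (complex_of_real (u f k t) * K t) \<le> pi * (norm f)\<^sup>2 * (2 / (1 - cmod w))" for k
        using Xb by simp
      show "(\<lambda>t. complex_of_real (u f k t) * K t) \<in> borel_measurable cauchy_distr" for k
        by (simp add: measurable_cong_sets[OF sets_cauchy_distr refl]) measurable
      show "X \<in> borel_measurable cauchy_distr" using Xm by (simp add: measurable_cong_sets[OF sets_cauchy_distr refl])
    qed simp
    then have "(\<lambda>k. \<i> * (LINT t|cauchy_distr. complex_of_real (u f k t) * K t)) \<longlonglongrightarrow> \<i> * (LINT t|cauchy_distr. X t)"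
      by (intro tendsto_mult tendsto_const)
    moreover have "(\<lambda>k. \<i> * (LINT t|cauchy_distr. complex_of_real (u f k t) * K t)) = (\<lambda>k. H f (of_real (r k) * w) - of_real (Re (H f 0)))"
      unfolding u_def K_def by (intro ext schwarz_formula H r w)
    \<comment> \<open>The point \<open>w\<close> is fixed inside the disc, so this side of Schwarz's
      formula converges by continuity of \<open>H f\<close> at \<open>w\<close>; the boundary limit
      is used only under the integral.\<close>
    moreover have "(\<lambda>k. H f (of_real (r k) * w) - of_real (Re (H f 0))) \<longlonglongrightarrow> H f w - of_real (Re (H f 0))"
    proof -
      have "isCont (H f) w"
        using holomorphic_on_imp_continuous_on[OF H[of f]] w by (simp add: continuous_on_eq_continuous_at)
      then have c: "isCont (H f) (of_real 1 * w)" by simp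
      have "(\<lambda>k. of_real (r k) * w) \<longlonglongrightarrow> of_real 1 * w" by (intro tendsto_intros r)
      from isCont_tendsto_compose[OF c this] have "(\<lambda>k. H f (of_real (r k) * w)) \<longlonglongrightarrow> H f w" by simp
      then show ?thesis by (intro tendsto_intros)
    qed
    ultimately have val: "\<i> * (LINT t|cauchy_distr. X t) = H f w - of_real (Re (H f 0))"
      using LIMSEQ_unique by metis
    \<comment> \<open>The factor pi in \<open>X\<close> cancels the one in the Cauchy
      density.\<close>
    have eq: "\<i> * (inverse (pi * (1 + t\<^sup>2)) *\<^sub>R X t) =
        (inverse (of_real t - z) - of_real (t * inverse (1 + t\<^sup>2))) * cinner f (\<Xi> t f)" for t
      unfolding kernel_transform[OF z, symmetric] Qr X_def K_def w_def
      by (simp add: scaleR_conv_of_real divide_inverse mult_ac)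
    have "has_bochner_integral lborel (\<lambda>t. inverse (pi * (1 + t\<^sup>2)) *\<^sub>R X t) (LINT t|cauchy_distr. X t)"
      using Xi integral_cauchy_distr[OF Xm] by (simp add: integrable_cauchy_distr_iff[OF Xm] has_bochner_integral_iff)
    then have "has_bochner_integral lborel (\<lambda>t. \<i> * (inverse (pi * (1 + t\<^sup>2)) *\<^sub>R X t)) (\<i> * (LINT t|cauchy_distr. X t))"
      by (intro has_bochner_integral_mult_right)
    then show ?thesis unfolding eq val by (simp add: H_def w(2))
  qed
  show ?thesis
  proof (rule that[OF \<Xi>c _ _ \<Xi>m rep])
    show "op_nonneg (\<Xi> t)" for t by (simp add: op_nonneg_def Qr Q0 complex_nonneg_Reals_iff)
    show "op_nonneg (id_blinfun - \<Xi> t)" for t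
      by (simp add: op_nonneg_def Qr Q1 complex_nonneg_Reals_iff blinfun.diff_left cinner_diff_right cinner_self)
  qed
qed

section \<open>Weak integrals from integrals of quadratic forms\<close>

lemma has_bochner_integral_lebesgue:
  fixes f :: "real \<Rightarrow> complex"
  assumes "has_bochner_integral lborel f x" "f \<in> borel_measurable borel"
  shows "has_bochner_integral lebesgue f x"
  using assms by (simp add: has_bochner_integral_iff integrable_completion integral_completion)

lemma weak_integral_of_quadratic_forms:
  fixes F :: "'s \<Rightarrow> 'a::complex_inner \<Rightarrow>\<^sub>L 'a"
  assumes F: "\<And>t. F t \<in> cbounded_ops" and J: "J \<in> cbounded_ops"
    and q: "\<And>f. has_bochner_integral \<mu> (\<lambda>t. cinner f (F t f)) (cinner f (J f))"
  shows "has_weak_integral \<mu> F J"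
  unfolding has_weak_integral_def
proof (intro allI)
  fix f g
  have "has_bochner_integral \<mu> (\<lambda>t. (\<Sum>m<4. (-\<i>) ^ m * cinner (f + \<i> ^ m *\<^sub>C g) (F t (f + \<i> ^ m *\<^sub>C g))) / 4)
    ((\<Sum>m<4. (-\<i>) ^ m * cinner (f + \<i> ^ m *\<^sub>C g) (J (f + \<i> ^ m *\<^sub>C g))) / 4)"
    by (intro has_bochner_integral_divide_zero has_bochner_integral_sum has_bochner_integral_mult_right q)
  moreover have "(\<lambda>t. cinner f (F t g)) = (\<lambda>t. (\<Sum>m<4. (-\<i>) ^ m * cinner (f + \<i> ^ m *\<^sub>C g) (F t (f + \<i> ^ m *\<^sub>C g))) / 4)"
    by (intro ext polarization_op F)
  ultimately show "has_bochner_integral \<mu> (\<lambda>t. cinner f (F t g)) (cinner f (J g))"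
    by (simp only: polarization_op[OF J, of f g])
qed

section \<open>Square roots\<close>

text \<open>The Cauchy-Schwarz inequality for the form of \<open>S\<close>, taken at
  \<open>S x\<close> and \<open>x\<close>. In particular a vector at which the quadratic form
  vanishes lies in the kernel.\<close>

lemma norm_sq_le_nonneg_form:
  fixes S :: "'a::complex_hilbert_space \<Rightarrow>\<^sub>L 'a"
  assumes S: "S \<in> cbounded_ops" "op_nonneg S"
  shows "(norm (S x))\<^sup>2 \<le> norm S * Re (cinner x (S x))"
proof (cases "S x = 0")
  case True
  then show ?thesis using op_nonnegD(2)[OF S(2), of x] by simp
next
  case False
  have "(cmod (cinner (S x) (S x)))\<^sup>2 \<le> Re (cinner (S x) (S (S x))) * Re (cinner x (S x))"
    by (rule cauchy_schwarz_nonneg[OF S])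
  also have "\<dots> \<le> (norm S * norm (S x) * norm (S x)) * Re (cinner x (S x))"
    by (intro mult_right_mono order_trans[OF complex_Re_le_cmod cinner_op_bound] op_nonnegD(2) S)
  finally have "(norm (S x))\<^sup>2 * (norm (S x))\<^sup>2 \<le> (norm (S x))\<^sup>2 * (norm S * Re (cinner x (S x)))"
    by (simp add: cinner_self norm_power power2_eq_square mult_ac norm_mult)
  then show ?thesis by (rule mult_left_le_imp_le) (use False in simp)
qed

text \<open>The increments of the iteration \<open>Y \<mapsto> (A + Y\<^sup>2) / 2\<close> are dominated by those of the scalar iteration
  \<open>y \<mapsto> (1 + y\<^sup>2) / 2\<close>, which increases and stays below \<open>1\<close>.\<close>

lemma sqrt_iteration:
  fixes A :: "'a::complex_hilbert_space \<Rightarrow>\<^sub>L 'a"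
  assumes A: "A \<in> cbounded_ops" "norm A \<le> 1" and h: "\<And>x y. cinner (A x) y = cinner x (A y)"
  obtains Y where "Y \<in> cbounded_ops" "\<And>x y. cinner (Y x) y = cinner x (blinfun_apply Y y)"
    "(id_blinfun - Y) o\<^sub>L (id_blinfun - Y) = id_blinfun - A" "norm Y \<le> 1"
    "\<And>R x. (\<And>x. blinfun_apply R (A x) = A (blinfun_apply R x)) \<Longrightarrow> R (Y x) = Y (R x)"
proof -
  define Y where "Y = rec_nat (0 :: 'a \<Rightarrow>\<^sub>L 'a) (\<lambda>_ Z. (1/2) *\<^sub>R (A + (Z o\<^sub>L Z)))"
  define y where "y = rec_nat (0 :: real) (\<lambda>_ z. (1/2) * (1 + z * z))"
  have Y: "Y 0 = 0" "Y (Suc n) = (1/2) *\<^sub>R (A + (Y n o\<^sub>L Y n))" for n by (simp_all add: Y_def)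
  have y: "y 0 = 0" "y (Suc n) = (1/2) * (1 + y n * y n)" for n by (simp_all add: y_def)
  have y01: "0 \<le> y n \<and> y n \<le> 1" for n
  proof (induction n)
    case (Suc n)
    then have "y n * y n \<le> 1 * 1" by (intro mult_mono) auto
    then show ?case by (simp add: y)
  qed (simp add: y)
  \<comment> \<open>The increment is half the square of \<open>1 - y n\<close>.\<close>
  have yinc: "y n \<le> y (Suc n)" for n
  proof -
    have "0 \<le> (1 - y n)\<^sup>2" by simp
    then show ?thesis by (simp add: y power2_eq_square algebra_simps)
  qed
  have Yb: "norm (Y n) \<le> y n" for n
  proof (induction n)
    case (Suc n)
    have "norm (Y (Suc n)) \<le> (1/2) * (norm A + norm (Y n o\<^sub>L Y n))"
      using norm_triangle_ineq[of A "Y n o\<^sub>L Y n"] by (simp add: Y)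
    also have "\<dots> \<le> (1/2) * (1 + y n * y n)"
      using Suc y01[of n] by (intro mult_left_mono add_mono A order_trans[OF norm_blinfun_compose] mult_mono) auto
    finally show ?case by (simp add: y)
  qed (simp add: Y y)
  have Yd: "norm (Y (Suc n) - Y n) \<le> y (Suc n) - y n" for n
  proof (induction n)
    case (Suc n)
    \<comment> \<open>A difference of squares in the form valid without commutativity; the scalar
      increments satisfy the same identity, which lets the induction close.\<close>
    have "Y (Suc (Suc n)) - Y (Suc n) = (1/2) *\<^sub>R ((Y (Suc n) o\<^sub>L (Y (Suc n) - Y n)) + ((Y (Suc n) - Y n) o\<^sub>L Y n))"
      unfolding Y(2)[of "Suc n"] Y(2)[of n]
      by (rule blinfun_eqI) (simp add: blinfun.bilinear_simps algebra_simps)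
    also have "norm \<dots> \<le> (1/2) * (norm (Y (Suc n)) * norm (Y (Suc n) - Y n) + norm (Y (Suc n) - Y n) * norm (Y n))"
      unfolding norm_scaleR by (intro mult_mono order_trans[OF norm_triangle_ineq] add_mono norm_blinfun_compose) auto
    also have "\<dots> \<le> (1/2) * (y (Suc n) * (y (Suc n) - y n) + (y (Suc n) - y n) * y n)"
      using Yb Suc y01[of n] y01[of "Suc n"] yinc[of n] by (intro mult_left_mono add_mono mult_mono) auto
    also have "\<dots> = y (Suc (Suc n)) - y (Suc n)"
      unfolding y(2)[of "Suc n"] by (subst (3) y(2)) (simp add: algebra_simps)
    finally show ?case .
  qed (use A in \<open>simp add: Y y\<close>)
  have Ydiff: "norm (Y (n + k) - Y n) \<le> y (n + k) - y n" for n k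
  proof (induction k)
    case (Suc k)
    have "norm (Y (n + Suc k) - Y n) \<le> norm (Y (Suc (n + k)) - Y (n + k)) + norm (Y (n + k) - Y n)"
      using norm_triangle_ineq[of "Y (Suc (n + k)) - Y (n + k)" "Y (n + k) - Y n"] by simp
    then show ?case using Yd[of "n + k"] Suc by simp
  qed simp
  have "Bseq y" using y01 by (intro BseqI'[where K = 1]) auto
  then have "convergent y" by (intro Bseq_monoseq_convergent incseq_imp_monoseq incseq_SucI yinc)
  then have yC: "Cauchy y" by (simp add: Cauchy_convergent_iff)
  have "Cauchy Y"
  proof (rule metric_CauchyI)
    fix e :: real assume "e > 0"
    then obtain N where N: "\<And>m n. m \<ge> N \<Longrightarrow> n \<ge> N \<Longrightarrow> dist (y m) (y n) < e" using yC unfolding Cauchy_def by meson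
    have *: "dist (Y m) (Y n) < e" if "N \<le> n" "n \<le> m" for m n
      using Ydiff[of n "m - n"] N[of m n] that by (simp add: dist_norm)
    show "\<exists>N. \<forall>m\<ge>N. \<forall>n\<ge>N. dist (Y m) (Y n) < e"
      using * by (metis dist_commute linear)
  qed
  then obtain Z where Z: "Y \<longlonglongrightarrow> Z" using Cauchy_convergent_iff convergent_def by metis
  have Yc: "Y n \<in> cbounded_ops" for n by (induction n) (use A in \<open>auto simp: Y\<close>)
  have Yh: "cinner (Y n x) z = cinner x (Y n z)" for n x z
    by (induction n arbitrary: x z) (simp_all add: Y h blinfun.bilinear_simps cinner_add_left cinner_add_right)
  have 1: "(\<lambda>n. (1/2) *\<^sub>R (A + (Y n o\<^sub>L Y n))) \<longlonglongrightarrow> (1/2) *\<^sub>R (A + (Z o\<^sub>L Z))"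
    by (intro tendsto_intros Z bounded_bilinear.tendsto[OF bounded_bilinear_blinfun_compose])
  have 2: "(\<lambda>n. (1/2) *\<^sub>R (A + (Y n o\<^sub>L Y n))) \<longlonglongrightarrow> Z" using LIMSEQ_Suc[OF Z] by (simp add: Y)
  \<comment> \<open>The fixed point equation 2 Z = A + Z^2 is the same as (I - Z)^2 = I - A.\<close>
  have ZA: "Z = (1/2) *\<^sub>R (A + (Z o\<^sub>L Z))" by (rule LIMSEQ_unique[OF 2 1])
  show ?thesis
  proof (rule that)
    show "Z \<in> cbounded_ops" using closed_cbounded_ops Yc Z unfolding closed_sequential_limits by blast
    show "cinner (Z x) z = cinner x (Z z)" for x z
    proof (rule LIMSEQ_unique)
      show "(\<lambda>n. cinner (Y n x) z) \<longlonglongrightarrow> cinner (Z x) z" by (intro tendsto_intros Z)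
      show "(\<lambda>n. cinner (Y n x) z) \<longlonglongrightarrow> cinner x (Z z)" unfolding Yh by (intro tendsto_intros Z)
    qed
    show "(id_blinfun - Z) o\<^sub>L (id_blinfun - Z) = id_blinfun - A"
    proof (rule blinfun_eqI)
      fix x
      have "Z x = (1/2) *\<^sub>R (A x + Z (Z x))"
        using arg_cong[OF ZA, of "\<lambda>T. blinfun_apply T x"] by (simp only: blinfun.bilinear_simps blinfun_apply_blinfun_compose)
      then have "2 *\<^sub>R Z x = 2 *\<^sub>R ((1/2) *\<^sub>R (A x + Z (Z x)))" by (rule arg_cong)
      then have "2 *\<^sub>R Z x = A x + Z (Z x)" by (simp only: scaleR_scaleR) simp
      then have "Z x + Z x = A x + Z (Z x)" by (simp only: scaleR_2)
      then show "((id_blinfun - Z) o\<^sub>L (id_blinfun - Z)) x = (id_blinfun - A) x"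
        by (simp add: blinfun.bilinear_simps algebra_simps)
    qed
    show "norm Z \<le> 1"
      by (rule LIMSEQ_le_const2[OF tendsto_norm[OF Z]]) (use Yb y01 order_trans in blast)
    \<comment> \<open>Each iterate is a polynomial in \<open>A\<close>, so it commutes with whatever
      commutes with \<open>A\<close>.\<close>
    show "R (Z x) = Z (R x)" if R: "\<And>x. blinfun_apply R (A x) = A (blinfun_apply R x)" for R x
    proof (rule LIMSEQ_unique)
      have RY: "R (Y n x) = Y n (R x)" for n x
        by (induction n arbitrary: x) (simp_all add: Y R blinfun.bilinear_simps)
      show "(\<lambda>n. R (Y n x)) \<longlonglongrightarrow> R (Z x)" by (intro tendsto_intros Z)
      show "(\<lambda>n. R (Y n x)) \<longlonglongrightarrow> Z (R x)" unfolding RY by (intro tendsto_intros Z)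
    qed
  qed
qed

text \<open>Rescaling reduces to the iteration: I - T / c has a quadratic form between 0 and |x|^2,
  hence norm at most 1, and sqrt c times the resulting root of T / c is a root of \<open>T\<close>.
  The 1 added in \<open>c\<close> keeps it positive for \<open>T = 0\<close>. The commutation clause
  serves the uniqueness proof.\<close>

lemma nonneg_sqrt:
  fixes T :: "'a::complex_hilbert_space \<Rightarrow>\<^sub>L 'a"
  assumes T: "T \<in> cbounded_ops" "op_nonneg T"
  obtains S where "S \<in> cbounded_ops" "op_nonneg S" "S o\<^sub>L S = T"
    "\<And>R x. (\<And>x. blinfun_apply R (T x) = T (blinfun_apply R x)) \<Longrightarrow> R (S x) = S (R x)"
proof -
  define c where "c = norm T + 1"
  have c: "c > 0" by (simp add: c_def add_nonneg_pos)
  define A where "A = id_blinfun - (1 / c) *\<^sub>R T"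
  have A: "A \<in> cbounded_ops" using T by (simp add: A_def)
  note Tq = op_nonnegD(1,2)[OF T(2)]
  have Aq: "cinner x (A x) = of_real ((norm x)\<^sup>2 - Re (cinner x (T x)) / c)" for x
    using Tq(1)[of x] by (simp add: A_def blinfun.bilinear_simps cinner_diff_right cinner_self)
  have "Re (cinner x (T x)) \<le> c * (norm x)\<^sup>2" for x
  proof -
    have "Re (cinner x (T x)) \<le> norm T * norm x * norm x"
      by (rule order_trans[OF complex_Re_le_cmod cinner_op_bound])
    also have "\<dots> \<le> c * norm x * norm x" by (intro mult_right_mono) (auto simp: c_def)
    finally show ?thesis by (simp add: power2_eq_square mult.assoc)
  qed
  then have A01: "0 \<le> Re (cinner x (A x))" "Re (cinner x (A x)) \<le> (norm x)\<^sup>2" for x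
    using c Tq(2)[of x] by (simp_all add: Aq field_simps)
  have Ann: "op_nonneg A" using A01(1) by (simp add: op_nonneg_def Aq complex_nonneg_Reals_iff)
  have nA: "norm A \<le> 1"
  proof (rule cbounded_norm_le)
    show "cmod (cinner f (A g)) \<le> 1 * norm f * norm g" for f g
    proof -
      have "(cmod (cinner f (A g)))\<^sup>2 \<le> Re (cinner f (A f)) * Re (cinner g (A g))" by (rule cauchy_schwarz_nonneg[OF A Ann])
      also have "\<dots> \<le> (norm f)\<^sup>2 * (norm g)\<^sup>2" by (intro mult_mono A01) auto
      also have "\<dots> = (norm f * norm g)\<^sup>2" by (simp add: power_mult_distrib)
      finally have "cmod (cinner f (A g)) \<le> norm f * norm g" by (rule power2_le_imp_le) simp
      then show ?thesis by simp
    qed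
  qed simp
  have "cinner (A x) y = cinner x (A y)" for x y by (rule hermitian_form[OF A]) (simp add: Aq)
  from sqrt_iteration[OF A nA this] obtain Y where Y: "Y \<in> cbounded_ops"
    "\<And>x y. cinner (Y x) y = cinner x (blinfun_apply Y y)"
    "(id_blinfun - Y) o\<^sub>L (id_blinfun - Y) = id_blinfun - A" "norm Y \<le> 1"
    "\<And>R x. (\<And>x. blinfun_apply R (A x) = A (blinfun_apply R x)) \<Longrightarrow> R (Y x) = Y (R x)" by metis
  show ?thesis
  proof (rule that[of "sqrt c *\<^sub>R (id_blinfun - Y)"])
    show "sqrt c *\<^sub>R (id_blinfun - Y) \<in> cbounded_ops" using Y by simp
    have "Im (cinner x (Y x)) = 0" for x
      using cinner_commute[of x "Y x"] Y(2)[of x x] by (simp add: complex_eq_iff)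
    moreover have "Re (cinner x (Y x)) \<le> (norm x)\<^sup>2" for x
    proof -
      have "Re (cinner x (Y x)) \<le> norm Y * (norm x * norm x)"
        using order_trans[OF complex_Re_le_cmod cinner_op_bound[of x Y x]] by (simp add: mult.assoc)
      also have "\<dots> \<le> 1 * (norm x * norm x)" by (intro mult_right_mono Y) auto
      finally show ?thesis by (simp add: power2_eq_square)
    qed
    ultimately show "op_nonneg (sqrt c *\<^sub>R (id_blinfun - Y))"
      using c by (simp add: op_nonneg_def complex_nonneg_Reals_iff blinfun.bilinear_simps cinner_diff_right cinner_self
        del: of_real_power)
    show "R ((sqrt c *\<^sub>R (id_blinfun - Y)) x) = (sqrt c *\<^sub>R (id_blinfun - Y)) (R x)"
      if "\<And>x. blinfun_apply R (T x) = T (blinfun_apply R x)" for R x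
      using Y(5)[of R] that by (simp add: A_def blinfun.bilinear_simps)
    show "(sqrt c *\<^sub>R (id_blinfun - Y)) o\<^sub>L (sqrt c *\<^sub>R (id_blinfun - Y)) = T"
    proof (rule blinfun_eqI)
      fix x
      have "((id_blinfun - Y) o\<^sub>L (id_blinfun - Y)) x = (1 / c) *\<^sub>R T x" unfolding Y(3) by (simp add: A_def blinfun.bilinear_simps)
      then have "c *\<^sub>R ((id_blinfun - Y) ((id_blinfun - Y) x)) = T x" using c by simp
      then show "((sqrt c *\<^sub>R (id_blinfun - Y)) o\<^sub>L (sqrt c *\<^sub>R (id_blinfun - Y))) x = T x"
        using c by (simp add: blinfun.scaleR_left blinfun.scaleR_right)
    qed
  qed
qed

text \<open>For \<open>y = P x - S x\<close> the assumptions give \<open>P y = - S y\<close>, so two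
  nonnegative quadratic forms have opposite values at \<open>y\<close> and both vanish there. Then
  \<open>P y\<close> and \<open>S y\<close> are zero, and symmetry gives
  \<open>cinner y y = 0\<close>.\<close>

lemma commuting_square_unique:
  fixes P S :: "'a::complex_hilbert_space \<Rightarrow>\<^sub>L 'a"
  assumes P: "P \<in> cbounded_ops" "op_nonneg P" and S: "S \<in> cbounded_ops" "op_nonneg S"
    and eq: "P o\<^sub>L P = S o\<^sub>L S" and comm: "\<And>x. P (S x) = S (P x)"
  shows "P = S"
proof (rule blinfun_eqI)
  fix x
  define y where "y = P x - S x"
  have "P (P x) = S (S x)" using arg_cong[OF eq, of "\<lambda>T. blinfun_apply T x"] by simp
  then have "P y = - S y" by (simp add: y_def blinfun.diff_right comm)
  then have "Re (cinner y (P y)) = 0" "Re (cinner y (S y)) = 0"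
    using op_nonnegD(2)[OF P(2), of y] op_nonnegD(2)[OF S(2), of y] by auto
  then have "P y = 0" "S y = 0"
    using norm_sq_le_nonneg_form[OF P, of y] norm_sq_le_nonneg_form[OF S, of y] by auto
  then have "cinner (P x) y - cinner (S x) y = 0"
    unfolding hermitian_form[OF P(1) op_nonnegD(3)[OF P(2)]] hermitian_form[OF S(1) op_nonnegD(3)[OF S(2)]] by simp
  then have "cinner y y = 0" by (simp only: y_def cinner_diff_left)
  then show "P x = S x" by (simp add: cinner_self y_def)
qed

text \<open>The constructed root \<open>S\<close> of T^2 commutes with everything that commutes with
  T^2, in particular with any nonnegative \<open>P\<close> satisfying P^2 = T^2. Hence every such
  \<open>P\<close>, \<open>T\<close> itself included, equals \<open>S\<close>, and the description
  in \<open>op_abs\<close> has a unique solution.\<close>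

lemma op_abs_nonneg:
  fixes T :: "'a::complex_hilbert_space \<Rightarrow>\<^sub>L 'a"
  assumes T: "T \<in> cbounded_ops" "op_nonneg T"
  shows "op_abs T = T"
proof -
  note herm = hermitian_form[OF T(1) op_nonnegD(3)[OF T(2)]]
  have adj: "op_adj T = T" by (rule op_adj_self[OF T(1) op_nonnegD(3)[OF T(2)]])
  have "T o\<^sub>L T \<in> cbounded_ops" "op_nonneg (T o\<^sub>L T)"
    using T(1) by (simp_all add: op_nonneg_def cinner_self complex_nonneg_Reals_iff flip: herm)
  then obtain S where S: "S \<in> cbounded_ops" "op_nonneg S" "S o\<^sub>L S = T o\<^sub>L T"
    "\<And>R x. (\<And>x. blinfun_apply R ((T o\<^sub>L T) x) = (T o\<^sub>L T) (blinfun_apply R x)) \<Longrightarrow> R (S x) = S (R x)"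
    using nonneg_sqrt by metis
  have "P = S" if P: "P \<in> cbounded_ops" "op_nonneg P" "P o\<^sub>L P = T o\<^sub>L T" for P
    by (rule commuting_square_unique[OF P(1,2) S(1,2)]) (use P(3) S(3) in simp, rule S(4), simp flip: P(3))
  then show ?thesis unfolding op_abs_def adj using T by (intro the_equality) auto
qed

section \<open>Orthonormal bases and the trace\<close>

text \<open>Moves unordered sums to integrals over counting measure, where Tonelli's theorem is
  available. The second equation covers divergent sums too: \<open>infsum\<close> and
  \<open>enn2real\<close> of infinity are both 0.\<close>

lemma count_space_summable_iff:
  fixes f :: "'a \<Rightarrow> real"
  assumes f: "\<And>x. x \<in> E \<Longrightarrow> 0 \<le> f x"
  shows "f summable_on E \<longleftrightarrow> (\<integral>\<^sup>+x. ennreal (f x) \<partial>count_space E) < \<infinity>"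
    and "infsum f E = enn2real (\<integral>\<^sup>+x. ennreal (f x) \<partial>count_space E)"
proof -
  have "f summable_on E \<longleftrightarrow> Infinite_Set_Sum.abs_summable_on f E"
    by (rule trans[OF summable_on_iff_abs_summable_on_real abs_summable_equivalent])
  also have "\<dots> \<longleftrightarrow> (\<integral>\<^sup>+x. ennreal (norm (f x)) \<partial>count_space E) < \<infinity>"
    by (simp add: Infinite_Set_Sum.abs_summable_on_def integrable_iff_bounded)
  also have "(\<integral>\<^sup>+x. ennreal (norm (f x)) \<partial>count_space E) = (\<integral>\<^sup>+x. ennreal (f x) \<partial>count_space E)"
    by (rule nn_integral_cong) (simp add: f)
  finally show 1: "f summable_on E \<longleftrightarrow> (\<integral>\<^sup>+x. ennreal (f x) \<partial>count_space E) < \<infinity>" .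
  show "infsum f E = enn2real (\<integral>\<^sup>+x. ennreal (f x) \<partial>count_space E)"
  proof (cases "f summable_on E")
    case True
    then have "Infinite_Set_Sum.abs_summable_on f E"
      using trans[OF summable_on_iff_abs_summable_on_real[of f E] abs_summable_equivalent] by blast
    then have "infsum f E = infsetsum f E" by (rule infsetsum_infsum[symmetric])
    also have "\<dots> = enn2real (\<integral>\<^sup>+x. ennreal (f x) \<partial>count_space E)"
      by (rule infsetsum_conv_nn_integral) (use 1 True f in auto)
    finally show ?thesis .
  next
    case False
    then have "(\<integral>\<^sup>+x. ennreal (f x) \<partial>count_space E) = \<infinity>" using 1 False by (metis less_top infinity_ennreal_def)
    then show ?thesis using False by (simp add: infsum_not_exists)
  qed
qed

lemma onb_norm: "is_onb E \<Longrightarrow> e \<in> E \<Longrightarrow> norm e = 1"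
proof -
  assume "is_onb E" "e \<in> E"
  then have "cinner e e = 1" by (simp add: is_onb_def)
  then have "complex_of_real ((norm e)\<^sup>2) = 1" by (simp only: cinner_self)
  then have "(norm e)\<^sup>2 = 1\<^sup>2" by (metis of_real_eq_1_iff one_power2)
  then show ?thesis by (rule power2_eq_imp_eq) auto
qed

text \<open>Distinct basis vectors are sqrt 2 apart, so points of the dense sequence within 1/2 of
  them differ. Countability makes the counting measure sigma-finite, as the exchanges of sums and
  integrals require.\<close>

lemma onb_countable:
  fixes E :: "'h::complex_inner set"
  assumes sep: "separable_space (euclidean :: 'h topology)" and E: "is_onb E"
  shows "countable E"
proof -
  obtain d :: "nat \<Rightarrow> 'h" where d: "closure (range d) = UNIV" using separable_dense_sequence[OF sep] .
  have "\<exists>n. dist (d n) e < 1/2" for e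
  proof -
    have "\<forall>\<epsilon>>0. \<exists>n. dist (d n) e < \<epsilon>" using d closure_approachable[of e "range d"] by auto
    from this[rule_format, of "1/2"] show ?thesis by simp
  qed
  then obtain n where n: "\<And>e. dist (d (n e)) e < 1/2" by metis
  have "inj_on n E"
  proof (rule inj_onI, rule ccontr)
    fix e f assume ef: "e \<in> E" "f \<in> E" "n e = n f" "e \<noteq> f"
    have "dist e f \<le> dist (d (n e)) e + dist (d (n e)) f" by (metis dist_commute dist_triangle)
    then have "dist e f < 1" using n[of e] n[of f] ef(3) by simp
    then have "(norm (e - f))\<^sup>2 < 1" by (simp add: dist_norm power_less_one_iff)
    moreover have "cinner e (- f) = 0" using E ef by (simp add: is_onb_def)
    then have "(norm (e - f))\<^sup>2 = 2" using norm_add_sq[of e "- f"] onb_norm[OF E] ef by simp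
    ultimately show False by simp
  qed
  then show ?thesis by (rule countableI)
qed

text \<open>Pythagoras with free coefficients \<open>r\<close>: the Fourier coefficients give
  Bessel's inequality, and the coefficients of an approximating combination show that Bessel's sums
  come arbitrarily close to equality.\<close>

lemma norm_diff_onb_sum:
  assumes E: "is_onb E" and F: "finite F" "F \<subseteq> E"
  shows "(norm (x - (\<Sum>e\<in>F. r e *\<^sub>C e)))\<^sup>2 =
    (norm x)\<^sup>2 - (\<Sum>e\<in>F. (cmod (cinner e x))\<^sup>2) + (\<Sum>e\<in>F. (cmod (r e - cinner e x))\<^sup>2)"
  using F
proof (induction F arbitrary: x rule: finite_induct)
  case (insert a F)
  then have a: "a \<in> E" "F \<subseteq> E" by auto
  have ort: "cinner e a = 0" if "e \<in> F" for e
    using E a insert(2) that by (auto simp: is_onb_def)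
  have na: "norm a = 1" by (rule onb_norm[OF E a(1)])
  let ?x = "x - r a *\<^sub>C a"
  have "(norm (x - (\<Sum>e\<in>insert a F. r e *\<^sub>C e)))\<^sup>2 = (norm (?x - (\<Sum>e\<in>F. r e *\<^sub>C e)))\<^sup>2"
    using insert(1,2) by (simp add: diff_diff_eq)
  also have "\<dots> = (norm ?x)\<^sup>2 - (\<Sum>e\<in>F. (cmod (cinner e ?x))\<^sup>2) + (\<Sum>e\<in>F. (cmod (r e - cinner e ?x))\<^sup>2)"
    by (rule insert(3)[OF a(2)])
  also have "\<dots> = (norm ?x)\<^sup>2 - (\<Sum>e\<in>F. (cmod (cinner e x))\<^sup>2) + (\<Sum>e\<in>F. (cmod (r e - cinner e x))\<^sup>2)"
    by (simp add: cinner_diff_right cinner_scaleC_right ort)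
  also have "(norm ?x)\<^sup>2 = (norm x)\<^sup>2 - (cmod (cinner a x))\<^sup>2 + (cmod (r a - cinner a x))\<^sup>2"
    using norm_add_sq[of x "- (r a *\<^sub>C a)"] cinner_commute[of x a]
    by (simp add: cinner_scaleC_right norm_scaleC na cmod_power2) (simp add: power2_eq_square algebra_simps)
  finally show ?case using insert(1,2) by simp
qed simp

lemma parseval:
  fixes x :: "'h::complex_inner"
  assumes E: "is_onb E"
  shows "(\<integral>\<^sup>+e. ennreal ((cmod (cinner e x))\<^sup>2) \<partial>count_space E) = ennreal ((norm x)\<^sup>2)"
proof -
  have "((\<lambda>e. (cmod (cinner e x))\<^sup>2) has_sum (norm x)\<^sup>2) E"
    unfolding has_sum_def tendsto_iff
  proof (intro allI impI)
    fix \<epsilon> :: real assume \<epsilon>: "\<epsilon> > 0"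
    have "x \<in> closure (module.span scaleC E)" using E by (simp add: is_onb_def)
    then obtain y where y: "y \<in> module.span scaleC E" "dist y x < sqrt \<epsilon>"
      using \<epsilon> unfolding closure_approachable by (metis real_sqrt_gt_0_iff)
    then obtain F r where F: "finite F" "F \<subseteq> E" "y = (\<Sum>e\<in>F. r e *\<^sub>C e)" unfolding cvs.span_explicit by blast
    have bessel: "(\<Sum>e\<in>G. (cmod (cinner e x))\<^sup>2) \<le> (norm x)\<^sup>2" if "finite G" "G \<subseteq> E" for G
    proof -
      have "0 \<le> (norm (x - (\<Sum>e\<in>G. cinner e x *\<^sub>C e)))\<^sup>2" by simp
      then show ?thesis unfolding norm_diff_onb_sum[OF E that] by simp
    qed
    have "(norm x)\<^sup>2 - (\<Sum>e\<in>F. (cmod (cinner e x))\<^sup>2) \<le> (norm (x - y))\<^sup>2"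
      using norm_diff_onb_sum[OF E F(1,2), of x r] by (simp add: F(3) sum_nonneg)
    also have "\<dots> < (sqrt \<epsilon>)\<^sup>2"
      using y(2) by (intro power_strict_mono) (auto simp: dist_norm norm_minus_commute)
    also have "\<dots> = \<epsilon>" using \<epsilon> by simp
    finally have Fe: "(norm x)\<^sup>2 - (\<Sum>e\<in>F. (cmod (cinner e x))\<^sup>2) < \<epsilon>" .
    show "\<forall>\<^sub>F G in finite_subsets_at_top E. dist (\<Sum>e\<in>G. (cmod (cinner e x))\<^sup>2) ((norm x)\<^sup>2) < \<epsilon>"
      unfolding eventually_finite_subsets_at_top
    proof (intro exI[of _ F] conjI allI impI F)
      fix G assume G: "finite G \<and> F \<subseteq> G \<and> G \<subseteq> E"
      then have "(\<Sum>e\<in>F. (cmod (cinner e x))\<^sup>2) \<le> (\<Sum>e\<in>G. (cmod (cinner e x))\<^sup>2)" by (intro sum_mono2) auto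
      then show "dist (\<Sum>e\<in>G. (cmod (cinner e x))\<^sup>2) ((norm x)\<^sup>2) < \<epsilon>"
        using Fe bessel[of G] G by (simp add: dist_real_def)
    qed
  qed
  then have "(\<lambda>e. (cmod (cinner e x))\<^sup>2) summable_on E" "infsum (\<lambda>e. (cmod (cinner e x))\<^sup>2) E = (norm x)\<^sup>2"
    by (auto simp: has_sum_imp_summable infsumI)
  then show ?thesis
    using count_space_summable_iff[of E "\<lambda>e. (cmod (cinner e x))\<^sup>2"]
    by (metis ennreal_enn2real infinity_ennreal_def zero_le_power2)
qed

text \<open>Extended nonnegative values let Tonelli's theorem apply before finiteness is known.
  Negative terms would be cut off by \<open>ennreal\<close>; the intended arguments are nonnegative
  operators.\<close>

definition nn_trace :: "'a::complex_inner set \<Rightarrow> ('a \<Rightarrow>\<^sub>L 'a) \<Rightarrow> ennreal" where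
  "nn_trace E T = (\<integral>\<^sup>+e. ennreal (Re (cinner e (T e))) \<partial>count_space E)"

text \<open>Both sides are the squared Hilbert-Schmidt norm of the root \<open>S\<close>, summed by
  rows and by columns.\<close>

lemma nn_trace_basis_independent:
  fixes T :: "'h::complex_hilbert_space \<Rightarrow>\<^sub>L 'h"
  assumes sep: "separable_space (euclidean :: 'h topology)"
    and T: "T \<in> cbounded_ops" "op_nonneg T" and E: "is_onb E" "is_onb F"
  shows "nn_trace E T = nn_trace F T"
proof -
  obtain S where S': "S \<in> cbounded_ops" "op_nonneg S" and S3: "S o\<^sub>L S = T" using nonneg_sqrt[OF T] by metis
  note S2 = hermitian_form[OF S'(1) op_nonnegD(3)[OF S'(2)]]
  have cE: "countable E" "countable F" using onb_countable[OF sep] E by auto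
  have q: "ennreal (Re (cinner e (T e))) = (\<integral>\<^sup>+f. ennreal ((cmod (cinner f (S e)))\<^sup>2) \<partial>count_space G)" if "is_onb G" for e G
  proof -
    have "cinner e (T e) = cinner (S e) (S e)" unfolding S3[symmetric] by (simp add: S2)
    then show ?thesis by (simp add: parseval[OF that] cinner_self flip: of_real_power)
  qed
  interpret pair_sigma_finite "count_space E" "count_space F"
    by (intro pair_sigma_finite.intro sigma_finite_measure_count_space_countable cE)
  have "nn_trace E T = (\<integral>\<^sup>+e. (\<integral>\<^sup>+f. ennreal ((cmod (cinner f (S e)))\<^sup>2) \<partial>count_space F) \<partial>count_space E)"
    unfolding nn_trace_def q[OF E(2)] ..
  also have "\<dots> = (\<integral>\<^sup>+f. (\<integral>\<^sup>+e. ennreal ((cmod (cinner f (S e)))\<^sup>2) \<partial>count_space E) \<partial>count_space F)"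
    by (rule Fubini'[symmetric]) (intro measurable_pair_measure_countable1 cE, simp)
  also have "\<dots> = (\<integral>\<^sup>+f. (\<integral>\<^sup>+e. ennreal ((cmod (cinner e (S f)))\<^sup>2) \<partial>count_space E) \<partial>count_space F)"
  proof -
    have "cmod (cinner f (S e)) = cmod (cinner e (S f))" for e f
      using cinner_commute[of f "S e"] S2[of e f] by simp
    then show ?thesis by simp
  qed
  also have "\<dots> = nn_trace F T" unfolding nn_trace_def q[OF E(1)] ..
  finally show ?thesis .
qed

lemma trace_class_iff_nn_trace:
  fixes T :: "'h::complex_hilbert_space \<Rightarrow>\<^sub>L 'h"
  assumes sep: "separable_space (euclidean :: 'h topology)"
    and T: "T \<in> cbounded_ops" "op_nonneg T" and E: "is_onb E"
  shows "trace_class T \<longleftrightarrow> nn_trace E T < \<infinity>"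
proof -
  note re = op_nonnegD(1,2)[OF T(2)]
  have "(\<lambda>e. cinner e (T e)) summable_on F \<longleftrightarrow> nn_trace F T < \<infinity>" for F
  proof -
    have "(\<lambda>e. cinner e (T e)) summable_on F \<longleftrightarrow> (\<lambda>e. Re (cinner e (T e))) summable_on F"
    proof
      assume "(\<lambda>e. Re (cinner e (T e))) summable_on F"
      then have "(\<lambda>e. complex_of_real (Re (cinner e (T e)))) summable_on F" by (rule summable_on_of_real)
      moreover have "(\<lambda>e. cinner e (T e)) = (\<lambda>e. complex_of_real (Re (cinner e (T e))))" by (rule ext) (rule re(1))
      ultimately show "(\<lambda>e. cinner e (T e)) summable_on F" by (simp only:)
    qed (rule summable_on_Re)
    then show ?thesis unfolding nn_trace_def using count_space_summable_iff(1)[of F "\<lambda>e. Re (cinner e (T e))"] re(2) by simp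
  qed
  then have "trace_class T \<longleftrightarrow> (\<exists>F. is_onb F \<and> nn_trace F T < \<infinity>)"
    unfolding trace_class_def op_abs_nonneg[OF T] using T(1) by simp
  then show ?thesis using nn_trace_basis_independent[OF sep T _ E] E by metis
qed

text \<open>The identity includes operators outside the trace class: there \<open>op_trace\<close>
  is 0 by definition and \<open>nn_trace\<close> is infinite, which \<open>enn2real\<close> also
  sends to 0. So it can be used at every point of the line, without an exceptional set.\<close>

lemma op_trace_nn_trace:
  fixes T :: "'h::complex_hilbert_space \<Rightarrow>\<^sub>L 'h"
  assumes sep: "separable_space (euclidean :: 'h topology)"
    and T: "T \<in> cbounded_ops" "op_nonneg T" and E: "is_onb E"
  shows "op_trace T = of_real (enn2real (nn_trace E T))"
proof -
  define F :: "'h set" where "F = (SOME F. is_onb F)"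
  have F: "is_onb F" unfolding F_def by (rule someI[of is_onb, OF E])
  note re = op_nonnegD(1,2)[OF T(2)]
  have "nn_trace E T = nn_trace F T" by (rule nn_trace_basis_independent[OF sep T E F])
  moreover have "(\<Sum>\<^sub>\<infinity>e\<in>F. cinner e (T e)) = of_real (enn2real (nn_trace F T))" if "trace_class T"
  proof -
    have "nn_trace F T < \<infinity>" using that trace_class_iff_nn_trace[OF sep T F] by simp
    then have sm: "(\<lambda>e. Re (cinner e (T e))) summable_on F"
      unfolding nn_trace_def using count_space_summable_iff(1)[of F "\<lambda>e. Re (cinner e (T e))"] re(2) by simp
    have "(\<Sum>\<^sub>\<infinity>e\<in>F. cinner e (T e)) = (\<Sum>\<^sub>\<infinity>e\<in>F. complex_of_real (Re (cinner e (T e))))" by (rule infsum_cong) (rule re(1))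
    also have "\<dots> = of_real (\<Sum>\<^sub>\<infinity>e\<in>F. Re (cinner e (T e)))" by (rule infsumI[OF has_sum_of_real[OF has_sum_infsum[OF sm]]])
    also have "(\<Sum>\<^sub>\<infinity>e\<in>F. Re (cinner e (T e))) = enn2real (nn_trace F T)"
      unfolding nn_trace_def by (rule count_space_summable_iff(2)) (rule re(2))
    finally show ?thesis .
  qed
  moreover have "nn_trace E T = \<infinity>" if "\<not> trace_class T"
    using that trace_class_iff_nn_trace[OF sep T E] by (metis less_top infinity_ennreal_def)
  ultimately show ?thesis unfolding op_trace_def F_def[symmetric] by simp
qed

section \<open>Traces of weakly integrated families\<close>

lemma nn_trace_integral:
  fixes \<Xi> :: "real \<Rightarrow> 'h::complex_hilbert_space \<Rightarrow>\<^sub>L 'h" and B :: "'h \<Rightarrow>\<^sub>L 'h"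
  assumes E: "countable E" and p [measurable]: "p \<in> borel_measurable borel" and p0: "\<And>t. 0 \<le> p t"
    and \<Xi>m [measurable]: "\<And>f g. (\<lambda>t. cinner f (\<Xi> t g)) \<in> borel_measurable borel"
    and B: "\<And>e. ennreal (Re (cinner e (B e))) = (\<integral>\<^sup>+t. ennreal (p t * Re (cinner e (\<Xi> t e))) \<partial>lborel)"
  shows "nn_trace E B = (\<integral>\<^sup>+t. ennreal (p t) * nn_trace E (\<Xi> t) \<partial>lborel)"
    and "(\<lambda>t. nn_trace E (\<Xi> t)) \<in> borel_measurable borel"
proof -
  interpret cE: sigma_finite_measure "count_space E" by (rule sigma_finite_measure_count_space_countable[OF E])
  interpret pair_sigma_finite "count_space E" "lborel :: real measure"
    by (intro pair_sigma_finite.intro cE.sigma_finite_measure_axioms sigma_finite_lborel)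
  have "nn_trace E B = (\<integral>\<^sup>+e. (\<integral>\<^sup>+t. ennreal (p t * Re (cinner e (\<Xi> t e))) \<partial>lborel) \<partial>count_space E)"
    unfolding nn_trace_def B ..
  also have "\<dots> = (\<integral>\<^sup>+t. (\<integral>\<^sup>+e. ennreal (p t * Re (cinner e (\<Xi> t e))) \<partial>count_space E) \<partial>lborel)"
    by (rule Fubini'[symmetric]) (intro measurable_pair_measure_countable1 E, simp)
  also have "\<dots> = (\<integral>\<^sup>+t. ennreal (p t) * nn_trace E (\<Xi> t) \<partial>lborel)"
    unfolding nn_trace_def by (simp add: nn_integral_cmult[symmetric] ennreal_mult' p0)
  finally show "nn_trace E B = (\<integral>\<^sup>+t. ennreal (p t) * nn_trace E (\<Xi> t) \<partial>lborel)" .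
  have "(\<lambda>(e, t). ennreal (Re (cinner e (\<Xi> t e)))) \<in> borel_measurable (count_space E \<Otimes>\<^sub>M borel)"
    by (intro measurable_pair_measure_countable1 E) simp
  from measurable_pair_swap[OF this]
  have "(\<lambda>(t, e). ennreal (Re (cinner e (\<Xi> t e)))) \<in> borel_measurable (borel \<Otimes>\<^sub>M count_space E)" by simp
  then show "(\<lambda>t. nn_trace E (\<Xi> t)) \<in> borel_measurable borel"
    unfolding nn_trace_def by (rule cE.borel_measurable_nn_integral)
qed

lemma poisson_kernel_comparison:
  assumes z: "Im z > 0" and w: "Im w > 0"
  obtains c where "c \<ge> 0" "\<And>t. inverse ((cmod (of_real t - z))\<^sup>2) \<le> c * inverse ((cmod (of_real t - w))\<^sup>2)"
proof -
  \<comment> \<open>From |t - w| \<le> |t - z| + |z - w| and Im z \<le> |t - z|.\<close>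
  define k where "k = 1 + cmod (z - w) / Im z"
  have k: "k > 0" using z by (simp add: k_def add_pos_nonneg)
  have "inverse ((cmod (of_real t - z))\<^sup>2) \<le> k\<^sup>2 * inverse ((cmod (of_real t - w))\<^sup>2)" for t
  proof -
    have lz: "Im z \<le> cmod (of_real t - z)" using abs_Im_le_cmod[of "of_real t - z"] z by simp
    have pw: "0 < cmod (of_real t - w)" using w by (auto simp: complex_eq_iff)
    have "cmod (of_real t - w) \<le> cmod (of_real t - z) + cmod (z - w)"
      using norm_triangle_ineq[of "of_real t - z" "z - w"] by simp
    also have "cmod (z - w) = cmod (z - w) / Im z * Im z" using z by simp
    also have "\<dots> \<le> cmod (z - w) / Im z * cmod (of_real t - z)" using z by (intro mult_left_mono lz) auto
    finally have "cmod (of_real t - w) \<le> k * cmod (of_real t - z)" by (simp add: k_def algebra_simps)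
    then have "(cmod (of_real t - w))\<^sup>2 \<le> (k * cmod (of_real t - z))\<^sup>2" by (intro power_mono) auto
    moreover have "0 < cmod (of_real t - z)" using lz z by linarith
    ultimately show ?thesis using pw k by (simp add: field_simps power_mult_distrib)
  qed
  then show ?thesis by (intro that[of "k\<^sup>2"]) auto
qed

lemma measurable_poisson [measurable]:
  "(\<lambda>t. inverse ((cmod (complex_of_real t - z))\<^sup>2)) \<in> borel_measurable borel"
  by measurable

text \<open>For every z the trace of \<open>B z\<close> is an integral of the traces of
  \<open>\<Xi>\<close> in the extended sense. Finiteness at \<open>z0\<close> passes to all z
  because the kernels are comparable, and the remaining claims are consequences of it.\<close>

lemma trace_representation:
  fixes \<Xi> :: "real \<Rightarrow> 'h::complex_hilbert_space \<Rightarrow>\<^sub>L 'h" and B :: "complex \<Rightarrow> 'h \<Rightarrow>\<^sub>L 'h"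
  assumes sep: "separable_space (euclidean :: 'h topology)"
    and \<Xi>: "\<And>t. \<Xi> t \<in> cbounded_ops" "\<And>t. op_nonneg (\<Xi> t)"
    and \<Xi>m [measurable]: "\<And>f g. (\<lambda>t. cinner f (\<Xi> t g)) \<in> borel_measurable borel"
    and B: "\<And>z. Im z > 0 \<Longrightarrow> B z \<in> cbounded_ops" "\<And>z. Im z > 0 \<Longrightarrow> op_nonneg (B z)"
    and rep: "\<And>z e. Im z > 0 \<Longrightarrow> ennreal (Re (cinner e (B z e))) =
      (\<integral>\<^sup>+t. ennreal (Im z * inverse ((cmod (of_real t - z))\<^sup>2) * Re (cinner e (\<Xi> t e))) \<partial>lborel)"
    and tc: "Im z0 > 0" "trace_class (B z0)"
  shows "(\<forall>z. Im z > 0 \<longrightarrow> trace_class (B z)) \<and>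
    (AE t in lebesgue. op_nonneg (\<Xi> t) \<and> trace_class (\<Xi> t)) \<and>
    (AE t in lebesgue. op_trace (\<Xi> t) \<in> \<real>\<^sub>\<ge>\<^sub>0) \<and>
    (\<forall>K. compact K \<longrightarrow> set_integrable lebesgue K (\<lambda>t. op_trace (\<Xi> t))) \<and>
    (\<integral>\<^sup>+ t. ennreal (inverse (1 + t\<^sup>2) * Re (op_trace (\<Xi> t))) \<partial>lebesgue) < \<infinity> \<and>
    (\<forall>z. Im z > 0 \<longrightarrow>
      integrable lebesgue
        (\<lambda>t. op_trace (\<Xi> t) * complex_of_real (inverse ((cmod (complex_of_real t - z))\<^sup>2))) \<and>
      op_trace (B z) = complex_of_real (Im z) *
        (LINT t|lebesgue. op_trace (\<Xi> t) * complex_of_real (inverse ((cmod (complex_of_real t - z))\<^sup>2))))"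
proof -
  obtain E :: "'h set" where E: "is_onb E" using tc(2) by (auto simp: trace_class_def)
  note cE = onb_countable[OF sep E]
  define p where "p = (\<lambda>z t. inverse ((cmod (complex_of_real t - z))\<^sup>2))"
  have pm [measurable]: "p z \<in> borel_measurable borel" for z unfolding p_def by (rule measurable_poisson)
  have p0: "0 \<le> p z t" for z t by (simp add: p_def)
  define \<tau> where "\<tau> = (\<lambda>t. nn_trace E (\<Xi> t))"
  \<comment> \<open>\<open>\<tau>\<close> may be infinite on a null set; \<open>g\<close> has the
    value 0 there, which is exactly what \<open>op_trace\<close> returns.\<close>
  define g where "g = (\<lambda>t. enn2real (\<tau> t))"
  have trB: "nn_trace E (B z) = (\<integral>\<^sup>+t. ennreal (Im z * p z t) * \<tau> t \<partial>lborel)"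
    and \<tau>m: "\<tau> \<in> borel_measurable borel" if "Im z > 0" for z
  proof -
    have 1: "(\<lambda>t. Im z * p z t) \<in> borel_measurable borel" by measurable
    have 2: "0 \<le> Im z * p z t" for t using that p0 by simp
    have 3: "ennreal (Re (cinner e (B z e))) = (\<integral>\<^sup>+t. ennreal (Im z * p z t * Re (cinner e (\<Xi> t e))) \<partial>lborel)" for e
      unfolding p_def by (rule rep[OF that])
    show "nn_trace E (B z) = (\<integral>\<^sup>+t. ennreal (Im z * p z t) * \<tau> t \<partial>lborel)" "\<tau> \<in> borel_measurable borel"
      unfolding \<tau>_def by (rule nn_trace_integral[OF cE 1 2 \<Xi>m 3])+
  qed
  have \<tau>m [measurable]: "\<tau> \<in> borel_measurable borel" using \<tau>m[OF tc(1)] .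
  have gm [measurable]: "g \<in> borel_measurable borel" unfolding g_def by measurable
  have g0: "0 \<le> g t" for t by (simp add: g_def)
  have op\<Xi>: "op_trace (\<Xi> t) = of_real (g t)" for t
    unfolding g_def \<tau>_def by (rule op_trace_nn_trace[OF sep \<Xi> E])
  have fin: "(\<integral>\<^sup>+t. ennreal (p z t) * \<tau> t \<partial>lborel) < \<infinity>" if z: "Im z > 0" for z
  proof -
    obtain c where c: "c \<ge> 0" "\<And>t. p z t \<le> c * p z0 t"
      using poisson_kernel_comparison[OF z tc(1)] unfolding p_def by blast
    define d where "d = c / Im z0"
    have d: "d \<ge> 0" using c tc(1) by (simp add: d_def)
    have "(\<integral>\<^sup>+t. ennreal (p z t) * \<tau> t \<partial>lborel) \<le> (\<integral>\<^sup>+t. ennreal d * (ennreal (Im z0 * p z0 t) * \<tau> t) \<partial>lborel)"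
    proof (rule nn_integral_mono)
      fix t
      have "p z t \<le> d * (Im z0 * p z0 t)" using c(2)[of t] tc(1) by (simp add: d_def)
      then have "ennreal (p z t) \<le> ennreal d * ennreal (Im z0 * p z0 t)"
        using d by (simp add: ennreal_mult'[symmetric] ennreal_leI)
      then show "ennreal (p z t) * \<tau> t \<le> ennreal d * (ennreal (Im z0 * p z0 t) * \<tau> t)"
        by (simp add: mult.assoc[symmetric] mult_right_mono)
    qed
    also have "\<dots> = ennreal d * nn_trace E (B z0)"
      unfolding trB[OF tc(1)] by (rule nn_integral_cmult) measurable
    also have "\<dots> < \<infinity>"
      using tc(2) trace_class_iff_nn_trace[OF sep B[OF tc(1)] E] by (simp add: ennreal_mult_less_top)
    finally show ?thesis .
  qed
  have split: "(\<integral>\<^sup>+t. ennreal (Im z * p z t) * \<tau> t \<partial>lborel) = ennreal (Im z) * (\<integral>\<^sup>+t. ennreal (p z t) * \<tau> t \<partial>lborel)"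
    if "Im z > 0" for z
    using that p0 by (simp add: ennreal_mult' mult.assoc nn_integral_cmult)
  have tcB: "trace_class (B z)" if z: "Im z > 0" for z
    using fin[OF z] trace_class_iff_nn_trace[OF sep B[OF z] E]
    unfolding trB[OF z] split[OF z] by (simp add: ennreal_mult_less_top)
  \<comment> \<open>The kernel at i is positive everywhere, so finiteness of the integral makes
    \<open>\<tau>\<close> finite almost everywhere.\<close>
  have "AE t in lborel. ennreal (p \<i> t) * \<tau> t \<noteq> \<infinity>"
    using fin[of \<i>] by (intro nn_integral_noteq_infinite) auto
  then have fin\<tau>: "AE t in lborel. \<tau> t < \<infinity>"
  proof eventually_elim
    case (elim t)
    have "p \<i> t > 0" unfolding p_def using of_real_plus_i_nz(2)[of t] by simp
    then show ?case using elim by (metis ennreal_mult_eq_top_iff ennreal_eq_0_iff infinity_ennreal_def less_top not_less)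
  qed
  then have "AE t in lebesgue. \<tau> t < \<infinity>" by (rule AE_completion)
  then have tc\<Xi>: "AE t in lebesgue. op_nonneg (\<Xi> t) \<and> trace_class (\<Xi> t)"
    by eventually_elim (simp add: trace_class_iff_nn_trace[OF sep \<Xi> E] \<tau>_def \<Xi>)
  have pg: "(\<integral>\<^sup>+t. ennreal (p z t * g t) \<partial>lborel) = (\<integral>\<^sup>+t. ennreal (p z t) * \<tau> t \<partial>lborel)" for z
  proof (rule nn_integral_cong_AE)
    show "AE t in lborel. ennreal (p z t * g t) = ennreal (p z t) * \<tau> t"
      using fin\<tau> by eventually_elim (simp add: g_def ennreal_mult' p0)
  qed
  have int: "integrable lborel (\<lambda>t. p z t * g t)" if "Im z > 0" for z
    by (rule integrableI_nonneg) (use fin[OF that] p0 g0 in \<open>auto simp: pg\<close>)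
  have eq: "op_trace (\<Xi> t) * complex_of_real (inverse ((cmod (complex_of_real t - z))\<^sup>2)) = complex_of_real (p z t * g t)" for t z
    by (simp add: op\<Xi> p_def mult.commute)
  have cm: "(\<lambda>t. complex_of_real (p z t * g t)) \<in> borel_measurable lborel" for z by measurable
  have intc: "integrable lebesgue (\<lambda>t. complex_of_real (p z t * g t))" if "Im z > 0" for z
    unfolding integrable_completion[OF cm] by (rule integrable_of_real[OF int[OF that]])
  have trace: "op_trace (B z) = complex_of_real (Im z) * (LINT t|lebesgue. complex_of_real (p z t * g t))"
    if z: "Im z > 0" for z
  proof -
    have "nn_trace E (B z) = ennreal (Im z) * (\<integral>\<^sup>+t. ennreal (p z t * g t) \<partial>lborel)"
      unfolding trB[OF z] split[OF z] pg ..
    also have "(\<integral>\<^sup>+t. ennreal (p z t * g t) \<partial>lborel) = ennreal (LINT t|lborel. p z t * g t)"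
      by (rule nn_integral_eq_integral[OF int[OF z]]) (simp add: p0 g0)
    finally have "enn2real (nn_trace E (B z)) = Im z * (LINT t|lborel. p z t * g t)"
      using z p0 g0 by (simp add: enn2real_mult)
    then show ?thesis
      unfolding op_trace_nn_trace[OF sep B[OF z] E] integral_completion[OF cm]
      by (simp del: of_real_mult add: integral_of_real) simp
  qed
  \<comment> \<open>The Poisson kernel at i is the weight of the theorem, so weighted integrability
    is the case z = i.\<close>
  have pi: "p \<i> t = inverse (1 + t\<^sup>2)" for t by (simp add: p_def cmod_power2 add.commute)
  have "(\<integral>\<^sup>+ t. ennreal (inverse (1 + t\<^sup>2) * Re (op_trace (\<Xi> t))) \<partial>lebesgue) = (\<integral>\<^sup>+t. ennreal (p \<i> t * g t) \<partial>lborel)"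
    by (simp add: op\<Xi> pi nn_integral_completion)
  also have "\<dots> < \<infinity>" unfolding pg by (rule fin) simp
  finally have finite: "(\<integral>\<^sup>+ t. ennreal (inverse (1 + t\<^sup>2) * Re (op_trace (\<Xi> t))) \<partial>lebesgue) < \<infinity>" .
  have "set_integrable lebesgue K (\<lambda>t. op_trace (\<Xi> t))" if K: "compact K" for K
  proof -
    obtain R where R: "\<And>t. t \<in> K \<Longrightarrow> \<bar>t\<bar> \<le> R"
      using compact_imp_bounded[OF K] by (auto simp: bounded_iff)
    have Kb [measurable]: "K \<in> sets borel" using K by (rule borel_compact)
    have m: "(\<lambda>t. indicator K t *\<^sub>R complex_of_real (g t)) \<in> borel_measurable lborel" by measurable
    have "integrable lborel (\<lambda>t. indicator K t *\<^sub>R complex_of_real (g t))"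
    proof (rule Bochner_Integration.integrable_bound[OF _ m])
      show "integrable lborel (\<lambda>t. (1 + R\<^sup>2) * (p \<i> t * g t))" using int[of \<i>] by simp
      have "indicator K t * g t \<le> (1 + R\<^sup>2) * (p \<i> t * g t)" for t
      proof (cases "t \<in> K")
        case True
        have "t\<^sup>2 \<le> R\<^sup>2" using power_mono[OF R[OF True], of 2] by simp
        \<comment> \<open>On a compact set the weight is bounded below, so local integrability
          follows from the weighted one.\<close>
        then have "1 \<le> (1 + R\<^sup>2) * inverse (1 + t\<^sup>2)"
          using sum_power2_gt_zero_iff[of 1 t] by (simp add: field_simps)
        then have "1 * g t \<le> (1 + R\<^sup>2) * inverse (1 + t\<^sup>2) * g t" using g0 by (intro mult_right_mono)
        then show ?thesis using True by (simp add: pi mult.assoc)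
      qed (use p0 g0 in simp)
      then show "AE t in lborel. norm (indicator K t *\<^sub>R complex_of_real (g t)) \<le> norm ((1 + R\<^sup>2) * (p \<i> t * g t))"
        using p0 g0 by (intro AE_I2) (simp add: abs_mult)
    qed
    then show ?thesis unfolding set_integrable_def op\<Xi> integrable_completion[OF m] .
  qed
  then show ?thesis
    unfolding eq using tcB tc\<Xi> finite trace intc
    by (simp add: op\<Xi> g0 complex_nonneg_Reals_iff)
qed

section \<open>Integral representation of the logarithm and its trace formula\<close>

theorem theorem2p10:
  fixes M :: "complex \<Rightarrow> 'h::complex_hilbert_space \<Rightarrow>\<^sub>L 'h"
  assumes "separable_space (euclidean :: 'h topology)"
    and "herglotz_op M"
    and "\<exists>z0. Im z0 > 0 \<and> boundedly_invertible (M z0)"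
  shows "(\<forall>z. Im z > 0 \<longrightarrow> boundedly_invertible (M z)) \<and>
    (\<exists>(C :: 'h \<Rightarrow>\<^sub>L 'h) (\<Xi> :: real \<Rightarrow> 'h \<Rightarrow>\<^sub>L 'h).
      C \<in> cbounded_ops \<and> op_adj C = C \<and>
      (\<forall>t. \<Xi> t \<in> cbounded_ops \<and> op_adj (\<Xi> t) = \<Xi> t) \<and>
      weakly_measurable lebesgue \<Xi> \<and>
      (AE t in lebesgue. op_nonneg (\<Xi> t) \<and> op_nonneg (id_blinfun - \<Xi> t)) \<and>
      (\<forall>z. Im z > 0 \<longrightarrow>
        (\<exists>J. has_weak_integral lebesgue
               (\<lambda>t. (inverse (complex_of_real t - z)
                      - complex_of_real (t * inverse (1 + t\<^sup>2))) *\<^sub>C \<Xi> t) J \<and>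
             op_log (M z) = C + J)) \<and>
      ((\<exists>z0. Im z0 > 0 \<and> trace_class (op_Im (op_log (M z0)))) \<longrightarrow>
        (\<forall>z. Im z > 0 \<longrightarrow> trace_class (op_Im (op_log (M z)))) \<and>
        (AE t in lebesgue. op_nonneg (\<Xi> t) \<and> trace_class (\<Xi> t)) \<and>
        (AE t in lebesgue. op_trace (\<Xi> t) \<in> \<real>\<^sub>\<ge>\<^sub>0) \<and>
        (\<forall>K. compact K \<longrightarrow> set_integrable lebesgue K (\<lambda>t. op_trace (\<Xi> t))) \<and>
        (\<integral>\<^sup>+ t. ennreal (inverse (1 + t\<^sup>2) * Re (op_trace (\<Xi> t))) \<partial>lebesgue) < \<infinity> \<and>
        (\<forall>z. Im z > 0 \<longrightarrow>
          integrable lebesgue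
            (\<lambda>t. op_trace (\<Xi> t) * complex_of_real (inverse ((cmod (complex_of_real t - z))\<^sup>2))) \<and>
          op_trace (op_Im (op_log (M z))) =
            complex_of_real (Im z) *
            (LINT t|lebesgue. op_trace (\<Xi> t) *
               complex_of_real (inverse ((cmod (complex_of_real t - z))\<^sup>2))))))"
proof -
  note sep = assms(1) and M = assms(2)
  have inv: "boundedly_invertible (M z)" if "Im z > 0" for z
    using assms(3) herglotz_invertible[OF M _ _ that] by blast
  define L where "L = (\<lambda>z. op_log (M z))"
  have Lc: "L z \<in> cbounded_ops" if "Im z > 0" for z
    unfolding L_def by (rule op_log(1)[OF herglotz_dissipative[OF M that] inv[OF that]])
  have Lb: "0 \<le> Im (cinner f (L z f))" "Im (cinner f (L z f)) \<le> pi * (norm f)\<^sup>2" if "Im z > 0" for z f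
    unfolding L_def by (rule op_log_Im_bounds[OF herglotz_dissipative[OF M that] inv[OF that]])+
  have Ld: "(\<lambda>z. cinner f (L z f)) field_differentiable at z" if "Im z > 0" for z f
    unfolding L_def by (rule op_log_field_differentiable[OF M inv that])
  define k where "k = (\<lambda>z t. inverse (complex_of_real t - z) - complex_of_real (t * inverse (1 + t\<^sup>2)))"
  obtain \<Xi> :: "real \<Rightarrow> 'h \<Rightarrow>\<^sub>L 'h" where \<Xi>: "\<And>t. \<Xi> t \<in> cbounded_ops"
    "\<And>t. op_nonneg (\<Xi> t)" "\<And>t. op_nonneg (id_blinfun - \<Xi> t)"
    "\<And>f g. (\<lambda>t. cinner f (\<Xi> t g)) \<in> borel_measurable borel"
    and rep0: "\<And>z f. Im z > 0 \<Longrightarrow> has_bochner_integral lborel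
      (\<lambda>t. (inverse (of_real t - z) - of_real (t * inverse (1 + t\<^sup>2))) * cinner f (\<Xi> t f))
      (cinner f (L z f) - of_real (Re (cinner f (L \<i> f))))"
    by (rule bounded_herglotz_representation[OF sep Lc Ld Lb]) (assumption | rule that)+
  have rep: "has_bochner_integral lborel (\<lambda>t. k z t * cinner f (\<Xi> t f)) (cinner f (L z f) - of_real (Re (cinner f (L \<i> f))))"
    if "Im z > 0" for z f
    unfolding k_def by (rule rep0[OF that])
  note [measurable] = \<Xi>(4)
  have km [measurable]: "k z \<in> borel_measurable borel" for z unfolding k_def by measurable
  note \<Xi>r = op_nonnegD[OF \<Xi>(2)]
  \<comment> \<open>The real part of the logarithm at i, written through
    \<open>op_Im\<close>.\<close>
  define C where "C = L \<i> - \<i> *\<^sub>C op_Im (L \<i>)"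
  have Li: "L \<i> \<in> cbounded_ops" by (rule Lc) simp
  have Cc: "C \<in> cbounded_ops" unfolding C_def using Li cinner_op_Im(1)[OF Li] by simp
  have Cq: "cinner f (C f) = of_real (Re (cinner f (L \<i> f)))" for f
    unfolding C_def blinfun.diff_left blinfun_apply_scaleC cinner_diff_right cinner_scaleC_right cinner_op_Im(2)[OF Li]
    by (simp add: complex_eq_iff)
  have Cadj: "op_adj C = C" by (rule op_adj_self[OF Cc]) (simp add: Cq)
  have \<Xi>adj: "op_adj (\<Xi> t) = \<Xi> t" for t by (rule op_adj_self[OF \<Xi>(1) \<Xi>r(3)])
  have wm: "weakly_measurable lebesgue \<Xi>"
    unfolding weakly_measurable_def using \<Xi>(4) by (auto intro!: measurable_completion)
  have wi: "has_weak_integral lebesgue (\<lambda>t. k z t *\<^sub>C \<Xi> t) (L z - C)" if z: "Im z > 0" for z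
  proof (rule weak_integral_of_quadratic_forms)
    show "k z t *\<^sub>C \<Xi> t \<in> cbounded_ops" for t using \<Xi>(1) by simp
    show "L z - C \<in> cbounded_ops" using Lc[OF z] Cc by simp
    show "has_bochner_integral lebesgue (\<lambda>t. cinner f ((k z t *\<^sub>C \<Xi> t) f)) (cinner f ((L z - C) f))" for f
    proof -
      have "has_bochner_integral lebesgue (\<lambda>t. k z t * cinner f (\<Xi> t f)) (cinner f (L z f) - of_real (Re (cinner f (L \<i> f))))"
        by (rule has_bochner_integral_lebesgue[OF rep[OF z]]) measurable
      then show ?thesis
        unfolding blinfun_apply_scaleC cinner_scaleC_right blinfun.diff_left cinner_diff_right Cq .
    qed
  qed
  define B where "B = (\<lambda>z. op_Im (L z))"
  have Bc: "B z \<in> cbounded_ops" and Bq: "cinner e (B z e) = of_real (Im (cinner e (L z e)))" if "Im z > 0" for z e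
    unfolding B_def using cinner_op_Im[OF Lc[OF that]] by auto
  have Bn: "op_nonneg (B z)" if "Im z > 0" for z
    using Lb(1)[OF that] by (simp add: op_nonneg_def Bq[OF that] complex_nonneg_Reals_iff)
  have Brep: "ennreal (Re (cinner e (B z e))) =
      (\<integral>\<^sup>+t. ennreal (Im z * inverse ((cmod (of_real t - z))\<^sup>2) * Re (cinner e (\<Xi> t e))) \<partial>lborel)"
    if z: "Im z > 0" for z e
  proof -
    \<comment> \<open>The regularizing term of the kernel is real, so taking imaginary parts leaves
      the Poisson kernel.\<close>
    have "Im (k z t * cinner e (\<Xi> t e)) = Im z * inverse ((cmod (of_real t - z))\<^sup>2) * Re (cinner e (\<Xi> t e))" for t
    proof -
      have "Im (k z t) = Im z * inverse ((cmod (of_real t - z))\<^sup>2)"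
        by (simp add: k_def cmod_power2 divide_inverse)
      moreover have "Im (cinner e (\<Xi> t e)) = 0" using \<Xi>(2)[of t] by (simp add: op_nonneg_def complex_nonneg_Reals_iff)
      ultimately show ?thesis by simp
    qed
    then have "has_bochner_integral lborel (\<lambda>t. Im z * inverse ((cmod (of_real t - z))\<^sup>2) * Re (cinner e (\<Xi> t e))) (Im (cinner e (L z e)))"
      using has_bochner_integral_Im[OF rep[OF z, of e]] by simp
    then show ?thesis
      using z \<Xi>r(2) nn_integral_eq_integral[of lborel "\<lambda>t. Im z * inverse ((cmod (of_real t - z))\<^sup>2) * Re (cinner e (\<Xi> t e))"]
      by (simp add: Bq[OF z] has_bochner_integral_iff)
  qed
  have log: "\<exists>J. has_weak_integral lebesgue
               (\<lambda>t. (inverse (complex_of_real t - z)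
                      - complex_of_real (t * inverse (1 + t\<^sup>2))) *\<^sub>C \<Xi> t) J \<and>
             op_log (M z) = C + J" if "Im z > 0" for z
    using wi[OF that] by (intro exI[of _ "L z - C"]) (simp add: k_def L_def)
  note tr = trace_representation[OF sep \<Xi>(1,2,4) Bc Bn Brep, unfolded B_def L_def]
  show ?thesis
    by (intro conjI exI[of _ C] exI[of _ \<Xi>]; (rule impI, elim exE conjE, rule tr, assumption, assumption)?)
      (use inv log Cc Cadj \<Xi> \<Xi>adj wm in auto)
qed

end
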